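(* Let $k$ be an algebraically closed field of characteristic $p>0$, let $(\mathbf 0\in C)$ be a germ of smooth $k$-curve, and let $f\colon(X,\Delta)\to C$ be a family of pairs such that $X$ is normal, the closed fibers of $X\to C$ are demi-normal with only separable nodes, the generic fiber of $X\to C$ is geometrically normal, and $K_X+\Delta$ is $\mathbb{Q}$-Cartier. Let $E$ be a prime divisor over $X$. If $E$ is vertical (mapping to $\mathbf 0$), wild and not $T_{X/C}$-invariant, then $\gamma_w(E)\in p\mathbb{Z}_{\geq0}$.
   Context: $k$ is an algebraically closed field of characteristic $p>0$. Varieties are reduced and equidimensional. Family of pairs $f\colon(X,\Delta)\to C$: $X$ is a variety, Gorenstein in codimension one; $f\colon X\to C$ is flat, separated, closed, essentially of finite type, with pure-dimensional, geometrically connected and geometrically reduced fibers; $\Delta$ is an effective $\mathbb{Q}$-divisor on $X$ whose support contains no irreducible component of any fiber $X_c$, and no irreducible component of $X_c\cap\mathrm{Supp}(\Delta)$ is contained in $\mathrm{Sing}(X_c)$. Demi-normal: $S_2$ and at worst nodal in codimension one; a node at a codimension-one point $x$ is separable if the degree two extension of the residue field $k(x)$ given by the reduced preimage of $x$ in the normalization is étale. Let $E$ lie on a normal birational model $Y\to X$ and map to $\mathbf 0$. Let $t$ be a uniformizer of $\mathcal{O}_{C,\mathbf 0}$, $s$ a uniformizer of $\mathcal{O}_{Y,E}$, $n=\mathrm{ord}_E Y_{\mathbf 0}$ the multiplicity of $E$ in the fiber over $\mathbf 0$, $t=us^n$ with $u$ a unit. $E$ is wild if $p\mid n$; in that case $\gamma_w(E)=\max\{r\ge0\mid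 s^r\text{ divides }du\text{ in }\Omega^1_{\mathcal{O}_{Y,E}/k}\}$. $E$ is $T_{X/C}$-invariant if every $\theta\in\mathrm{Der}_k(\mathcal{O}_{Y,E})$ with $\theta(t)=0$ maps the maximal ideal of $\mathcal{O}_{Y,E}$ into itself. *)

theory Defs
  imports
    "HOL-Analysis.Abstract_Topology"
    "HOL-Library.Extended_Nat"
    "HOL-Computational_Algebra.Primes"
    "HOL-Algebra.Ideal_Product"
    "HOL-Algebra.Generated_Rings"
    "HOL-Algebra.Generated_Fields"
    "HOL-Algebra.Algebraic_Closure"
begin

section \<open>Commutative algebra\<close>

text \<open>All rings are commutative. \<open>max_ideal\<close> is only meaningful for local rings.\<close>

definition local_ring :: "('r, 'm) ring_scheme \<Rightarrow> bool"
  where "local_ring R \<longleftrightarrow> cring R \<and> (\<exists>!m. maximalideal m R)"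

definition max_ideal :: "('r, 'm) ring_scheme \<Rightarrow> 'r set"
  where "max_ideal R = carrier R - Units R"

definition reduced_ring :: "('r, 'm) ring_scheme \<Rightarrow> bool"
  where "reduced_ring R \<longleftrightarrow>
    (\<forall>x\<in>carrier R. \<forall>n::nat. x [^]\<^bsub>R\<^esub> n = \<zero>\<^bsub>R\<^esub> \<longrightarrow> x = \<zero>\<^bsub>R\<^esub>)"

definition radical :: "('r, 'm) ring_scheme \<Rightarrow> 'r set \<Rightarrow> 'r set"
  where "radical R I = {x \<in> carrier R. \<exists>n::nat. x [^]\<^bsub>R\<^esub> n \<in> I}"

definition krull_dim :: "('r, 'm) ring_scheme \<Rightarrow> enat"
  where "krull_dim R =
    Sup {enat n | n. \<exists>P. (\<forall>i\<le>n. primeideal (P i) R) \<and> (\<forall>i<n. P i \<subset> P (Suc i))}"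

definition regular_sequence :: "('r, 'm) ring_scheme \<Rightarrow> 'r list \<Rightarrow> bool"
  where "regular_sequence R xs \<longleftrightarrow> set xs \<subseteq> max_ideal R \<and>
    (\<forall>i<length xs. \<forall>r\<in>carrier R.
       r \<otimes>\<^bsub>R\<^esub> xs ! i \<in> Idl\<^bsub>R\<^esub> (set (take i xs)) \<longrightarrow> r \<in> Idl\<^bsub>R\<^esub> (set (take i xs)))"

definition depth :: "('r, 'm) ring_scheme \<Rightarrow> enat"
  where "depth R = Sup {enat (length xs) | xs. regular_sequence R xs}"

definition regular_local :: "('r, 'm) ring_scheme \<Rightarrow> bool"
  where "regular_local R \<longleftrightarrow> local_ring R \<and> noetherian_ring R \<and>
    (\<exists>S\<subseteq>carrier R. finite S \<and> enat (card S) = krull_dim R \<and> Idl\<^bsub>R\<^esub> S = max_ideal R)"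

text \<open>A noetherian local ring is Gorenstein iff it is Cohen--Macaulay and its quotient by a
  maximal regular sequence has a one-dimensional socle.\<close>

definition gorenstein_local :: "('r, 'm) ring_scheme \<Rightarrow> bool"
  where "gorenstein_local R \<longleftrightarrow> local_ring R \<and> noetherian_ring R \<and>
    (\<exists>xs. regular_sequence R xs \<and> enat (length xs) = krull_dim R \<and>
      (let A = R Quot (Idl\<^bsub>R\<^esub> (set xs)) in
        \<exists>e\<in>carrier A. e \<noteq> \<zero>\<^bsub>A\<^esub> \<and>
          {x \<in> carrier A. \<forall>a\<in>max_ideal A. a \<otimes>\<^bsub>A\<^esub> x = \<zero>\<^bsub>A\<^esub>} = PIdl\<^bsub>A\<^esub> e))"

definition integral_closure :: "('r, 'm) ring_scheme \<Rightarrow> 'r set \<Rightarrow> 'r set"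
  where "integral_closure R A = {x \<in> carrier R. \<exists>q\<in>carrier (univ_poly R A).
    q \<noteq> [] \<and> lead_coeff q = \<one>\<^bsub>R\<^esub> \<and> ring.eval R q x = \<zero>\<^bsub>R\<^esub>}"

text \<open>Rings of fractions \<open>S\<inverse>R\<close>, with zero divisors allowed: a fraction is the set of all
  pairs (numerator, denominator) representing it. The unions below are unions of copies of one
  and the same class.\<close>

definition fraction :: "('r, 'm) ring_scheme \<Rightarrow> 'r set \<Rightarrow> 'r \<Rightarrow> 'r \<Rightarrow> ('r \<times> 'r) set"
  where "fraction R S r s = {(r', s'). r' \<in> carrier R \<and> s' \<in> S \<and>
    (\<exists>w\<in>S. w \<otimes>\<^bsub>R\<^esub> (r \<otimes>\<^bsub>R\<^esub> s' \<ominus>\<^bsub>R\<^esub> r' \<otimes>\<^bsub>R\<^esub> s) = \<zero>\<^bsub>R\<^esub>)}"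

definition ring_of_fractions :: "('r, 'm) ring_scheme \<Rightarrow> 'r set \<Rightarrow> ('r \<times> 'r) set ring"
  where "ring_of_fractions R S =
    \<lparr> carrier = {fraction R S r s | r s. r \<in> carrier R \<and> s \<in> S},
      monoid.mult = (\<lambda>x y. \<Union>(a, s)\<in>x. \<Union>(b, t)\<in>y. fraction R S (a \<otimes>\<^bsub>R\<^esub> b) (s \<otimes>\<^bsub>R\<^esub> t)),
      one = fraction R S \<one>\<^bsub>R\<^esub> \<one>\<^bsub>R\<^esub>,
      zero = fraction R S \<zero>\<^bsub>R\<^esub> \<one>\<^bsub>R\<^esub>,
      add = (\<lambda>x y. \<Union>(a, s)\<in>x. \<Union>(b, t)\<in>y.
        fraction R S (a \<otimes>\<^bsub>R\<^esub> t \<oplus>\<^bsub>R\<^esub> b \<otimes>\<^bsub>R\<^esub> s) (s \<otimes>\<^bsub>R\<^esub> t)) \<rparr>"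

definition nonzerodivisors :: "('r, 'm) ring_scheme \<Rightarrow> 'r set"
  where "nonzerodivisors R =
    {s \<in> carrier R. \<forall>r\<in>carrier R. s \<otimes>\<^bsub>R\<^esub> r = \<zero>\<^bsub>R\<^esub> \<longrightarrow> r = \<zero>\<^bsub>R\<^esub>}"

abbreviation total_fractions :: "('r, 'm) ring_scheme \<Rightarrow> ('r \<times> 'r) set ring"
  where "total_fractions R \<equiv> ring_of_fractions R (nonzerodivisors R)"

definition to_fractions :: "('r, 'm) ring_scheme \<Rightarrow> 'r \<Rightarrow> ('r \<times> 'r) set"
  where "to_fractions R r = fraction R (nonzerodivisors R) r \<one>\<^bsub>R\<^esub>"

text \<open>The normalization of a reduced noetherian ring.\<close>

definition normalization :: "('r, 'm) ring_scheme \<Rightarrow> ('r \<times> 'r) set ring"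
  where "normalization R = (total_fractions R)
    \<lparr> carrier := integral_closure (total_fractions R) (to_fractions R ` carrier R) \<rparr>"

definition normal_domain :: "('r, 'm) ring_scheme \<Rightarrow> bool"
  where "normal_domain R \<longleftrightarrow>
    domain R \<and> carrier (normalization R) = to_fractions R ` carrier R"


section \<open>Modules, differentials, tensor products\<close>

text \<open>The fields \<open>mult\<close> and \<open>one\<close> of the library record of modules play no role.\<close>

definition free_module :: "('r, 'm) ring_scheme \<Rightarrow> 'b set \<Rightarrow> ('r, 'b \<Rightarrow> 'r) module"
  where "free_module R B =
    \<lparr> carrier = {f. (\<forall>b. f b \<in> carrier R) \<and> finite {b. f b \<noteq> \<zero>\<^bsub>R\<^esub>} \<and> {b. f b \<noteq> \<zero>\<^bsub>R\<^esub>} \<subseteq> B},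
      monoid.mult = undefined, one = undefined,
      zero = (\<lambda>_. \<zero>\<^bsub>R\<^esub>),
      add = (\<lambda>f g b. f b \<oplus>\<^bsub>R\<^esub> g b),
      smult = (\<lambda>a f b. a \<otimes>\<^bsub>R\<^esub> f b) \<rparr>"

definition free_gen :: "('r, 'm) ring_scheme \<Rightarrow> 'b \<Rightarrow> 'b \<Rightarrow> 'r"
  where "free_gen R b = (\<lambda>x. if x = b then \<one>\<^bsub>R\<^esub> else \<zero>\<^bsub>R\<^esub>)"

definition submodule_span ::
    "('r, 'm) ring_scheme \<Rightarrow> ('r, 'e) module \<Rightarrow> 'e set \<Rightarrow> 'e set"
  where "submodule_span R M S = \<Inter>{N. submodule N R M \<and> S \<subseteq> N}"

definition quotient_module :: "('r, 'e) module \<Rightarrow> 'e set \<Rightarrow> ('r, 'e set) module"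
  where "quotient_module M N =
    \<lparr> carrier = a_rcosets\<^bsub>M\<^esub> N, monoid.mult = undefined, one = undefined,
      zero = N, add = set_add M,
      smult = (\<lambda>a A. \<Union>x\<in>A. N +>\<^bsub>M\<^esub> (a \<odot>\<^bsub>M\<^esub> x)) \<rparr>"

text \<open>Kaehler differentials \<open>\<Omega>\<^sup>1\<close> of \<open>R\<close> over a subring \<open>k\<close>: generators \<open>d a\<close> for \<open>a \<in> R\<close>,
  subject to additivity, the Leibniz rule and \<open>d c = 0\<close> for \<open>c \<in> k\<close>.\<close>

definition kaehler_relations :: "('r, 'm) ring_scheme \<Rightarrow> 'r set \<Rightarrow> ('r \<Rightarrow> 'r) set"
  where "kaehler_relations R k =
    (let M = free_module R (carrier R); d = free_gen R in
      submodule_span R M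
        ({d (a \<oplus>\<^bsub>R\<^esub> b) \<ominus>\<^bsub>M\<^esub> (d a \<oplus>\<^bsub>M\<^esub> d b) | a b. a \<in> carrier R \<and> b \<in> carrier R} \<union>
         {d (a \<otimes>\<^bsub>R\<^esub> b) \<ominus>\<^bsub>M\<^esub> (a \<odot>\<^bsub>M\<^esub> d b \<oplus>\<^bsub>M\<^esub> b \<odot>\<^bsub>M\<^esub> d a) | a b.
            a \<in> carrier R \<and> b \<in> carrier R} \<union>
         {d c | c. c \<in> k}))"

definition kaehler :: "('r, 'm) ring_scheme \<Rightarrow> 'r set \<Rightarrow> ('r, ('r \<Rightarrow> 'r) set) module"
  where "kaehler R k = quotient_module (free_module R (carrier R)) (kaehler_relations R k)"

definition differential :: "('r, 'm) ring_scheme \<Rightarrow> 'r set \<Rightarrow> 'r \<Rightarrow> ('r \<Rightarrow> 'r) set"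
  where "differential R k a =
    kaehler_relations R k +>\<^bsub>free_module R (carrier R)\<^esub> free_gen R a"

text \<open>The \<open>d\<close>-th exterior power: generated by lists \<open>[x\<^sub>1, \<dots>, x\<^sub>d]\<close>, the wedges, subject to
  multilinearity and alternation.\<close>

definition wedge_gens :: "('r, 'e) module \<Rightarrow> nat \<Rightarrow> 'e list set"
  where "wedge_gens M d = {l. length l = d \<and> set l \<subseteq> carrier M}"

definition wedge_relations ::
    "('r, 'm) ring_scheme \<Rightarrow> ('r, 'e) module \<Rightarrow> nat \<Rightarrow> ('e list \<Rightarrow> 'r) set"
  where "wedge_relations R M d =
    (let L = free_module R (wedge_gens M d); w = free_gen R in
      submodule_span R L
        ({w (l[i := x \<oplus>\<^bsub>M\<^esub> y]) \<ominus>\<^bsub>L\<^esub> (w (l[i := x]) \<oplus>\<^bsub>L\<^esub> w (l[i := y])) | l i x y.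
            l \<in> wedge_gens M d \<and> i < d \<and> x \<in> carrier M \<and> y \<in> carrier M} \<union>
         {w (l[i := a \<odot>\<^bsub>M\<^esub> x]) \<ominus>\<^bsub>L\<^esub> a \<odot>\<^bsub>L\<^esub> w (l[i := x]) | l i a x.
            l \<in> wedge_gens M d \<and> i < d \<and> a \<in> carrier R \<and> x \<in> carrier M} \<union>
         {w l | l. l \<in> wedge_gens M d \<and> (\<exists>i j. i < j \<and> j < d \<and> l ! i = l ! j)}))"

definition exterior_power ::
    "('r, 'm) ring_scheme \<Rightarrow> ('r, 'e) module \<Rightarrow> nat \<Rightarrow> ('r, ('e list \<Rightarrow> 'r) set) module"
  where "exterior_power R M d =
    quotient_module (free_module R (wedge_gens M d)) (wedge_relations R M d)"

definition wedge ::
    "('r, 'm) ring_scheme \<Rightarrow> ('r, 'e) module \<Rightarrow> nat \<Rightarrow> 'e list \<Rightarrow> ('e list \<Rightarrow> 'r) set"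
  where "wedge R M d l =
    wedge_relations R M d +>\<^bsub>free_module R (wedge_gens M d)\<^esub> free_gen R l"

text \<open>A finite algebra \<open>B\<close> over a field \<open>\<kappa> \<subseteq> B\<close> is etale iff it is unramified, flatness being
  automatic.\<close>

definition etale_over_field :: "('r, 'm) ring_scheme \<Rightarrow> 'r set \<Rightarrow> bool"
  where "etale_over_field B \<kappa> \<longleftrightarrow> ring.finite_dimension B \<kappa> (carrier B) \<and>
    carrier (kaehler B \<kappa>) = {\<zero>\<^bsub>kaehler B \<kappa>\<^esub>}"

text \<open>The tensor product of two algebras \<open>\<phi> : R \<rightarrow> A\<close> and \<open>\<psi> : R \<rightarrow> B\<close> is the quotient of the
  monoid ring \<open>\<int>[A \<times> B]\<close> of the multiplicative monoid \<open>A \<times> B\<close> by the relations of bilinearity.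
  The ideal they generate is already their additive span.\<close>

definition monoid_ring :: "('g, 'm) monoid_scheme \<Rightarrow> ('g \<Rightarrow> int) ring"
  where "monoid_ring G =
    \<lparr> carrier = {f. finite {x. f x \<noteq> 0} \<and> {x. f x \<noteq> 0} \<subseteq> carrier G},
      monoid.mult = (\<lambda>f g z. \<Sum>(x, y) \<in> {(x, y). f x \<noteq> 0 \<and> g y \<noteq> 0 \<and> x \<otimes>\<^bsub>G\<^esub> y = z}. f x * g y),
      one = (\<lambda>x. if x = \<one>\<^bsub>G\<^esub> then 1 else 0),
      zero = (\<lambda>_. 0),
      add = (\<lambda>f g x. f x + g x) \<rparr>"

definition single :: "'g \<Rightarrow> 'g \<Rightarrow> int"
  where "single x = (\<lambda>y. if y = x then 1 else 0)"

definition tensor_ideal :: "('r, 'm) ring_scheme \<Rightarrow> ('r \<Rightarrow> 'a) \<Rightarrow> ('a, 'n) ring_scheme \<Rightarrow>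
    ('r \<Rightarrow> 'b) \<Rightarrow> ('b, 'l) ring_scheme \<Rightarrow> ('a \<times> 'b \<Rightarrow> int) set"
  where "tensor_ideal R \<phi> A \<psi> B =
    (let Z = monoid_ring (A \<times>\<times> B) in
      Idl\<^bsub>Z\<^esub>
        ({single (a \<oplus>\<^bsub>A\<^esub> a', b) \<ominus>\<^bsub>Z\<^esub> (single (a, b) \<oplus>\<^bsub>Z\<^esub> single (a', b)) | a a' b.
            a \<in> carrier A \<and> a' \<in> carrier A \<and> b \<in> carrier B} \<union>
         {single (a, b \<oplus>\<^bsub>B\<^esub> b') \<ominus>\<^bsub>Z\<^esub> (single (a, b) \<oplus>\<^bsub>Z\<^esub> single (a, b')) | a b b'.
            a \<in> carrier A \<and> b \<in> carrier B \<and> b' \<in> carrier B} \<union>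
         {single (\<phi> r \<otimes>\<^bsub>A\<^esub> a, b) \<ominus>\<^bsub>Z\<^esub> single (a, \<psi> r \<otimes>\<^bsub>B\<^esub> b) | r a b.
            r \<in> carrier R \<and> a \<in> carrier A \<and> b \<in> carrier B}))"

definition tensor_ring :: "('r, 'm) ring_scheme \<Rightarrow> ('r \<Rightarrow> 'a) \<Rightarrow> ('a, 'n) ring_scheme \<Rightarrow>
    ('r \<Rightarrow> 'b) \<Rightarrow> ('b, 'l) ring_scheme \<Rightarrow> ('a \<times> 'b \<Rightarrow> int) set ring"
  where "tensor_ring R \<phi> A \<psi> B = monoid_ring (A \<times>\<times> B) Quot (tensor_ideal R \<phi> A \<psi> B)"

definition tensor_class :: "('r, 'm) ring_scheme \<Rightarrow> ('r \<Rightarrow> 'a) \<Rightarrow> ('a, 'n) ring_scheme \<Rightarrow>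
    ('r \<Rightarrow> 'b) \<Rightarrow> ('b, 'l) ring_scheme \<Rightarrow> ('a \<times> 'b \<Rightarrow> int) \<Rightarrow> ('a \<times> 'b \<Rightarrow> int) set"
  where "tensor_class R \<phi> A \<psi> B g = tensor_ideal R \<phi> A \<psi> B +>\<^bsub>monoid_ring (A \<times>\<times> B)\<^esub> g"

text \<open>Flatness of a ring \<open>B\<close> over a subring \<open>A\<close> of a common ring \<open>K\<close>, by the equational
  criterion: every linear relation in \<open>B\<close> with coefficients in \<open>A\<close> comes from relations
  in \<open>A\<close>.\<close>

definition flat_over :: "('r, 'm) ring_scheme \<Rightarrow> 'r set \<Rightarrow> 'r set \<Rightarrow> bool"
  where "flat_over K A B \<longleftrightarrow> (\<forall>(n::nat) a b.
    (\<forall>i<n. a i \<in> A \<and> b i \<in> B) \<and> (\<Oplus>\<^bsub>K\<^esub>i\<in>{..<n}. a i \<otimes>\<^bsub>K\<^esub> b i) = \<zero>\<^bsub>K\<^esub> \<longrightarrow>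
    (\<exists>(m::nat) y e. (\<forall>j<m. y j \<in> B) \<and> (\<forall>i<n. \<forall>j<m. e i j \<in> A) \<and>
      (\<forall>i<n. b i = (\<Oplus>\<^bsub>K\<^esub>j\<in>{..<m}. e i j \<otimes>\<^bsub>K\<^esub> y j)) \<and>
      (\<forall>j<m. (\<Oplus>\<^bsub>K\<^esub>i\<in>{..<n}. a i \<otimes>\<^bsub>K\<^esub> e i j) = \<zero>\<^bsub>K\<^esub>)))"


section \<open>Topological notions\<close>

definition irreducible_in :: "'p topology \<Rightarrow> 'p set \<Rightarrow> bool"
  where "irreducible_in T Z \<longleftrightarrow> Z \<subseteq> topspace T \<and> Z \<noteq> {} \<and>
    (\<forall>A B. closedin T A \<and> closedin T B \<and> Z \<subseteq> A \<union> B \<longrightarrow> Z \<subseteq> A \<or> Z \<subseteq> B)"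

definition irreducible_components :: "'p topology \<Rightarrow> 'p set set"
  where "irreducible_components T =
    {Z. irreducible_in T Z \<and> (\<forall>Z'. irreducible_in T Z' \<and> Z \<subseteq> Z' \<longrightarrow> Z' = Z)}"

definition space_dim :: "'p topology \<Rightarrow> enat"
  where "space_dim T = Sup {enat n | n. \<exists>Z.
    (\<forall>i\<le>n. closedin T (Z i) \<and> irreducible_in T (Z i)) \<and> (\<forall>i<n. Z i \<subset> Z (Suc i))}"

definition pure_dimensional :: "'p topology \<Rightarrow> bool"
  where "pure_dimensional T \<longleftrightarrow>
    (\<forall>Z\<in>irreducible_components T. \<forall>Z'\<in>irreducible_components T.
      space_dim (subtopology T Z) = space_dim (subtopology T Z'))"


section \<open>Integral schemes as sets of local rings\<close>

text \<open>A separated integral scheme, essentially of finite type over \<open>k\<close>, with function field \<open>K\<close>,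
  is given by the set of its local rings, viewed as subrings of \<open>K\<close>: points are local rings.
  These sets of local rings are exactly the schemes of Chevalley and Nagata, EGA I, 8.3.1; the
  three clauses of \<open>scheme_model\<close> are the axioms given there (in loc. cit. the \<open>A\<^sub>i\<close> are noetherian
  rings; here they are localizations of finitely generated \<open>k\<close>-algebras). The last clause is
  separatedness: two points with related local rings coincide.

  A subring \<open>A\<close> of \<open>K\<close>, as a ring in its own right, is written \<open>K\<lparr>carrier := A\<rparr>\<close>. In formulas the
  scheme is called \<open>XX\<close>, as HOL-Algebra reserves the token \<open>X\<close> for the polynomial variable.\<close>

definition dominates :: "('a, 'm) ring_scheme \<Rightarrow> 'a set \<Rightarrow> 'a set \<Rightarrow> bool"
  where "dominates K A B \<longleftrightarrow> A \<subseteq> B \<and> max_ideal (K\<lparr>carrier := A\<rparr>) \<subseteq> max_ideal (K\<lparr>carrier := B\<rparr>)"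
  \<comment> \<open>the local ring \<open>B\<close> dominates the local ring \<open>A\<close>\<close>

definition ess_finite_type :: "('a, 'm) ring_scheme \<Rightarrow> 'a set \<Rightarrow> 'a set \<Rightarrow> bool"
  where "ess_finite_type K k A \<longleftrightarrow> (\<exists>G S. finite G \<and> G \<subseteq> carrier K \<and>
    submonoid S K \<and> S \<subseteq> generate_ring K (k \<union> G) \<and> \<zero>\<^bsub>K\<^esub> \<notin> S \<and>
    A = {b \<otimes>\<^bsub>K\<^esub> inv\<^bsub>K\<^esub> s | b s. b \<in> generate_ring K (k \<union> G) \<and> s \<in> S})"

definition localize_at :: "('a, 'm) ring_scheme \<Rightarrow> 'a set \<Rightarrow> 'a set \<Rightarrow> 'a set"
  where "localize_at K A P = {a \<otimes>\<^bsub>K\<^esub> inv\<^bsub>K\<^esub> b | a b. a \<in> A \<and> b \<in> A - P}"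

definition affine_points :: "('a, 'm) ring_scheme \<Rightarrow> 'a set \<Rightarrow> 'a set set"
  where "affine_points K A = {localize_at K A P | P. primeideal P (K\<lparr>carrier := A\<rparr>)}"

definition scheme_model :: "('a, 'm) ring_scheme \<Rightarrow> 'a set \<Rightarrow> 'a set set \<Rightarrow> bool"
  where "scheme_model K k XX \<longleftrightarrow>
    (\<exists>\<U>. finite \<U> \<and> \<U> \<noteq> {} \<and> XX = (\<Union>A\<in>\<U>. affine_points K A) \<and>
      (\<forall>A\<in>\<U>. ess_finite_type K k A \<and>
         carrier K = {a \<otimes>\<^bsub>K\<^esub> inv\<^bsub>K\<^esub> b | a b. a \<in> A \<and> b \<in> A - {\<zero>\<^bsub>K\<^esub>}}) \<and>
      (\<forall>A\<in>\<U>. \<forall>B\<in>\<U>. \<exists>G. finite G \<and> G \<subseteq> carrier K \<and>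
         generate_ring K (A \<union> B) = generate_ring K (A \<union> G))) \<and>
    (\<forall>x\<in>XX. \<forall>y\<in>XX. (\<exists>V. subring V K \<and> local_ring (K\<lparr>carrier := V\<rparr>) \<and>
      dominates K x V \<and> dominates K y V) \<longrightarrow> x = y)"

definition zariski :: "('a, 'm) ring_scheme \<Rightarrow> 'a set set \<Rightarrow> 'a set topology"
  where "zariski K XX = topology_generated_by {{x \<in> XX. h \<in> x} | h. h \<in> carrier K}"

abbreviation codim_one_points :: "('a, 'm) ring_scheme \<Rightarrow> 'a set set \<Rightarrow> 'a set set"
  where "codim_one_points K XX \<equiv> {x \<in> XX. krull_dim (K\<lparr>carrier := x\<rparr>) = 1}"
  \<comment> \<open>generic points of the prime divisors\<close>

definition normal_model :: "('a, 'm) ring_scheme \<Rightarrow> 'a set set \<Rightarrow> bool"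
  where "normal_model K XX \<longleftrightarrow> (\<forall>x\<in>XX. normal_domain (K\<lparr>carrier := x\<rparr>))"

text \<open>Dominant morphisms \<open>X \<rightarrow> C\<close> inducing a given inclusion \<open>F \<subseteq> K\<close> of function fields: the
  image of \<open>x\<close> is the point whose local ring is dominated by \<open>x\<close>.\<close>

definition image_point :: "('a, 'm) ring_scheme \<Rightarrow> 'a set set \<Rightarrow> 'a set \<Rightarrow> 'a set"
  where "image_point K C x = (THE c. c \<in> C \<and> dominates K c x)"

definition dominant_morphism ::
    "('a, 'm) ring_scheme \<Rightarrow> 'a set set \<Rightarrow> 'a set \<Rightarrow> 'a set set \<Rightarrow> bool"
  where "dominant_morphism K XX F C \<longleftrightarrow> (\<forall>x\<in>XX. \<exists>!c. c \<in> C \<and> dominates K c x) \<and>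
    continuous_map (zariski K XX) (zariski (K\<lparr>carrier := F\<rparr>) C) (image_point K C)"

definition transcendence_degree :: "('a, 'm) ring_scheme \<Rightarrow> 'a set \<Rightarrow> nat \<Rightarrow> bool"
  where "transcendence_degree K k d \<longleftrightarrow> (\<exists>xs. length xs = d \<and> set xs \<subseteq> carrier K \<and>
    (\<forall>i<d. ring.transcendental K (generate_field K (k \<union> set (take i xs))) (xs ! i)) \<and>
    (\<forall>z\<in>carrier K. \<not> ring.transcendental K (generate_field K (k \<union> set xs)) z))"

text \<open>For \<open>k\<close> algebraically closed, smooth is the same as regular. Semi-local and local curves
  are included.\<close>

definition smooth_curve :: "('a, 'm) ring_scheme \<Rightarrow> 'a set \<Rightarrow> 'a set set \<Rightarrow> bool"
  where "smooth_curve F k C \<longleftrightarrow> scheme_model F k C \<and> transcendence_degree F k 1 \<and>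
    (\<forall>c\<in>C. regular_local (F\<lparr>carrier := c\<rparr>))"

abbreviation closed_point :: "('a, 'm) ring_scheme \<Rightarrow> 'a set set \<Rightarrow> 'a set \<Rightarrow> bool"
  where "closed_point F C c \<equiv> c \<in> C \<and> closedin (zariski F C) {c}"


section \<open>Fibers\<close>

definition fiber :: "('a, 'm) ring_scheme \<Rightarrow> 'a set set \<Rightarrow> 'a set \<Rightarrow> 'a set set"
  where "fiber K XX c = {x \<in> XX. dominates K c x}"

definition fiber_ring :: "('a, 'm) ring_scheme \<Rightarrow> 'a set \<Rightarrow> 'a set \<Rightarrow> 'a set ring"
  where "fiber_ring K c x =
    (K\<lparr>carrier := x\<rparr>) Quot (Idl\<^bsub>K\<lparr>carrier := x\<rparr>\<^esub> (max_ideal (K\<lparr>carrier := c\<rparr>)))"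

abbreviation fiber_space :: "('a, 'm) ring_scheme \<Rightarrow> 'a set set \<Rightarrow> 'a set \<Rightarrow> 'a set topology"
  where "fiber_space K XX c \<equiv> subtopology (zariski K XX) (fiber K XX c)"

text \<open>The geometric fiber over \<open>c\<close> is the fiber product of \<open>X\<close> with the spectrum of an algebraic
  closure of the residue field of \<open>c\<close>. Its points over \<open>x \<in> X\<close> are the primes of the
  tensor product ring \<open>geom_ring K c x\<close> lying over the maximal ideal of \<open>x\<close>.\<close>

definition residue_field :: "('a, 'm) ring_scheme \<Rightarrow> 'a set \<Rightarrow> 'a set ring"
  where "residue_field K c = (K\<lparr>carrier := c\<rparr>) Quot (max_ideal (K\<lparr>carrier := c\<rparr>))"

definition residue_closure :: "('a, 'm) ring_scheme \<Rightarrow> 'a set \<Rightarrow>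
    (('a set list \<times> nat) multiset \<Rightarrow> 'a set) ring"
  where "residue_closure K c = field.alg_closure (residue_field K c)"

definition to_residue_closure :: "('a, 'm) ring_scheme \<Rightarrow> 'a set \<Rightarrow> 'a \<Rightarrow>
    (('a set list \<times> nat) multiset \<Rightarrow> 'a set)"
  where "to_residue_closure K c a = ring.indexed_const (residue_field K c)
    (max_ideal (K\<lparr>carrier := c\<rparr>) +>\<^bsub>K\<lparr>carrier := c\<rparr>\<^esub> a)"

abbreviation geom_ring where "geom_ring K c x \<equiv>
  tensor_ring (K\<lparr>carrier := c\<rparr>) id (K\<lparr>carrier := x\<rparr>) (to_residue_closure K c) (residue_closure K c)"

abbreviation geom_class where "geom_class K c x \<equiv>
  tensor_class (K\<lparr>carrier := c\<rparr>) id (K\<lparr>carrier := x\<rparr>) (to_residue_closure K c) (residue_closure K c)"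

definition geom_fiber where "geom_fiber K XX c =
  {(x, Q). x \<in> XX \<and> dominates K c x \<and> primeideal Q (geom_ring K c x) \<and>
     {a \<in> x. geom_class K c x (single (a, \<one>\<^bsub>residue_closure K c\<^esub>)) \<in> Q} =
       max_ideal (K\<lparr>carrier := x\<rparr>)}"

text \<open>An element \<open>\<Sum> a\<^sub>i \<otimes> l\<^sub>i\<close> defines a function near those points \<open>x\<close> whose local ring contains
  all the \<open>a\<^sub>i\<close>; the basic open sets are the loci where such a function is defined and does not
  vanish.\<close>

definition geom_fiber_space where "geom_fiber_space K XX c =
  topology_generated_by
    {{(x, Q) \<in> geom_fiber K XX c.
        {z. g z \<noteq> 0} \<subseteq> x \<times> carrier (residue_closure K c) \<and> geom_class K c x g \<notin> Q} | g.
      finite {z. g z \<noteq> 0}}"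

definition geom_local_ring where "geom_local_ring K c x Q =
  ring_of_fractions (geom_ring K c x) (carrier (geom_ring K c x) - Q)"

definition geometrically_connected_fiber where "geometrically_connected_fiber K XX c \<longleftrightarrow>
  connected_space (geom_fiber_space K XX c)"

definition geometrically_reduced_fiber where "geometrically_reduced_fiber K XX c \<longleftrightarrow>
  (\<forall>(x, Q)\<in>geom_fiber K XX c. reduced_ring (geom_local_ring K c x Q))"

definition geometrically_normal_fiber where "geometrically_normal_fiber K XX c \<longleftrightarrow>
  (\<forall>(x, Q)\<in>geom_fiber K XX c. normal_domain (geom_local_ring K c x Q))"


section \<open>Nodes and demi-normality\<close>

text \<open>A node is a ring \<open>S / (f)\<close> with \<open>S\<close> regular local of dimension two and \<open>f \<in> m\<^sup>2\<close>, where \<open>f\<close> is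
  not, modulo \<open>m\<^sup>3\<close>, a scalar multiple of a square (in particular \<open>f \<notin> m\<^sup>3\<close>). It is harmless that
  \<open>S\<close> has the same underlying type as \<open>R\<close>: for \<open>R\<close> essentially of finite type over the infinite
  field \<open>k\<close>, the ring \<open>S\<close> can be chosen so too, hence of the same cardinality as \<open>k\<close>.\<close>

definition node :: "'r ring \<Rightarrow> bool"
  where "node R \<longleftrightarrow> (\<exists>(S :: 'r ring) f. regular_local S \<and> krull_dim S = 2 \<and>
    (let m = max_ideal S; m2 = m \<cdot>\<^bsub>S\<^esub> m; m3 = m2 \<cdot>\<^bsub>S\<^esub> m in
      f \<in> m2 \<and>
      \<not> (\<exists>a\<in>carrier S. \<exists>l\<in>m. f \<ominus>\<^bsub>S\<^esub> a \<otimes>\<^bsub>S\<^esub> (l \<otimes>\<^bsub>S\<^esub> l) \<in> m3)) \<and>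
    R \<simeq> S Quot (PIdl\<^bsub>S\<^esub> f))"

text \<open>\<open>B\<close> is the coordinate ring of the reduced preimage, in the normalization, of the closed
  point of \<open>R\<close>, and \<open>\<kappa>\<close> is the image in \<open>B\<close> of the residue field of \<open>R\<close>.\<close>

definition separable_node :: "'r ring \<Rightarrow> bool"
  where "separable_node R \<longleftrightarrow> node R \<and>
    (let N = normalization R;
         J = radical N (Idl\<^bsub>N\<^esub> (to_fractions R ` max_ideal R));
         B = N Quot J;
         \<kappa> = (\<lambda>r. J +>\<^bsub>N\<^esub> to_fractions R r) ` carrier R
     in ring.dimension B 2 \<kappa> (carrier B) \<and> etale_over_field B \<kappa>)"

definition demi_normal_fiber :: "'a ring \<Rightarrow> 'a set set \<Rightarrow> 'a set \<Rightarrow> bool"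
  where "demi_normal_fiber K XX c \<longleftrightarrow>
    (\<forall>x\<in>fiber K XX c. depth (fiber_ring K c x) \<ge> min 2 (krull_dim (fiber_ring K c x))) \<and>
    (\<forall>x\<in>fiber K XX c. krull_dim (fiber_ring K c x) \<le> 1 \<longrightarrow>
       regular_local (fiber_ring K c x) \<or> node (fiber_ring K c x))"

definition only_separable_nodes :: "'a ring \<Rightarrow> 'a set set \<Rightarrow> 'a set \<Rightarrow> bool"
  where "only_separable_nodes K XX c \<longleftrightarrow>
    (\<forall>x\<in>fiber K XX c. krull_dim (fiber_ring K c x) = 1 \<and> node (fiber_ring K c x) \<longrightarrow>
       separable_node (fiber_ring K c x))"


section \<open>Divisors and families of pairs\<close>

text \<open>A Weil divisor is a function on points, supported on finitely many points of
  codimension one.\<close>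

definition effective_divisor :: "'a ring \<Rightarrow> 'a set set \<Rightarrow> ('a set \<Rightarrow> rat) \<Rightarrow> bool"
  where "effective_divisor K XX \<Delta> \<longleftrightarrow> (\<forall>D. \<Delta> D \<ge> 0) \<and> finite {D. \<Delta> D \<noteq> 0} \<and>
    {D. \<Delta> D \<noteq> 0} \<subseteq> codim_one_points K XX"

definition divisor_support :: "'a ring \<Rightarrow> 'a set set \<Rightarrow> ('a set \<Rightarrow> rat) \<Rightarrow> 'a set set"
  where "divisor_support K XX \<Delta> = (\<Union>D\<in>{D. \<Delta> D \<noteq> 0}. zariski K XX closure_of {D})"

text \<open>Being separated and covered by finitely many algebras
  essentially of finite type over \<open>k\<close>, a model \<open>X\<close> is also separated and essentially of finite type
  over \<open>C\<close>; as \<open>X\<close> is integral, it is reduced and equidimensional.\<close>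

definition family_of_pairs ::
    "'a ring \<Rightarrow> 'a set \<Rightarrow> 'a set set \<Rightarrow> 'a set \<Rightarrow> 'a set set \<Rightarrow> ('a set \<Rightarrow> rat) \<Rightarrow> bool"
  where "family_of_pairs K k XX F C \<Delta> \<longleftrightarrow>
    scheme_model K k XX \<and>
    (\<forall>x\<in>XX. krull_dim (K\<lparr>carrier := x\<rparr>) \<le> 1 \<longrightarrow> gorenstein_local (K\<lparr>carrier := x\<rparr>)) \<and>
    dominant_morphism K XX F C \<and>
    (\<forall>x\<in>XX. flat_over K (image_point K C x) x) \<and>
    closed_map (zariski K XX) (zariski (K\<lparr>carrier := F\<rparr>) C) (image_point K C) \<and>
    (\<forall>c\<in>C. pure_dimensional (fiber_space K XX c) \<and>
      geometrically_connected_fiber K XX c \<and> geometrically_reduced_fiber K XX c) \<and>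
    effective_divisor K XX \<Delta> \<and>
    (\<forall>c\<in>C. \<forall>Z\<in>irreducible_components (fiber_space K XX c). \<not> Z \<subseteq> divisor_support K XX \<Delta>) \<and>
    (\<forall>c\<in>C. \<forall>Z\<in>irreducible_components
        (subtopology (zariski K XX) (fiber K XX c \<inter> divisor_support K XX \<Delta>)).
      \<not> Z \<subseteq> {x \<in> fiber K XX c. \<not> regular_local (fiber_ring K c x)})"

definition uniformizer :: "'a ring \<Rightarrow> 'a set \<Rightarrow> 'a \<Rightarrow> bool"
  where "uniformizer K D s \<longleftrightarrow> s \<in> D \<and> s \<noteq> \<zero>\<^bsub>K\<^esub> \<and>
    max_ideal (K\<lparr>carrier := D\<rparr>) = PIdl\<^bsub>K\<lparr>carrier := D\<rparr>\<^esub> s"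

definition order_of_vanishing :: "'a ring \<Rightarrow> 'a set \<Rightarrow> 'a \<Rightarrow> int"
  where "order_of_vanishing K D h = (THE n. \<exists>s. uniformizer K D s \<and>
    (\<exists>v\<in>Units (K\<lparr>carrier := D\<rparr>). h = v \<otimes>\<^bsub>K\<^esub> s [^]\<^bsub>K\<^esub> n))"

text \<open>Rational \<open>d\<close>-forms, \<open>d\<close> being the dimension, and the lattice of those forms that are regular
  along a prime divisor. The order of a form along a divisor is its order with respect to this
  lattice; the canonical divisor is the divisor of any nonzero rational \<open>d\<close>-form.\<close>

definition rational_forms where "rational_forms K k d = exterior_power K (kaehler K k) d"

definition regular_forms where "regular_forms K k d D =
  submodule_span (K\<lparr>carrier := D\<rparr>) (rational_forms K k d)
    {wedge K (kaehler K k) d (map (differential K k) as) | as. length as = d \<and> set as \<subseteq> D}"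

definition order_of_form where "order_of_form K k d D \<omega> =
  (THE n::int. \<exists>s. uniformizer K D s \<and>
     (\<exists>\<eta>\<in>regular_forms K k d D. \<omega> = (s [^]\<^bsub>K\<^esub> n) \<odot>\<^bsub>rational_forms K k d\<^esub> \<eta>) \<and>
     \<not> (\<exists>\<eta>\<in>regular_forms K k d D. \<omega> = (s [^]\<^bsub>K\<^esub> (n + 1)) \<odot>\<^bsub>rational_forms K k d\<^esub> \<eta>))"

text \<open>\<open>K\<^sub>X + \<Delta>\<close> is Q-Cartier: some multiple \<open>m (K\<^sub>X + \<Delta>)\<close>, \<open>m \<ge> 1\<close>, is locally the divisor of a
  rational function.\<close>

definition log_canonical_divisor_Q_Cartier ::
    "'a ring \<Rightarrow> 'a set \<Rightarrow> 'a set set \<Rightarrow> ('a set \<Rightarrow> rat) \<Rightarrow> bool"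
  where "log_canonical_divisor_Q_Cartier K k XX \<Delta> \<longleftrightarrow>
    (\<exists>d. transcendence_degree K k d \<and>
      (\<exists>\<omega>\<in>carrier (rational_forms K k d). \<omega> \<noteq> \<zero>\<^bsub>rational_forms K k d\<^esub> \<and>
        (\<exists>m::nat. m \<ge> 1 \<and>
          (\<forall>x\<in>XX. \<exists>U h. openin (zariski K XX) U \<and> x \<in> U \<and> h \<in> carrier K \<and> h \<noteq> \<zero>\<^bsub>K\<^esub> \<and>
            (\<forall>D \<in> U \<inter> codim_one_points K XX.
              of_nat m * (of_int (order_of_form K k d D \<omega>) + \<Delta> D) =
                of_int (order_of_vanishing K D h))))))"


section \<open>Prime divisors over \<open>X\<close>\<close>

text \<open>A prime divisor over \<open>X\<close> is (the local ring of) a prime divisor \<open>E\<close> on a normal birational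
  model \<open>Y \<rightarrow> X\<close>; \<open>X\<close> and \<open>Y\<close> have the same function field \<open>K\<close>.\<close>

definition prime_divisor_over :: "'a ring \<Rightarrow> 'a set \<Rightarrow> 'a set set \<Rightarrow> 'a set \<Rightarrow> bool"
  where "prime_divisor_over K k XX E \<longleftrightarrow> (\<exists>Y. scheme_model K k Y \<and> normal_model K Y \<and>
    dominant_morphism K Y (carrier K) XX \<and> E \<in> codim_one_points K Y)"

definition derivations :: "('r, 'm) ring_scheme \<Rightarrow> 'r set \<Rightarrow> ('r \<Rightarrow> 'r) set"
  where "derivations R k = {\<theta>. \<theta> \<in> carrier R \<rightarrow> carrier R \<and>
    (\<forall>a\<in>carrier R. \<forall>b\<in>carrier R. \<theta> (a \<oplus>\<^bsub>R\<^esub> b) = \<theta> a \<oplus>\<^bsub>R\<^esub> \<theta> b) \<and>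
    (\<forall>a\<in>carrier R. \<forall>b\<in>carrier R. \<theta> (a \<otimes>\<^bsub>R\<^esub> b) = a \<otimes>\<^bsub>R\<^esub> \<theta> b \<oplus>\<^bsub>R\<^esub> b \<otimes>\<^bsub>R\<^esub> \<theta> a) \<and>
    (\<forall>c\<in>k. \<theta> c = \<zero>\<^bsub>R\<^esub>)}"

definition T_invariant :: "'a ring \<Rightarrow> 'a set \<Rightarrow> 'a set \<Rightarrow> 'a \<Rightarrow> bool"
  where "T_invariant K k E t \<longleftrightarrow> (\<forall>\<theta>\<in>derivations (K\<lparr>carrier := E\<rparr>) k. \<theta> t = \<zero>\<^bsub>K\<^esub> \<longrightarrow>
    \<theta> ` max_ideal (K\<lparr>carrier := E\<rparr>) \<subseteq> max_ideal (K\<lparr>carrier := E\<rparr>))"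

definition gamma_w :: "'a ring \<Rightarrow> 'a set \<Rightarrow> 'a set \<Rightarrow> 'a \<Rightarrow> 'a \<Rightarrow> nat"
  where "gamma_w K k E s u = Max {r. \<exists>\<omega>\<in>carrier (kaehler (K\<lparr>carrier := E\<rparr>) k).
    differential (K\<lparr>carrier := E\<rparr>) k u =
      (s [^]\<^bsub>K\<^esub> r) \<odot>\<^bsub>kaehler (K\<lparr>carrier := E\<rparr>) k\<^esub> \<omega>}"

end

theory Submission
  imports Defs
begin

text \<open>
  Let \<open>V\<close> be the discrete valuation ring of \<open>E\<close>, with uniformizer \<open>s\<close>. The order of \<open>du\<close> along \<open>s\<close> can be
  computed with derivations: the differentials of \<open>V\<close> over \<open>k\<close> have a basis \<open>dy\<^sub>1, \<dots>, dy\<^sub>N\<close> with dual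
  derivations \<open>\<partial>\<^sub>1, \<dots>, \<partial>\<^sub>N\<close>, so \<open>s\<^sup>r\<close> divides \<open>du\<close> if and only if it divides \<open>D u\<close> for every \<open>k\<close>-derivation
  \<open>D\<close> of \<open>V\<close>.

  If \<open>E\<close> is not invariant, there is a derivation \<open>\<theta>\<close> with \<open>\<theta>(t) = 0\<close> for which \<open>\<theta>(s)\<close> is a unit. As \<open>p\<close> divides
  \<open>n\<close>, also \<open>\<theta>(s\<^sup>n) = 0\<close> and therefore \<open>\<theta>(u) = 0\<close>. Suppose that \<open>s\<^sup>r\<close> divides all \<open>D u\<close>, and write \<open>D u = s\<^sup>r c\<close>.
  The commutator of \<open>\<theta>\<close> and \<open>D\<close> sends \<open>u\<close> to \<open>\<theta>(D u) = s\<^sup>r \<theta>(c) + r s\<^sup>r\<^sup>-\<^sup>1 \<theta>(s) c\<close>, and this is divisible by \<open>s\<^sup>r\<close>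
  as well. If \<open>p\<close> does not divide \<open>r\<close>, it follows that \<open>s\<close> divides \<open>c\<close>. So \<open>s\<^sup>r\<^sup>+\<^sup>1\<close> divides all \<open>D u\<close>, and \<open>r\<close> is
  not the largest exponent (\<open>divisibility_improves\<close>, \<open>p_divides_order_of_differential\<close>).

  There is a largest exponent because \<open>du \<noteq> 0\<close>, that is, because \<open>u\<close> is not a \<open>p\<close>-th power; otherwise \<open>t\<close>
  would be the \<open>p\<close>-th power of some \<open>w\<close> in the function field of \<open>X\<close>. The generic fiber of a family of pairs
  is geometrically reduced, so \<open>w\<close> would lie in the function field of \<open>C\<close>
  (\<open>pth_root_in_generic_base\<close>). There \<open>t\<close> has no root, being a uniformizer
  (\<open>uniformizer_not_pth_power\<close>).

  The dual derivations come from a construction of \<open>V\<close> in finitely many steps from the ring of its \<open>p\<close>-th powers, each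
  of which adjoins one \<open>p\<close>-th root \<open>y\<close> whose powers \<open>1, y, \<dots>, y\<^sup>p\<^sup>-\<^sup>1\<close> are independent. Derivations extend over
  such a step, with an arbitrary value at \<open>y\<close> (\<open>derivation_extends_to_adjoin\<close>,
  \<open>dual_basis_adjoin\<close>). One first adjoins elements whose residue classes are new, and
  \<open>s\<close> in the end (\<open>dual_basis_exists\<close>). That this exhausts \<open>V\<close> follows from Nakayama's lemma, as \<open>V\<close>
  is finitely generated over its \<open>p\<close>-th powers; here \<open>k\<close> is perfect and \<open>V\<close> essentially of finite type
  over it (\<open>finitely_generated_over_pth_powers\<close>).
\<close>

section \<open>Rings of characteristic \<open>p\<close>\<close>

lemma (in cring) binomial_theorem:
  assumes x: "x \<in> carrier R" and y: "y \<in> carrier R"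
  shows "(x \<oplus> y) [^] (n::nat) = (\<Oplus>i\<in>{..n}. add_pow R (n choose i) (x [^] i \<otimes> y [^] (n - i)))"
proof (induction n)
  case 0
  then show ?case using x y by (simp add: add_pow_def)
next
  case (Suc n)
  let ?b = "\<lambda>n i. add_pow R (n choose i) (x [^] i \<otimes> y [^] (n - i))"
  let ?f = "\<lambda>i. add_pow R (n choose i) (x [^] i \<otimes> y [^] (Suc n - i))"
  have b: "?b m i \<in> carrier R" for m i using x y by simp
  have f: "?f i \<in> carrier R" for i using x y by simp
  have pascal: "?b (Suc n) (Suc i) = x \<otimes> ?b n i \<oplus> ?f (Suc i)" if "i \<le> n" for i
  proof -
    have "?b (Suc n) (Suc i) = add_pow R (n choose i) (x [^] Suc i \<otimes> y [^] (n - i)) \<oplus> ?f (Suc i)"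
      using x y by (simp add: add.nat_pow_mult)
    also have "add_pow R (n choose i) (x [^] Suc i \<otimes> y [^] (n - i)) = x \<otimes> ?b n i"
      using x y by (simp add: add_pow_rdistr m_ac)
    finally show ?thesis .
  qed
  have yb: "y \<otimes> ?b n i = ?f i" if "i \<le> n" for i
    using x y that by (simp add: add_pow_rdistr Suc_diff_le m_ac)
  have fS: "add_pow R (n choose Suc i) (x [^] Suc i \<otimes> y [^] (n - i)) \<in> carrier R" for i
    using x y by simp
  have top: "?f (Suc n) = \<zero>" using x y by (simp add: binomial_eq_0 del: nat_pow_Suc)
  have "(\<Oplus>i\<in>{..Suc n}. ?b (Suc n) i) = (\<Oplus>i\<in>{..n}. ?b (Suc n) (Suc i)) \<oplus> ?b (Suc n) 0"
    using b by (subst finsum_Suc2) auto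
  also have "(\<Oplus>i\<in>{..n}. ?b (Suc n) (Suc i)) = (\<Oplus>i\<in>{..n}. x \<otimes> ?b n i \<oplus> ?f (Suc i))"
  proof (rule finsum_cong'[OF refl])
    have "x \<otimes> ?b n i \<oplus> ?f (Suc i) \<in> carrier R" for i
      by (intro a_closed m_closed b f x)
    then show "(\<lambda>i. x \<otimes> ?b n i \<oplus> ?f (Suc i)) \<in> {..n} \<rightarrow> carrier R" by blast
  qed (simp only: pascal atMost_iff)
  also have "\<dots> = x \<otimes> (\<Oplus>i\<in>{..n}. ?b n i) \<oplus> (\<Oplus>i\<in>{..n}. ?f (Suc i))"
    using b f fS x by (subst finsum_addf) (auto simp: finsum_rdistr simp del: binomial_Suc_Suc diff_Suc_Suc nat_pow_Suc Group.nat_pow_Suc)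
  also have "?b (Suc n) 0 = ?f 0" by simp
  also have "x \<otimes> (\<Oplus>i\<in>{..n}. ?b n i) \<oplus> (\<Oplus>i\<in>{..n}. ?f (Suc i)) \<oplus> ?f 0
      = x \<otimes> (\<Oplus>i\<in>{..n}. ?b n i) \<oplus> ((\<Oplus>i\<in>{..n}. ?f (Suc i)) \<oplus> ?f 0)"
    using b f x y by (intro a_assoc m_closed finsum_closed) auto
  also have "(\<Oplus>i\<in>{..n}. ?f (Suc i)) \<oplus> ?f 0 = (\<Oplus>i\<in>{..Suc n}. ?f i)"
    using f by (subst finsum_Suc2) auto
  also have "\<dots> = (\<Oplus>i\<in>{..n}. ?f i)"
    using f top by (subst finsum_Suc) auto
  also have "\<dots> = (\<Oplus>i\<in>{..n}. y \<otimes> ?b n i)"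
    by (intro finsum_cong') (use yb b f y in auto)
  also have "\<dots> = y \<otimes> (\<Oplus>i\<in>{..n}. ?b n i)"
    using b y by (simp add: finsum_rdistr)
  finally have "(\<Oplus>i\<in>{..Suc n}. ?b (Suc n) i) = (x \<oplus> y) \<otimes> (\<Oplus>i\<in>{..n}. ?b n i)"
    using b x y by (subst l_distr) auto
  then show ?case using Suc.IH x y b by (simp add: m_comm)
qed

locale char_p_ring = cring R for R (structure) +
  fixes p :: nat
  assumes prime_p: "Factorial_Ring.prime p" and char_p: "[p] \<cdot> \<one> = \<zero>"
begin

lemma p_pos: "p > 0" using prime_p by (rule prime_gt_0_nat)
lemma p_gt_1: "p > 1" using prime_p by (rule prime_gt_1_nat)

lemma dvd_add_pow:
  assumes "x \<in> carrier R" "p dvd m"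
  shows "[m] \<cdot> x = \<zero>"
proof -
  have "[p] \<cdot> x = [p] \<cdot> (\<one> \<otimes> x)" using assms by simp
  also have "\<dots> = \<zero>" using assms(1) char_p by (subst add_pow_ldistr[symmetric]) auto
  finally have *: "[p] \<cdot> x = \<zero>" .
  obtain q where "m = p * q" using assms(2) by blast
  then show ?thesis using * assms(1) add.nat_pow_pow[of x q p]
    by (simp add: mult.commute)
qed

lemma frobenius_add:
  assumes x: "x \<in> carrier R" and y: "y \<in> carrier R"
  shows "(x \<oplus> y) [^] p = x [^] p \<oplus> y [^] p"
proof -
  obtain q where q: "p = Suc q" using p_pos by (cases p) auto
  let ?b = "\<lambda>i. add_pow R (p choose i) (x [^] i \<otimes> y [^] (p - i))"
  have b: "?b i \<in> carrier R" for i using x y by simp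
  have mid: "?b i = \<zero>" if "0 < i" "i < p" for i
    using x y that prime_p by (intro dvd_add_pow dvd_choose_prime) auto
  have "(x \<oplus> y) [^] p = (\<Oplus>i\<in>{..Suc q}. ?b i)"
    using binomial_theorem[OF x y, of p] q by simp
  also have "\<dots> = ?b (Suc q) \<oplus> (\<Oplus>i\<in>{..q}. ?b i)"
    using b by (subst finsum_Suc) auto
  also have "(\<Oplus>i\<in>{..q}. ?b i) = (\<Oplus>i\<in>{..q}. if 0 = i then y [^] p else \<zero>)"
    by (intro finsum_cong') (use mid q x y in auto)
  also have "\<dots> = y [^] p" using y finsum_singleton[of 0 "{..q}" "\<lambda>_. y [^] p"] by auto
  finally show ?thesis using q x y by simp
qed

lemma frobenius_neg:
  assumes "x \<in> carrier R"
  shows "(\<ominus> x) [^] p = \<ominus> (x [^] p)"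
proof -
  have "(\<ominus> x) [^] p \<oplus> x [^] p = (\<ominus> x \<oplus> x) [^] p"
    using assms by (intro frobenius_add[symmetric]) auto
  also have "\<dots> = \<zero>" using assms p_pos by (simp add: l_neg nat_pow_zero)
  finally show ?thesis using assms by (intro minus_equality[symmetric]) auto
qed

end

lemma (in ring) eval_coeff_list:
  assumes "\<And>i. i < n \<Longrightarrow> a i \<in> carrier R" "x \<in> carrier R"
  shows "eval (map a (rev [0..<n])) x = (\<Oplus>i\<in>{..<n}. a i \<otimes> x [^] i)"
  using assms(1)
proof (induction n)
  case 0
  then show ?case by simp
next
  case (Suc n)
  then show ?case using assms(2)
    by (simp add: lessThan_Suc finsum_insert Pi_def)
qed

lemma (in domain) nonzero_pow_nonzero:
  assumes "x \<in> carrier R" "x \<noteq> \<zero>" shows "x [^] (n::nat) \<noteq> \<zero>"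
  using assms by (induction n) (auto simp: integral_iff)

locale char_p_field = field R + char_p_ring R p for R (structure) and p
begin

text \<open>One factor \<open>X - y\<close> at a time is peeled off, from the divisor \<open>f\<close> or from its cofactor \<open>q\<close>.\<close>

lemma monic_divisor_of_linear_power:
  assumes y: "y \<in> carrier R"
    and "f \<in> carrier (poly_ring R)" "q \<in> carrier (poly_ring R)" "lead_coeff f = \<one>" "f \<noteq> []"
    and "f \<otimes>\<^bsub>poly_ring R\<^esub> q = [\<one>, \<ominus> y] [^]\<^bsub>poly_ring R\<^esub> (m::nat)"
  shows "\<exists>e. f = [\<one>, \<ominus> y] [^]\<^bsub>poly_ring R\<^esub> (e::nat)"
  using assms(2-)
proof (induction m arbitrary: f q)
  case 0
  interpret UP: domain "poly_ring R" using univ_poly_is_domain[OF carrier_is_subring] .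
  have "f \<in> Units (poly_ring R)"
    using 0 UP.m_comm[of f q] unfolding Units_def by auto
  then obtain c where "f = [c]"
    using univ_poly_units[OF carrier_is_subfield] by auto
  then have "f = [\<one>, \<ominus> y] [^]\<^bsub>poly_ring R\<^esub> (0::nat)"
    using 0 by (simp add: univ_poly_one)
  then show ?case ..
next
  case (Suc m)
  interpret UP: domain "poly_ring R" using univ_poly_is_domain[OF carrier_is_subring] .
  let ?l = "[\<one>, \<ominus> y]"
  have l: "?l \<in> carrier (poly_ring R)" "?l \<noteq> \<zero>\<^bsub>poly_ring R\<^esub>"
    using y by (auto simp: sym[OF univ_poly_carrier] polynomial_def univ_poly_zero)
  let ?L = "?l [^]\<^bsub>poly_ring R\<^esub> m"
  have L: "?L \<in> carrier (poly_ring R)" using l by simp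
  note ev = ring_hom_memE[OF eval_is_hom[OF carrier_is_subring y]]
  have "eval ?l y = \<zero>" using y by (simp add: r_neg)
  then have "eval f y \<otimes> eval q y = \<zero>"
    using Suc.prems(5) ev(2)[OF Suc.prems(1,2)] ev(2)[OF L l(1)] ev(1)[OF L] by simp
  then consider "eval f y = \<zero>" | "eval q y = \<zero>"
    using integral ev(1) Suc.prems(1,2) by blast
  then show ?case
  proof cases
    case 1
    then have "?l pdivides f"
      using is_root_imp_pdivides[OF Suc.prems(1)] y Suc.prems(4) by (auto simp: is_root_def)
    then obtain f1 where f1: "f1 \<in> carrier (poly_ring R)" "f = ?l \<otimes>\<^bsub>poly_ring R\<^esub> f1"
      unfolding pdivides_def factor_def by auto
    have "f1 \<noteq> []" using f1 Suc.prems(4) UP.r_null[OF l(1)] univ_poly_zero[of R "carrier R"] by auto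
    have "lead_coeff (poly_mult ?l f1) = lead_coeff ?l \<otimes> lead_coeff f1"
      using f1(1) l(1) \<open>f1 \<noteq> []\<close>
      by (intro poly_mult_lead_coeff[OF carrier_is_subring]) (auto simp: univ_poly_carrier)
    moreover have "lead_coeff f1 \<in> carrier R"
      using f1(1) \<open>f1 \<noteq> []\<close> by (auto simp: sym[OF univ_poly_carrier] polynomial_def)
    ultimately have "lead_coeff f1 = \<one>"
      using Suc.prems(3) f1(2) by (simp add: univ_poly_mult del: poly_mult.simps)
    have "?l \<otimes>\<^bsub>poly_ring R\<^esub> (f1 \<otimes>\<^bsub>poly_ring R\<^esub> q) = f \<otimes>\<^bsub>poly_ring R\<^esub> q"
      using Suc.prems(2) f1 l by (simp add: UP.m_assoc)
    also have "\<dots> = ?l \<otimes>\<^bsub>poly_ring R\<^esub> ?L"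
      using Suc.prems(5) UP.m_comm[OF L l(1)] by simp
    finally have "?l \<otimes>\<^bsub>poly_ring R\<^esub> (f1 \<otimes>\<^bsub>poly_ring R\<^esub> q) = ?l \<otimes>\<^bsub>poly_ring R\<^esub> ?L" .
    then have "f1 \<otimes>\<^bsub>poly_ring R\<^esub> q = ?L"
      using UP.m_lcancel[OF l(2,1)] f1(1) Suc.prems(2) L by auto
    then obtain e :: nat where "f1 = ?l [^]\<^bsub>poly_ring R\<^esub> e"
      using Suc.IH[OF f1(1) Suc.prems(2) \<open>lead_coeff f1 = \<one>\<close> \<open>f1 \<noteq> []\<close>] by blast
    then have "f = ?l [^]\<^bsub>poly_ring R\<^esub> Suc e" using f1 l UP.m_comm by simp
    then show ?thesis ..
  next
    case 2
    have "q \<noteq> []"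
    proof
      assume "q = []"
      then have "?l [^]\<^bsub>poly_ring R\<^esub> (Suc m) = \<zero>\<^bsub>poly_ring R\<^esub>"
        using Suc.prems(1,5) by (metis UP.r_null univ_poly_zero)
      then show False using polynomial_pow_not_zero[OF l(1), of "Suc m"] by (simp add: univ_poly_zero)
    qed
    then have "?l pdivides q"
      using 2 is_root_imp_pdivides[OF Suc.prems(2)] y by (auto simp: is_root_def)
    then obtain q1 where q1: "q1 \<in> carrier (poly_ring R)" "q = ?l \<otimes>\<^bsub>poly_ring R\<^esub> q1"
      unfolding pdivides_def factor_def by auto
    have "?l \<otimes>\<^bsub>poly_ring R\<^esub> (f \<otimes>\<^bsub>poly_ring R\<^esub> q1) = f \<otimes>\<^bsub>poly_ring R\<^esub> q"
      using Suc.prems(1) q1 l by (simp add: UP.m_lcomm)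
    also have "\<dots> = ?l \<otimes>\<^bsub>poly_ring R\<^esub> ?L"
      using Suc.prems(5) UP.m_comm[OF L l(1)] by simp
    finally have "?l \<otimes>\<^bsub>poly_ring R\<^esub> (f \<otimes>\<^bsub>poly_ring R\<^esub> q1) = ?l \<otimes>\<^bsub>poly_ring R\<^esub> ?L" .
    then have "f \<otimes>\<^bsub>poly_ring R\<^esub> q1 = ?L"
      using UP.m_lcancel[OF l(2,1)] q1(1) Suc.prems(1) L by auto
    then show ?thesis using Suc.IH[OF Suc.prems(1) q1(1) Suc.prems(3,4)] by blast
  qed
qed

text \<open>Bezout's identity \<open>e a = p b + 1\<close> makes \<open>z\<close> a quotient of powers of \<open>z\<^sup>e\<close> and \<open>z\<^sup>p\<close>.\<close>

lemma root_mem_subfield_if_coprime_powers: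
  assumes L: "subfield L R" and z: "z \<in> carrier R" "z [^] p \<in> L" "z [^] (e::nat) \<in> L"
    and e: "0 < e" "e < p"
  shows "z \<in> L"
proof (cases "z = \<zero>")
  case True
  then show ?thesis using subringE(2)[OF subfieldE(1)[OF L]] by simp
next
  case False
  have pow: "w [^] (n::nat) \<in> L" if "w \<in> L" for w n
    using that subringE(3,6)[OF subfieldE(1)[OF L]] by (induction n) auto
  have "coprime e p" using e prime_p
    by (metis coprime_commute dvd_imp_le not_less prime_imp_coprime)
  then obtain a b where ab: "e * a = p * b + 1" using bezout_nat[of e p] e by auto
  have "z [^] (p * b) \<in> L - {\<zero>}"
    using pow[OF z(2), of b] z(1) False by (simp add: nat_pow_pow nonzero_pow_nonzero)
  moreover have "z [^] (p * b) \<otimes> z \<in> L"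
    using pow[OF z(3), of a] z(1) ab by (simp add: nat_pow_pow)
  ultimately show ?thesis using subfield_m_inv_simprule[OF L] z(1) by blast
qed

text \<open>If the powers were dependent, the minimal polynomial \<open>f\<close> of \<open>y\<close> over \<open>L\<close> would have degree \<open>e < p\<close>. As it
  divides \<open>X\<^sup>p - y\<^sup>p = (X - y)\<^sup>p\<close>, it equals \<open>(X - y)\<^sup>e\<close>, so that its constant coefficient \<open>(-y)\<^sup>e\<close> lies in
  \<open>L\<close>. Since \<open>y\<^sup>p\<close> lies in \<open>L\<close> too and \<open>e\<close> is prime to \<open>p\<close>, this forces \<open>y\<close> into \<open>L\<close>.\<close>

lemma powers_independent_over_subfield:
  assumes L: "subfield L R" and y: "y \<in> carrier R" "y [^] p \<in> L" "y \<notin> L"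
    and a: "\<And>i. i < p \<Longrightarrow> a i \<in> L" and sum: "(\<Oplus>i\<in>{..<p}. a i \<otimes> y [^] i) = \<zero>"
    and j: "j < p"
  shows "a j = \<zero>"
proof (rule ccontr)
  assume aj: "a j \<noteq> \<zero>"
  note Lr = subfieldE(1)[OF L]
  note Lc = subfieldE(3)[OF L]
  interpret UP: domain "poly_ring R" using univ_poly_is_domain[OF carrier_is_subring] .
  let ?g = "map a (rev [0..<p])"
  have g: "set ?g \<subseteq> L" using a by auto
  have gR: "set ?g \<subseteq> carrier R" using g Lc by auto
  have "eval ?g y = \<zero>"
    using eval_coeff_list[of p a y] a Lc y(1) sum by auto
  then have ev: "eval (normalize ?g) y = \<zero>" using eval_normalize[OF gR y(1)] by simp
  have ng: "normalize ?g \<in> carrier (L[X])"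
    using normalize_gives_polynomial[OF g] by (simp add: univ_poly_carrier)
  have "coeff ?g j = a j" using j by (simp add: coeff_nth rev_nth)
  then have ne: "normalize ?g \<noteq> []" using aj normalize_coeff[of ?g] by auto
  have alg: "(algebraic over L) y" using algebraicI[OF ng ne ev] .
  define f where "f = Irr L y"
  note I = IrrE[OF L y(1) alg, folded f_def]
  have f0: "f \<noteq> []" using pirreducibleE(1)[OF Lr I(1,2)] .
  have fR: "f \<in> carrier (poly_ring R)" using carrier_polynomial_shell[OF Lr I(1)] .
  have "degree f \<le> degree (normalize ?g)"
    using pdivides_imp_degree_le[OF Lr I(1) ng ne] Irr_minimal[OF L y(1) alg ng ev] f_def by simp
  then have df: "degree f < p" using normalize_length_le[of ?g] ne p_pos by (cases "normalize ?g") auto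
  have df0: "degree f \<ge> 1" using pirreducible_degree[OF L I(1,2)] .
  have y0: "y \<noteq> \<zero>" using y(3) subringE(2)[OF Lr] by auto
  let ?l = "[\<one>, \<ominus> y]"
  have l: "?l \<in> carrier (poly_ring R)" using y by (auto simp: sym[OF univ_poly_carrier] polynomial_def)
  let ?c = "\<ominus> (y [^] p)"
  have c: "?c \<in> L" "?c \<noteq> \<zero>"
    using subringE(5)[OF Lr y(2)] nonzero_pow_nonzero[OF y(1) y0, of p] minus_minus[of "y [^] p"] y(1)
    by (auto simp del: minus_minus)
  \<comment> \<open>the polynomial \<open>X\<^sup>p - y\<^sup>p\<close>, with coefficients in \<open>L\<close>\<close>
  define h where "h = poly_add (monom \<one> p) [?c]"
  have m1: "polynomial L (monom \<one> p)" "polynomial L [?c]"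
    using c subringE(3)[OF Lr] by (auto intro!: monom_is_polynomial[OF Lr] const_is_polynomial)
  have hL: "h \<in> carrier (L[X])"
    using poly_add_closed[OF Lr m1] by (simp add: h_def univ_poly_carrier)
  have "eval h y = eval (monom \<one> p) y \<oplus> eval [?c] y"
    unfolding h_def using polynomial_in_carrier[OF Lr] m1 y(1) by (intro eval_poly_add) auto
  also have "\<dots> = \<zero>" using y(1) by (simp add: eval_monom r_neg)
  finally have evh: "eval h y = \<zero>" .
  have hl: "h = ?l [^]\<^bsub>poly_ring R\<^esub> p"
  proof -
    have "char_p_ring (poly_ring R) p"
    proof (unfold_locales)
      show "Factorial_Ring.prime p" by (rule prime_p)
      have hom: "ring_hom_ring R (poly_ring R) poly_of_const"
        using canonical_embedding_ring_hom[OF carrier_is_subring] by simp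
      interpret H: ring_hom_ring R "poly_ring R" poly_of_const by (rule hom)
      have "add_pow (poly_ring R) m \<one>\<^bsub>poly_ring R\<^esub> = poly_of_const (add_pow R m \<one>)" for m :: nat
        by (induction m) (use H.hom_add[of "add_pow R _ \<one>" \<one>] in auto)
      then show "add_pow (poly_ring R) p \<one>\<^bsub>poly_ring R\<^esub> = \<zero>\<^bsub>poly_ring R\<^esub>"
        using char_p by simp
    qed
    then interpret UPp: char_p_ring "poly_ring R" p .
    have XR: "X \<in> carrier (poly_ring R)" using var_closed(1)[OF carrier_is_subring] .
    have cR: "[\<ominus> y] \<in> carrier (poly_ring R)"
      using y(1) y0 minus_minus[OF y(1)]
      by (auto simp: sym[OF univ_poly_carrier] polynomial_def simp del: minus_minus)
    have "?l = X \<oplus>\<^bsub>poly_ring R\<^esub> [\<ominus> y]"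
      using y(1) by (simp add: var_def univ_poly_add)
    then have "?l [^]\<^bsub>poly_ring R\<^esub> p = X [^]\<^bsub>poly_ring R\<^esub> p \<oplus>\<^bsub>poly_ring R\<^esub> [\<ominus> y] [^]\<^bsub>poly_ring R\<^esub> p"
      using UPp.frobenius_add[OF XR cR] by simp
    also have "[\<ominus> y] [^]\<^bsub>poly_ring R\<^esub> n = [(\<ominus> y) [^] n]" for n :: nat
    proof (induction n)
      case (Suc n)
      have "(\<ominus> y) [^] n \<otimes> \<ominus> y \<noteq> \<zero>"
        using y(1) y0 nonzero_pow_nonzero[of "\<ominus> y" "Suc n"] minus_minus[OF y(1)]
        by (auto simp del: minus_minus)
      then show ?case using Suc y(1) by (simp add: univ_poly_mult)
    qed (simp add: univ_poly_one)
    finally show ?thesis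
      using frobenius_neg[OF y(1)] unitary_monom_eq_var_pow[OF carrier_is_subring, of p]
      by (simp add: h_def univ_poly_add)
  qed
  have "f pdivides h" using Irr_minimal[OF L y(1) alg hL evh] f_def by simp
  then obtain q where "q \<in> carrier (poly_ring R)" "f \<otimes>\<^bsub>poly_ring R\<^esub> q = ?l [^]\<^bsub>poly_ring R\<^esub> p"
    unfolding pdivides_def factor_def using hl by auto
  then obtain e :: nat where e: "f = ?l [^]\<^bsub>poly_ring R\<^esub> e"
    using monic_divisor_of_linear_power[OF y(1) fR _ I(3) f0] by blast
  have "degree f = e" using polynomial_pow_degree[OF l, of e] e by simp
  then have e1: "0 < e" "e < p" using df df0 by auto
  have "const_term (?l [^]\<^bsub>poly_ring R\<^esub> n) = (\<ominus> y) [^] n" for n :: nat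
  proof (induction n)
    case (Suc n)
    then show ?case
      using const_term_simprules_shell(2)[OF carrier_is_subring, of "?l [^]\<^bsub>poly_ring R\<^esub> n" ?l] l y(1)
      by (simp add: const_term_def del: poly_mult.simps)
  qed (simp add: const_term_def univ_poly_one)
  then have "(\<ominus> y) [^] e \<in> L"
    using const_term_simprules_shell(1)[OF Lr I(1)] e by metis
  moreover have "(\<ominus> y) [^] p \<in> L" using c(1) frobenius_neg[OF y(1)] by simp
  ultimately have "\<ominus> y \<in> L"
    using root_mem_subfield_if_coprime_powers[OF L _ _ _ e1] y(1) by auto
  then show False using y subringE(5)[OF Lr, of "\<ominus> y"] by simp
qed

end

section \<open>Adjoining \<open>p\<close>-th roots\<close>

context char_p_field
begin

definition pth_powers :: "'a set \<Rightarrow> 'a set"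
  where "pth_powers V = (\<lambda>x. x [^] p) ` V"

lemma subring_carrier: "subring A R \<Longrightarrow> a \<in> A \<Longrightarrow> a \<in> carrier R"
  using subringE(1) by blast

lemma subring_pow_closed:
  assumes "subring V R" "x \<in> V" shows "x [^] (n::nat) \<in> V"
  using assms(2) subringE(3,6)[OF assms(1)] by (induction n) auto

lemma subring_finsum_closed:
  assumes "subring V R" "\<And>i. i < (n::nat) \<Longrightarrow> f i \<in> V"
  shows "(\<Oplus>i\<in>{..<n}. f i) \<in> V"
  using assms(2)
proof (induction n)
  case 0
  then show ?case using subringE(2)[OF assms(1)] by simp
next
  case (Suc n)
  have "f i \<in> carrier R" if "i < Suc n" for i using Suc.prems[OF that] subringE(1)[OF assms(1)] by blast
  then have "(\<Oplus>i\<in>{..<Suc n}. f i) = f n \<oplus> (\<Oplus>i\<in>{..<n}. f i)"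
    by (simp add: lessThan_Suc finsum_insert Pi_def)
  then show ?case using Suc subringE(7)[OF assms(1)] by simp
qed

lemma pth_powers_subring:
  assumes V: "subring V R" shows "subring (pth_powers V) R"
proof (rule subringI)
  note c = subringE(1)[OF V, THEN subsetD]
  show "pth_powers V \<subseteq> carrier R" using c by (auto simp: pth_powers_def)
  show "\<one> \<in> pth_powers V" unfolding pth_powers_def
    using subringE(3)[OF V] by (intro image_eqI[of _ _ \<one>]) auto
next
  note c = subringE(1)[OF V, THEN subsetD]
  fix h assume "h \<in> pth_powers V"
  then obtain x where x: "x \<in> V" "h = x [^] p" by (auto simp: pth_powers_def)
  then show "\<ominus> h \<in> pth_powers V"
    using frobenius_neg[OF c] subringE(5)[OF V] unfolding pth_powers_def
    by (intro image_eqI[of _ _ "\<ominus> x"]) auto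
next
  note c = subringE(1)[OF V, THEN subsetD]
  fix h g assume "h \<in> pth_powers V" "g \<in> pth_powers V"
  then obtain x y where x: "x \<in> V" "h = x [^] p" and y: "y \<in> V" "g = y [^] p"
    by (auto simp: pth_powers_def)
  then show "h \<otimes> g \<in> pth_powers V" unfolding pth_powers_def
    using subringE(6)[OF V] c by (intro image_eqI[of _ _ "x \<otimes> y"]) (auto simp: nat_pow_distrib)
  show "h \<oplus> g \<in> pth_powers V" unfolding pth_powers_def
    using subringE(7)[OF V] c x y by (intro image_eqI[of _ _ "x \<oplus> y"]) (auto simp: frobenius_add)
qed

text \<open>For \<open>y\<^sup>p \<in> A\<close> this is the ring \<open>A[y]\<close>, as higher powers of \<open>y\<close> can be reduced.\<close>

definition adjoin :: "'a set \<Rightarrow> 'a \<Rightarrow> 'a set"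
  where "adjoin A y = {\<Oplus>i\<in>{..<p}. a i \<otimes> y [^] i | a. \<forall>i<p. a i \<in> A}"

text \<open>For \<open>y\<^sup>p \<in> A\<close> this says that \<open>A[y]\<close> is \<open>A[X]/(X\<^sup>p - y\<^sup>p)\<close>.\<close>

definition powers_independent :: "'a set \<Rightarrow> 'a \<Rightarrow> bool"
  where "powers_independent A y \<longleftrightarrow> (\<forall>a. (\<forall>i<p. a i \<in> A) \<and> (\<Oplus>i\<in>{..<p}. a i \<otimes> y [^] i) = \<zero> \<longrightarrow>
    (\<forall>i<p. a i = \<zero>))"

lemma powers_independentD:
  assumes "powers_independent A y" "\<And>i. i < p \<Longrightarrow> a i \<in> A"
    and "(\<Oplus>i\<in>{..<p}. a i \<otimes> y [^] i) = \<zero>" "j < p"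
  shows "a j = \<zero>"
  using assms(1)[unfolded powers_independent_def, THEN spec[of _ a]] assms(2-4) by simp

lemma adjoinE:
  assumes "x \<in> adjoin A y"
  obtains a where "\<And>i. i < p \<Longrightarrow> a i \<in> A" "x = (\<Oplus>i\<in>{..<p}. a i \<otimes> y [^] i)"
  using assms by (auto simp: adjoin_def)

lemma sum_single:
  assumes "i < (n::nat)" "\<And>j. j < n \<Longrightarrow> f j \<in> carrier R" "\<And>j. j < n \<Longrightarrow> j \<noteq> i \<Longrightarrow> f j = \<zero>"
  shows "(\<Oplus>j\<in>{..<n}. f j) = f i"
proof -
  have "(\<Oplus>j\<in>{..<n}. f j) = (\<Oplus>j\<in>{..<n}. if i = j then f j else \<zero>)"
    using assms by (intro finsum_cong') auto
  also have "\<dots> = f i" using assms by (intro finsum_singleton) auto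
  finally show ?thesis .
qed

context
  fixes A :: "'a set" and y :: 'a
  assumes A: "subring A R" and y: "y \<in> carrier R" and yp: "y [^] p \<in> A"
begin

lemma A_carrier: "a \<in> A \<Longrightarrow> a \<in> carrier R" using subringE(1)[OF A] by blast

lemma adjoin_carrier: "x \<in> adjoin A y \<Longrightarrow> x \<in> carrier R"
  by (erule adjoinE) (use A_carrier y in \<open>auto intro!: finsum_closed\<close>)

lemma adjoin_add:
  assumes "u \<in> adjoin A y" "v \<in> adjoin A y" shows "u \<oplus> v \<in> adjoin A y"
proof -
  obtain a where a: "\<And>i. i < p \<Longrightarrow> a i \<in> A" "u = (\<Oplus>i\<in>{..<p}. a i \<otimes> y [^] i)"
    using assms(1) by (rule adjoinE) blast
  obtain b where b: "\<And>i. i < p \<Longrightarrow> b i \<in> A" "v = (\<Oplus>i\<in>{..<p}. b i \<otimes> y [^] i)"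
    using assms(2) by (rule adjoinE) blast
  have "u \<oplus> v = (\<Oplus>i\<in>{..<p}. a i \<otimes> y [^] i \<oplus> b i \<otimes> y [^] i)"
    using a b A_carrier y by (auto intro!: finsum_addf[symmetric])
  also have "\<dots> = (\<Oplus>i\<in>{..<p}. (a i \<oplus> b i) \<otimes> y [^] i)"
    using a b A_carrier y by (intro finsum_cong') (auto simp: l_distr)
  finally show ?thesis using a(1) b(1) subringE(7)[OF A]
    by (auto simp: adjoin_def intro!: exI[of _ "\<lambda>i. a i \<oplus> b i"])
qed

lemma adjoin_monomial: "a \<in> A \<Longrightarrow> a \<otimes> y [^] (i::nat) \<in> adjoin A y"
proof (induction i arbitrary: a rule: less_induct)
  case (less i)
  show ?case
  proof (cases "i < p")
    case True
    have "(\<Oplus>j\<in>{..<p}. (if j = i then a else \<zero>) \<otimes> y [^] j) = a \<otimes> y [^] i"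
      using less.prems A_carrier y by (subst sum_single[OF True]) auto
    then show ?thesis using less.prems subringE(2)[OF A]
      by (auto simp: adjoin_def intro!: exI[of _ "\<lambda>j. if j = i then a else \<zero>"])
  next
    case False
    then obtain j where j: "i = p + j" using le_Suc_ex not_less by blast
    have "a \<otimes> y [^] i = (a \<otimes> y [^] p) \<otimes> y [^] j"
      using j less.prems A_carrier y by (simp add: nat_pow_mult[symmetric] m_assoc)
    then show ?thesis using less.IH[of j "a \<otimes> y [^] p"] j p_pos less.prems yp subringE(6)[OF A] by simp
  qed
qed

lemma adjoin_induct [consumes 1, case_names zero add monomial]:
  assumes x: "x \<in> adjoin A y" and "Q \<zero>"
    and "\<And>u v. u \<in> adjoin A y \<Longrightarrow> v \<in> adjoin A y \<Longrightarrow> Q u \<Longrightarrow> Q v \<Longrightarrow> Q (u \<oplus> v)"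
    and "\<And>a i. a \<in> A \<Longrightarrow> i < p \<Longrightarrow> Q (a \<otimes> y [^] i)"
  shows "Q x"
proof -
  obtain a where a: "\<And>i. i < p \<Longrightarrow> a i \<in> A" "x = (\<Oplus>i\<in>{..<p}. a i \<otimes> y [^] i)"
    using x by (rule adjoinE) blast
  have "n \<le> p \<Longrightarrow> (\<Oplus>i\<in>{..<n}. a i \<otimes> y [^] i) \<in> adjoin A y \<and> Q (\<Oplus>i\<in>{..<n}. a i \<otimes> y [^] i)" for n
  proof (induction n)
    case 0
    have "\<zero> \<in> adjoin A y" using adjoin_monomial[of \<zero> 0] subringE(2)[OF A] by simp
    then show ?case using assms(2) by simp
  next
    case (Suc n)
    have "(\<Oplus>i\<in>{..<Suc n}. a i \<otimes> y [^] i) = a n \<otimes> y [^] n \<oplus> (\<Oplus>i\<in>{..<n}. a i \<otimes> y [^] i)"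
      using Suc.prems a(1) A_carrier y unfolding lessThan_Suc by (subst finsum_insert) auto
    then show ?case using Suc a(1)[of n] assms(3,4) adjoin_add adjoin_monomial by auto
  qed
  then show ?thesis using a(2) by simp
qed

lemma adjoin_superset: "A \<subseteq> adjoin A y"
  using adjoin_monomial[of _ 0] A_carrier by auto

lemma adjoin_generator: "y \<in> adjoin A y"
  using adjoin_monomial[of \<one> 1] subringE(3)[OF A] y by simp

lemma adjoin_subring: "subring (adjoin A y) R"
proof (rule subringI)
  show "adjoin A y \<subseteq> carrier R" using adjoin_carrier by blast
  show "\<one> \<in> adjoin A y" using adjoin_superset subringE(3)[OF A] by blast
  show "\<ominus> h \<in> adjoin A y" if "h \<in> adjoin A y" for h
    using that
  proof (induction rule: adjoin_induct)
    case zero then show ?case using adjoin_superset subringE(2)[OF A] by auto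
  next
    case (add u v) then show ?case using adjoin_add adjoin_carrier by (simp add: minus_add)
  next
    case (monomial a i)
    then show ?case using adjoin_monomial[of "\<ominus> a" i] subringE(5)[OF A] A_carrier y by (simp add: l_minus)
  qed
  show "h \<otimes> g \<in> adjoin A y" if "h \<in> adjoin A y" and g: "g \<in> adjoin A y" for h g
    using that(1)
  proof (induction rule: adjoin_induct)
    case zero then show ?case using adjoin_superset subringE(2)[OF A] adjoin_carrier[OF g] by auto
  next
    case (add u v) then show ?case using adjoin_add adjoin_carrier g by (simp add: l_distr)
  next
    case (monomial a i)
    from g show ?case
    proof (induction rule: adjoin_induct)
      case zero then show ?case using adjoin_superset subringE(2)[OF A] A_carrier y monomial by auto
    next
      case (add u v) then show ?case using adjoin_add adjoin_carrier A_carrier y monomial by (simp add: r_distr)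
    next
      case (monomial b j)
      have "a \<otimes> y [^] i \<otimes> (b \<otimes> y [^] j) = (a \<otimes> b) \<otimes> y [^] (i + j)"
        using monomial \<open>a \<in> A\<close> A_carrier y by (simp add: nat_pow_mult[symmetric] m_ac)
      then show ?case using adjoin_monomial monomial \<open>a \<in> A\<close> subringE(6)[OF A] by simp
    qed
  qed
  show "h \<oplus> g \<in> adjoin A y" if "h \<in> adjoin A y" "g \<in> adjoin A y" for h g
    using that by (rule adjoin_add)
qed

lemma adjoin_subset:
  assumes V: "subring V R" "A \<subseteq> V" "y \<in> V" shows "adjoin A y \<subseteq> V"
proof
  fix x assume "x \<in> adjoin A y" then show "x \<in> V"
  proof (induction rule: adjoin_induct)
    case zero then show ?case using subringE(2)[OF V(1)] .
  next
    case (add u v) then show ?case using subringE(7)[OF V(1)] by simp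
  next
    case (monomial a i) then show ?case
      using subringE(6)[OF V(1)] subring_pow_closed[OF V(1,3)] V(2) by blast
  qed
qed

end

text \<open>The derivative \<open>i y\<^sup>i\<^sup>-\<^sup>1\<close> of \<open>y\<^sup>i\<close>. The truncated exponent for \<open>i = 0\<close> is harmless because of the
  factor \<open>i\<close>.\<close>

definition dpow :: "'a \<Rightarrow> nat \<Rightarrow> 'a"
  where "dpow y i = add_pow R i (y [^] (i - 1))"

lemma dpow_closed [simp]: "y \<in> carrier R \<Longrightarrow> dpow y i \<in> carrier R"
  by (simp add: dpow_def)

lemma dpow_0 [simp]: "dpow y 0 = \<zero>" by (simp add: dpow_def)

lemma dpow_1: "y \<in> carrier R \<Longrightarrow> dpow y (Suc 0) = \<one>" by (simp add: dpow_def)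

lemma dpow_mult: "y \<in> carrier R \<Longrightarrow> y \<otimes> dpow y i = add_pow R i (y [^] i)"
  unfolding dpow_def by (subst add_pow_rdistr) (cases i; simp add: m_comm)+

lemma dpow_add:
  assumes "y \<in> carrier R"
  shows "dpow y (i + j) = y [^] i \<otimes> dpow y j \<oplus> y [^] j \<otimes> dpow y i"
proof -
  have *: "y [^] i \<otimes> dpow y j = add_pow R j (y [^] (i + j - 1))" for i j
    using assms unfolding dpow_def
    by (subst add_pow_rdistr) (cases j; simp add: nat_pow_mult del: add.nat_pow_Suc nat_pow_Suc)+
  have "y [^] i \<otimes> dpow y j \<oplus> y [^] j \<otimes> dpow y i
      = add_pow R (j + i) (y [^] (i + j - 1))"
    unfolding * using assms by (simp add: add.commute[of j i] add.nat_pow_mult)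
  then show ?thesis by (simp add: dpow_def add.commute)
qed

lemma dpow_multiple:
  assumes "y \<in> carrier R" "p dvd i" shows "dpow y i = \<zero>"
  using assms by (simp add: dpow_def dvd_add_pow)

lemma dpow_pth: "y \<in> carrier R \<Longrightarrow> dpow y (p + i) = y [^] p \<otimes> dpow y i"
  by (simp add: dpow_add dpow_multiple)

lemma derivationsD:
  assumes "\<theta> \<in> derivations (R\<lparr>carrier := A\<rparr>) F"
  shows "a \<in> A \<Longrightarrow> \<theta> a \<in> A" "a \<in> A \<Longrightarrow> b \<in> A \<Longrightarrow> \<theta> (a \<oplus> b) = \<theta> a \<oplus> \<theta> b"
    "a \<in> A \<Longrightarrow> b \<in> A \<Longrightarrow> \<theta> (a \<otimes> b) = a \<otimes> \<theta> b \<oplus> b \<otimes> \<theta> a" "c \<in> F \<Longrightarrow> \<theta> c = \<zero>"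
  using assms by (auto simp: derivations_def)

lemma derivation_zero:
  assumes "\<theta> \<in> derivations (R\<lparr>carrier := A\<rparr>) F" "subring A R"
  shows "\<theta> \<zero> = \<zero>"
proof -
  have "\<theta> \<zero> \<in> carrier R" "\<theta> \<zero> \<oplus> \<theta> \<zero> = \<theta> \<zero>"
    using derivationsD(1)[OF assms(1), of \<zero>] derivationsD(2)[OF assms(1), of \<zero> \<zero>]
      subringE(1,2)[OF assms(2)] by auto
  then show ?thesis using add.l_cancel_one' by metis
qed

text \<open>Since \<open>X\<^sup>p - y\<^sup>p\<close> has derivative zero and its constant coefficient is killed by \<open>D\<close>, the value \<open>e\<close> at \<open>y\<close>
  can be prescribed at will: the product rule dictates the values \<open>m a i\<close> on the monomials \<open>a y\<^sup>i\<close> with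
  \<open>i < p\<close>, independence of the powers makes the additive extension well-defined, and the same formula
  persists for \<open>i \<ge> p\<close>, because \<open>dpow y (p + i) = y\<^sup>p dpow y i\<close>. The product rule then holds on monomials, hence
  everywhere.\<close>

lemma derivation_extends_to_adjoin:
  assumes A: "subring A R" and y: "y \<in> carrier R" and F: "F \<subseteq> A" "y [^] p \<in> F"
    and ind: "powers_independent A y"
    and D: "D \<in> derivations (R\<lparr>carrier := A\<rparr>) F" and e: "e \<in> A"
  shows "\<exists>D'\<in>derivations (R\<lparr>carrier := adjoin A y\<rparr>) F.
    \<forall>a\<in>A. \<forall>i. D' (a \<otimes> y [^] i) = D a \<otimes> y [^] i \<oplus> a \<otimes> dpow y i \<otimes> e"
proof -
  have yp: "y [^] p \<in> A" using F by blast
  note Ac = subring_carrier[OF A]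
  note DD = derivationsD[OF D]
  note Dc = Ac[OF DD(1)]
  note ec = Ac[OF e]
  define m where "m = (\<lambda>a i. D a \<otimes> y [^] i \<oplus> a \<otimes> dpow y i \<otimes> e)"
  have mc: "m a i \<in> carrier R" if "a \<in> A" for a i
    using that Ac Dc ec y by (simp add: m_def)
  have madj: "m a i \<in> adjoin A y" if "a \<in> A" for a i
  proof -
    have "a \<otimes> dpow y i \<otimes> e = (a \<otimes> add_pow R i \<one> \<otimes> e) \<otimes> y [^] (i - 1)"
      using Ac that ec y add_pow_ldistr[of \<one> "y [^] (i - 1)" i] by (simp add: dpow_def m_ac)
    moreover have "add_pow R i \<one> \<in> A"
      by (induction i) (use subringE(2,3,7)[OF A] in \<open>auto simp: add_pow_def\<close>)
    ultimately show ?thesis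
      unfolding m_def using that e subringE(6)[OF A] DD(1)
      by (auto intro!: adjoin_add[OF A y yp] adjoin_monomial[OF A y yp])
  qed
  have madd: "m (a \<oplus> b) i = m a i \<oplus> m b i" if "a \<in> A" "b \<in> A" for a b i
    using that Ac Dc ec y DD(2)[of a b] by (simp add: m_def l_distr a_ac)
  have m0: "m \<zero> i = \<zero>" for i
    using derivation_zero[OF D A] y ec by (simp add: m_def)
  \<comment> \<open>the coefficients of an element of \<open>A[y]\<close>, unique by independence\<close>
  define cf where "cf = (\<lambda>x. SOME a. (\<forall>i<p. a i \<in> A) \<and> x = (\<Oplus>i\<in>{..<p}. a i \<otimes> y [^] i))"
  define D' where "D' = (\<lambda>x. \<Oplus>i\<in>{..<p}. m (cf x i) i)"
  have cf: "cf (\<Oplus>i\<in>{..<p}. a i \<otimes> y [^] i) j = a j" if a: "\<And>i. i < p \<Longrightarrow> a i \<in> A" and j: "j < p" for a j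
  proof -
    let ?x = "\<Oplus>i\<in>{..<p}. a i \<otimes> y [^] i"
    define c where "c = cf ?x"
    have "(\<forall>i<p. c i \<in> A) \<and> ?x = (\<Oplus>i\<in>{..<p}. c i \<otimes> y [^] i)"
      unfolding c_def cf_def by (rule someI[of _ a]) (use a in auto)
    then have c: "\<And>i. i < p \<Longrightarrow> c i \<in> A" and s: "(\<Oplus>i\<in>{..<p}. c i \<otimes> y [^] i) = ?x" by auto
    have "(\<Oplus>i\<in>{..<p}. (c i \<oplus> (\<ominus> \<one>) \<otimes> a i) \<otimes> y [^] i)
        = (\<Oplus>i\<in>{..<p}. c i \<otimes> y [^] i \<oplus> (\<ominus> \<one>) \<otimes> (a i \<otimes> y [^] i))"
      using a c Ac y by (intro finsum_cong') (auto simp: l_distr l_minus)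
    also have "\<dots> = (\<Oplus>i\<in>{..<p}. c i \<otimes> y [^] i) \<oplus> (\<ominus> \<one>) \<otimes> ?x"
      using a c Ac y by (subst finsum_addf) (auto simp: finsum_rdistr)
    also have "\<dots> = \<zero>"
      unfolding s using a Ac y by (subst l_minus) (auto simp: r_neg intro!: finsum_closed)
    finally have z: "(\<Oplus>i\<in>{..<p}. (c i \<oplus> (\<ominus> \<one>) \<otimes> a i) \<otimes> y [^] i) = \<zero>" .
    have zA: "c i \<oplus> (\<ominus> \<one>) \<otimes> a i \<in> A" if "i < p" for i
      using a[OF that] c[OF that] subringE(3,5,6,7)[OF A] by simp
    have "c j \<oplus> (\<ominus> \<one>) \<otimes> a j = \<zero>"
      by (rule powers_independentD[where a = "\<lambda>i. c i \<oplus> (\<ominus> \<one>) \<otimes> a i", OF ind zA z j])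
    then have "c j \<ominus> a j = \<zero>"
      using Ac[OF a[OF j]] by (simp add: a_minus_def l_minus)
    then show ?thesis using Ac[OF a[OF j]] Ac[OF c[OF j]] unfolding c_def by simp
  qed
  have D's: "D' (\<Oplus>i\<in>{..<p}. a i \<otimes> y [^] i) = (\<Oplus>i\<in>{..<p}. m (a i) i)" if a: "\<And>i. i < p \<Longrightarrow> a i \<in> A" for a
    unfolding D'_def using cf[OF a] mc a by (intro finsum_cong') auto
  have D'add: "D' (u \<oplus> v) = D' u \<oplus> D' v" if uv: "u \<in> adjoin A y" "v \<in> adjoin A y" for u v
  proof -
    obtain a where a: "\<And>i. i < p \<Longrightarrow> a i \<in> A" "u = (\<Oplus>i\<in>{..<p}. a i \<otimes> y [^] i)"
      using uv(1) by (rule adjoinE) blast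
    obtain b where b: "\<And>i. i < p \<Longrightarrow> b i \<in> A" "v = (\<Oplus>i\<in>{..<p}. b i \<otimes> y [^] i)"
      using uv(2) by (rule adjoinE) blast
    have "u \<oplus> v = (\<Oplus>i\<in>{..<p}. a i \<otimes> y [^] i \<oplus> b i \<otimes> y [^] i)"
      using a b Ac y by (auto intro!: finsum_addf[symmetric])
    also have "\<dots> = (\<Oplus>i\<in>{..<p}. (a i \<oplus> b i) \<otimes> y [^] i)"
      using a b Ac y by (intro finsum_cong') (auto simp: l_distr)
    finally have "D' (u \<oplus> v) = (\<Oplus>i\<in>{..<p}. m (a i \<oplus> b i) i)"
      using D's[of "\<lambda>i. a i \<oplus> b i"] a(1) b(1) subringE(7)[OF A] by simp
    also have "\<dots> = (\<Oplus>i\<in>{..<p}. m (a i) i \<oplus> m (b i) i)"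
      using madd mc a(1) b(1) by (intro finsum_cong') auto
    also have "\<dots> = (\<Oplus>i\<in>{..<p}. m (a i) i) \<oplus> (\<Oplus>i\<in>{..<p}. m (b i) i)"
      using mc a(1) b(1) by (intro finsum_addf) auto
    also have "\<dots> = D' u \<oplus> D' v"
      using D's[of a] D's[of b] a b by simp
    finally show ?thesis .
  qed
  have Dyp: "m (a \<otimes> y [^] p) i = m a (p + i)" if a: "a \<in> A" for a i
    using a Ac Dc ec y DD(3)[OF a yp] DD(4)[OF F(2)]
    by (simp add: m_def dpow_pth nat_pow_mult[symmetric] m_ac)
  have D'mon: "D' (a \<otimes> y [^] i) = m a i" if "a \<in> A" for a i
    using that
  proof (induction i arbitrary: a rule: less_induct)
    case (less i)
    show ?case
    proof (cases "i < p")
      case True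
      let ?a = "\<lambda>j. if j = i then a else \<zero>"
      have aA: "\<And>j. j < p \<Longrightarrow> ?a j \<in> A" using less.prems subringE(2)[OF A] by simp
      have "(\<Oplus>j\<in>{..<p}. ?a j \<otimes> y [^] j) = a \<otimes> y [^] i"
        using less.prems Ac y by (subst sum_single[OF True]) auto
      moreover have "(\<Oplus>j\<in>{..<p}. m (?a j) j) = m a i"
        using aA mc m0 by (subst sum_single[OF True]) auto
      ultimately show ?thesis using D's[of ?a] aA by metis
    next
      case False
      then obtain j where j: "i = p + j" using le_Suc_ex not_less by blast
      have "a \<otimes> y [^] i = (a \<otimes> y [^] p) \<otimes> y [^] j"
        using j less.prems Ac y by (simp add: nat_pow_mult[symmetric] m_assoc)
      then show ?thesis
        using less.IH[of j "a \<otimes> y [^] p"] j p_pos less.prems yp subringE(6)[OF A] Dyp by simp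
    qed
  qed
  note ac = adjoin_carrier[OF A y yp]
  note am = adjoin_monomial[OF A y yp]
  note asr = adjoin_subring[OF A y yp]
  have D'0: "D' \<zero> = \<zero>" using D'mon[of \<zero> 0] m0 subringE(2)[OF A] by simp
  have D'closed: "D' x \<in> adjoin A y" if "x \<in> adjoin A y" for x
    using that
  proof (induction rule: adjoin_induct[OF A y yp, consumes 1, case_names zero add monomial])
    case zero then show ?case using D'0 subringE(2)[OF asr] by simp
  next
    case (add u v) then show ?case using D'add adjoin_add[OF A y yp] by simp
  next
    case (monomial a i) then show ?case using D'mon madj by simp
  qed
  note D'c = ac[OF D'closed]
  have leib_mon: "m (a \<otimes> b) (i + j) = a \<otimes> y [^] i \<otimes> m b j \<oplus> b \<otimes> y [^] j \<otimes> m a i" if ab: "a \<in> A" "b \<in> A" for a b i j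
  proof -
    have c: "a \<in> carrier R" "b \<in> carrier R" "D a \<in> carrier R" "D b \<in> carrier R"
      "y [^] i \<in> carrier R" "y [^] j \<in> carrier R" "dpow y i \<in> carrier R" "dpow y j \<in> carrier R"
      using ab Ac Dc y by auto
    show ?thesis unfolding m_def DD(3)[OF ab] dpow_add[OF y] nat_pow_mult[OF y, symmetric]
      using c ec by (simp add: l_distr r_distr m_ac a_ac)
  qed
  have leib: "D' (u \<otimes> v) = u \<otimes> D' v \<oplus> v \<otimes> D' u" if u: "u \<in> adjoin A y" and v: "v \<in> adjoin A y" for u v
    using u
  proof (induction rule: adjoin_induct[OF A y yp, consumes 1, case_names zero add monomial])
    case zero then show ?case using D'0 ac[OF v] D'c[OF v] by simp
  next
    case (add w x)
    have "D' ((w \<oplus> x) \<otimes> v) = D' (w \<otimes> v) \<oplus> D' (x \<otimes> v)"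
      using add v ac subringE(6)[OF asr] by (simp add: l_distr D'add)
    then show ?case using add v ac D'c by (simp add: D'add l_distr r_distr a_ac)
  next
    case (monomial a i)
    note ai = am[OF monomial(1), of i]
    from v show ?case
    proof (induction rule: adjoin_induct[OF A y yp, consumes 1, case_names zero add monomial])
      case zero then show ?case using D'0 ac[OF ai] D'c[OF ai] by simp
    next
      case (add w x)
      have "D' (a \<otimes> y [^] i \<otimes> (w \<oplus> x)) = D' (a \<otimes> y [^] i \<otimes> w) \<oplus> D' (a \<otimes> y [^] i \<otimes> x)"
        using add ai ac subringE(6)[OF asr] by (simp add: r_distr D'add)
      then show ?case using add ac[OF ai] D'c[OF ai] ac D'c by (simp add: D'add l_distr r_distr a_ac)
    next
      case (monomial b j)
      have "a \<otimes> y [^] i \<otimes> (b \<otimes> y [^] j) = (a \<otimes> b) \<otimes> y [^] (i + j)"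
        using monomial \<open>a \<in> A\<close> Ac y by (simp add: nat_pow_mult[symmetric] m_ac)
      then show ?case using monomial \<open>a \<in> A\<close> D'mon leib_mon subringE(6)[OF A] by simp
    qed
  qed
  have "D' c = \<zero>" if "c \<in> F" for c
  proof -
    have "c \<in> A" using that F by blast
    then show ?thesis using D'mon[of c 0] DD(4)[OF that] Ac ec by (simp add: m_def)
  qed
  then have "D' \<in> derivations (R\<lparr>carrier := adjoin A y\<rparr>) F"
    using D'closed D'add leib by (simp add: derivations_def)
  then show ?thesis using D'mon unfolding m_def by blast
qed

end

section \<open>Derivations with a dual basis\<close>

context char_p_field
begin

text \<open>The integer \<open>i\<close> is invertible modulo \<open>p\<close>.\<close>

lemma add_pow_eq_zeroD:
  assumes "a \<in> carrier R" "add_pow R i a = \<zero>" "0 < i" "i < p"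
  shows "a = \<zero>"
proof -
  have "coprime i p" using assms(3,4) prime_p
    by (metis coprime_commute dvd_imp_le not_less prime_imp_coprime)
  then obtain x y where xy: "i * x = p * y + 1" using bezout_nat[of i p] assms(3) by auto
  have "add_pow R (i * x) a = \<zero>"
    using assms(1,2) add.nat_pow_pow[of a x i] by (simp add: mult.commute)
  moreover have "add_pow R (p * y + 1) a = add_pow R (p * y) a \<oplus> a"
    using assms(1) by simp
  moreover have "add_pow R (p * y) a = \<zero>" using assms(1) by (intro dvd_add_pow) auto
  ultimately show ?thesis using assms(1) xy by simp
qed

lemma derivation_finsum:
  assumes \<theta>: "\<theta> \<in> derivations (R\<lparr>carrier := B\<rparr>) F" and B: "subring B R"
    and f: "\<And>i. i < (n::nat) \<Longrightarrow> f i \<in> B"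
  shows "\<theta> (\<Oplus>i\<in>{..<n}. f i) = (\<Oplus>i\<in>{..<n}. \<theta> (f i))"
  using f
proof (induction n)
  case 0
  then show ?case using derivation_zero[OF \<theta> B] by simp
next
  case (Suc n)
  note Bc = subring_carrier[OF B]
  have 1: "(\<Oplus>i\<in>{..<Suc n}. f i) = f n \<oplus> (\<Oplus>i\<in>{..<n}. f i)"
    using Suc.prems Bc unfolding lessThan_Suc by (subst finsum_insert) auto
  have 2: "(\<Oplus>i\<in>{..<Suc n}. \<theta> (f i)) = \<theta> (f n) \<oplus> (\<Oplus>i\<in>{..<n}. \<theta> (f i))"
    using Suc.prems Bc[OF derivationsD(1)[OF \<theta>]] unfolding lessThan_Suc by (subst finsum_insert) auto
  have "(\<Oplus>i\<in>{..<n}. f i) \<in> B" using subring_finsum_closed[OF B] Suc.prems by simp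
  then show ?case unfolding 1 2 using Suc derivationsD(2)[OF \<theta>] by simp
qed

lemma dpow_mem_subring:
  assumes V: "subring V R" and y: "y \<in> V"
  shows "dpow y i \<in> V"
proof -
  have "add_pow R n x \<in> V" if "x \<in> V" for n :: nat and x
    using that subringE(2,7)[OF V] by (induction n) auto
  then show ?thesis unfolding dpow_def using subring_pow_closed[OF V y] by simp
qed

end

text \<open>The intended instance of \<open>d\<close> is the universal derivation into the module of differentials.\<close>

locale char_p_derivation = char_p_field R p + M: module "R\<lparr>carrier := V\<rparr>" M
  for R :: "('a, 'r) ring_scheme" (structure) and p and V and M :: "('a, 'm, 'n) module_scheme" +
  fixes d :: "'a \<Rightarrow> 'm"
  assumes V: "subring V R"
    and d_closed: "x \<in> V \<Longrightarrow> d x \<in> carrier M"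
    and d_add: "x \<in> V \<Longrightarrow> y \<in> V \<Longrightarrow> d (x \<oplus> y) = d x \<oplus>\<^bsub>M\<^esub> d y"
    and d_mult: "x \<in> V \<Longrightarrow> y \<in> V \<Longrightarrow> d (x \<otimes> y) = x \<odot>\<^bsub>M\<^esub> d y \<oplus>\<^bsub>M\<^esub> y \<odot>\<^bsub>M\<^esub> d x"
begin

lemmas smult_closed' = M.smult_closed[simplified]
lemmas smult_l_distr' = M.smult_l_distr[simplified]
lemmas smult_assoc' = M.smult_assoc1[simplified]

lemma V_carrier: "x \<in> V \<Longrightarrow> x \<in> carrier R" using subring_carrier[OF V] .

lemma V_zero: "\<zero> \<in> V" and V_one: "\<one> \<in> V" using subringE(2,3)[OF V] by auto

lemma zero_smult: "x \<in> carrier M \<Longrightarrow> \<zero> \<odot>\<^bsub>M\<^esub> x = \<zero>\<^bsub>M\<^esub>"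
  using M.smult_l_null[of x] by simp

lemma d_zero: "d \<zero> = \<zero>\<^bsub>M\<^esub>"
  using d_add[OF V_zero V_zero] d_closed[OF V_zero] M.M.add.l_cancel_one' by auto

lemma d_one: "d \<one> = \<zero>\<^bsub>M\<^esub>"
proof -
  have "\<one> \<odot>\<^bsub>M\<^esub> d \<one> = d \<one>" using M.smult_one[OF d_closed[OF V_one]] by simp
  then have "d \<one> = d \<one> \<oplus>\<^bsub>M\<^esub> d \<one>" using d_mult[OF V_one V_one] by simp
  then show ?thesis using d_closed[OF V_one] M.M.add.l_cancel_one' by metis
qed

lemma d_pow:
  assumes y: "y \<in> V" shows "d (y [^] i) = dpow y i \<odot>\<^bsub>M\<^esub> d y"
proof (induction i)
  case 0
  then show ?case using d_one zero_smult d_closed[OF y] by simp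
next
  case (Suc i)
  have yc: "y \<in> carrier R" and yi: "y [^] i \<in> V" and di: "dpow y i \<in> V"
    using y V_carrier subring_pow_closed[OF V] dpow_mem_subring[OF V] by auto
  have "d (y [^] Suc i) = y [^] i \<odot>\<^bsub>M\<^esub> d y \<oplus>\<^bsub>M\<^esub> y \<odot>\<^bsub>M\<^esub> (dpow y i \<odot>\<^bsub>M\<^esub> d y)"
    using d_mult[OF yi y] Suc.IH by simp
  also have "\<dots> = (y [^] i \<oplus> y \<otimes> dpow y i) \<odot>\<^bsub>M\<^esub> d y"
    using y yi di d_closed[OF y] subringE(6)[OF V]
    by (simp add: smult_l_distr' smult_assoc')
  also have "y [^] i \<oplus> y \<otimes> dpow y i = dpow y (i + 1)"
    unfolding dpow_add[OF yc] using yc by (simp add: dpow_1)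
  finally show ?case by simp
qed

lemma d_pth_power: "x \<in> V \<Longrightarrow> d (x [^] p) = \<zero>\<^bsub>M\<^esub>"
  using d_pow[of x p] dpow_multiple[of x p] V_carrier zero_smult d_closed by simp

text \<open>The \<open>D i\<close> are the partial derivatives with respect to the coordinates \<open>Y i\<close>. The last clause replaces
  linear independence of the \<open>d (Y i)\<close>: an element of \<open>A\<close> that depends on none of the coordinates is a
  \<open>p\<close>-th power.\<close>

definition dual_basis :: "'a set \<Rightarrow> nat \<Rightarrow> (nat \<Rightarrow> 'a) \<Rightarrow> (nat \<Rightarrow> 'a \<Rightarrow> 'a) \<Rightarrow> bool"
  where "dual_basis A N Y D \<longleftrightarrow>
    (\<forall>i<N. Y i \<in> A \<and> D i \<in> derivations (R\<lparr>carrier := A\<rparr>) (pth_powers V)) \<and>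
    (\<forall>x\<in>A. d x = finsum M (\<lambda>i. D i x \<odot>\<^bsub>M\<^esub> d (Y i)) {..<N}) \<and>
    (\<forall>x\<in>A. (\<forall>i<N. D i x = \<zero>) \<longrightarrow> x \<in> pth_powers V)"

lemma dual_basis_pth_powers: "dual_basis (pth_powers V) 0 Y D"
  unfolding dual_basis_def using d_pth_power by (auto simp: pth_powers_def)

text \<open>The given partial derivatives are extended to \<open>A[y]\<close> by zero at \<open>y\<close>, and the derivation \<open>E\<close> that is zero on
  \<open>A\<close> and one at \<open>y\<close> is added. It sends \<open>x = \<Sum> a\<^sub>i y\<^sup>i\<close> to \<open>\<Sum> i a\<^sub>i y\<^sup>i\<^sup>-\<^sup>1\<close>. If this vanishes, then
  \<open>i a\<^sub>i = 0\<close> for all \<open>i < p\<close> by independence, so that \<open>x = a\<^sub>0\<close> lies in \<open>A\<close>, and the last clause of the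
  definition can be applied in \<open>A\<close>.\<close>

lemma dual_basis_adjoin:
  assumes A: "subring A R" "pth_powers V \<subseteq> A" "A \<subseteq> V" and y: "y \<in> V"
    and ind: "powers_independent A y" and db: "dual_basis A N Y D"
  shows "\<exists>Y' D'. dual_basis (adjoin A y) (Suc N) Y' D'"
proof -
  let ?F = "pth_powers V"
  let ?B = "adjoin A y"
  note Ac = subring_carrier[OF A(1)]
  have yc: "y \<in> carrier R" using y V_carrier by simp
  have ypF: "y [^] p \<in> ?F" using y by (auto simp: pth_powers_def)
  have yp: "y [^] p \<in> A" using ypF A(2) by blast
  note B = adjoin_subring[OF A(1) yc yp]
  note BA = adjoin_superset[OF A(1) yc yp]
  note yB = adjoin_generator[OF A(1) yc yp]
  note BV = adjoin_subset[OF A(1) yc yp V A(3) y]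
  have Y: "\<And>i. i < N \<Longrightarrow> Y i \<in> A" and D: "\<And>i. i < N \<Longrightarrow> D i \<in> derivations (R\<lparr>carrier := A\<rparr>) ?F"
    and dx: "\<And>x. x \<in> A \<Longrightarrow> d x = finsum M (\<lambda>i. D i x \<odot>\<^bsub>M\<^esub> d (Y i)) {..<N}"
    and ker: "\<And>x. x \<in> A \<Longrightarrow> (\<And>i. i < N \<Longrightarrow> D i x = \<zero>) \<Longrightarrow> x \<in> ?F"
    using db unfolding dual_basis_def by auto
  note ext = derivation_extends_to_adjoin[OF A(1) yc A(2) ypF ind]
  have z: "(\<lambda>_. \<zero>) \<in> derivations (R\<lparr>carrier := A\<rparr>) ?F"
    using subringE(2)[OF A(1)] Ac by (auto simp: derivations_def)
  obtain E where E: "E \<in> derivations (R\<lparr>carrier := ?B\<rparr>) ?F"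
    and Em: "\<And>a i. a \<in> A \<Longrightarrow> E (a \<otimes> y [^] i) = \<zero> \<otimes> y [^] i \<oplus> a \<otimes> dpow y i \<otimes> \<one>"
    using ext[OF z subringE(3)[OF A(1)]] by blast
  have "\<forall>j\<in>{..<N}. \<exists>D'. D' \<in> derivations (R\<lparr>carrier := ?B\<rparr>) ?F \<and>
      (\<forall>a\<in>A. \<forall>i. D' (a \<otimes> y [^] i) = D j a \<otimes> y [^] i \<oplus> a \<otimes> dpow y i \<otimes> \<zero>)"
    using ext[OF D subringE(2)[OF A(1)]] by blast
  then obtain D' where D': "\<And>j. j < N \<Longrightarrow> D' j \<in> derivations (R\<lparr>carrier := ?B\<rparr>) ?F"
    and D'm': "\<And>j a i. j < N \<Longrightarrow> a \<in> A \<Longrightarrow> D' j (a \<otimes> y [^] i) = D j a \<otimes> y [^] i \<oplus> a \<otimes> dpow y i \<otimes> \<zero>"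
    using bchoice[of "{..<N}"] by (metis lessThan_iff)
  have DA: "D j a \<in> A" if "j < N" "a \<in> A" for j a using derivationsD(1)[OF D] that by blast
  have D'm: "D' j (a \<otimes> y [^] i) = D j a \<otimes> y [^] i" if "j < N" "a \<in> A" for j a and i :: nat
    using D'm'[OF that] DA[OF that] that Ac yc by simp
  have Em: "E (a \<otimes> y [^] i) = a \<otimes> dpow y i" if "a \<in> A" for a i
    using Em[OF that] that Ac yc by simp
  define Y2 where "Y2 = (\<lambda>j. if j < N then Y j else y)"
  define D2 where "D2 = (\<lambda>j. if j < N then D' j else E)"
  have split: "finsum M (\<lambda>j. D2 j x \<odot>\<^bsub>M\<^esub> d (Y2 j)) {..<Suc N}
      = E x \<odot>\<^bsub>M\<^esub> d y \<oplus>\<^bsub>M\<^esub> finsum M (\<lambda>j. D' j x \<odot>\<^bsub>M\<^esub> d (Y j)) {..<N}" if "x \<in> ?B" for x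
  proof -
    have c: "D2 j x \<odot>\<^bsub>M\<^esub> d (Y2 j) \<in> carrier M" for j
      using that derivationsD(1)[OF D'] derivationsD(1)[OF E] BV Y A(3) y
      by (auto simp: D2_def Y2_def intro!: smult_closed' d_closed)
    have "finsum M (\<lambda>j. D2 j x \<odot>\<^bsub>M\<^esub> d (Y2 j)) {..<N} = finsum M (\<lambda>j. D' j x \<odot>\<^bsub>M\<^esub> d (Y j)) {..<N}"
      using c by (intro M.M.finsum_cong') (auto simp: D2_def Y2_def, metis (full_types))
    then show ?thesis using c c[of N, unfolded D2_def Y2_def, simplified] unfolding lessThan_Suc
      by (subst M.M.finsum_insert) (auto simp: D2_def Y2_def)
  qed
  have cl: "D' j x \<odot>\<^bsub>M\<^esub> d (Y j) \<in> carrier M" if "j < N" "x \<in> ?B" for j x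
    using that derivationsD(1)[OF D'] BV Y A(3) by (auto intro!: smult_closed' d_closed)
  have clE: "E x \<odot>\<^bsub>M\<^esub> d y \<in> carrier M" if "x \<in> ?B" for x
    using that derivationsD(1)[OF E] BV y by (auto intro!: smult_closed' d_closed)
  have main: "d x = E x \<odot>\<^bsub>M\<^esub> d y \<oplus>\<^bsub>M\<^esub> finsum M (\<lambda>j. D' j x \<odot>\<^bsub>M\<^esub> d (Y j)) {..<N}" if "x \<in> ?B" for x
    using that
  proof (induction rule: adjoin_induct[OF A(1) yc yp, consumes 1, case_names zero add monomial])
    case zero
    have "finsum M (\<lambda>j. D' j \<zero> \<odot>\<^bsub>M\<^esub> d (Y j)) {..<N} = finsum M (\<lambda>j. \<zero>\<^bsub>M\<^esub>) {..<N}"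
      using derivation_zero[OF D' B] Y A(3) by (intro M.M.finsum_cong') (auto intro!: zero_smult d_closed)
    then show ?case using derivation_zero[OF E B] zero_smult d_zero d_closed[OF y] by simp
  next
    case (add u v)
    have uV: "u \<in> V" "v \<in> V" "E u \<in> V" "E v \<in> V" using add BV derivationsD(1)[OF E] by auto
    have "finsum M (\<lambda>j. D' j (u \<oplus> v) \<odot>\<^bsub>M\<^esub> d (Y j)) {..<N}
        = finsum M (\<lambda>j. D' j u \<odot>\<^bsub>M\<^esub> d (Y j) \<oplus>\<^bsub>M\<^esub> D' j v \<odot>\<^bsub>M\<^esub> d (Y j)) {..<N}"
    proof (intro M.M.finsum_cong' refl)
      fix j assume "j \<in> {..<N}"
      then have j: "j < N" by simp
      have "D' j u \<in> V" "D' j v \<in> V" "d (Y j) \<in> carrier M"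
        using derivationsD(1)[OF D'[OF j]] add(1,2) BV Y[OF j] A(3) d_closed by auto
      then show "D' j (u \<oplus> v) \<odot>\<^bsub>M\<^esub> d (Y j) = D' j u \<odot>\<^bsub>M\<^esub> d (Y j) \<oplus>\<^bsub>M\<^esub> D' j v \<odot>\<^bsub>M\<^esub> d (Y j)"
        using derivationsD(2)[OF D'[OF j]] add(1,2) by (simp add: smult_l_distr')
    qed (use cl add in auto)
    also have "\<dots> = finsum M (\<lambda>j. D' j u \<odot>\<^bsub>M\<^esub> d (Y j)) {..<N} \<oplus>\<^bsub>M\<^esub> finsum M (\<lambda>j. D' j v \<odot>\<^bsub>M\<^esub> d (Y j)) {..<N}"
      using cl add by (intro M.M.finsum_addf) auto
    finally have 1: "finsum M (\<lambda>j. D' j (u \<oplus> v) \<odot>\<^bsub>M\<^esub> d (Y j)) {..<N} = \<dots>" .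
    have 2: "E (u \<oplus> v) \<odot>\<^bsub>M\<^esub> d y = E u \<odot>\<^bsub>M\<^esub> d y \<oplus>\<^bsub>M\<^esub> E v \<odot>\<^bsub>M\<^esub> d y"
      using derivationsD(2)[OF E] add(1,2) uV d_closed[OF y] by (simp add: smult_l_distr')
    have f: "finsum M (\<lambda>j. D' j w \<odot>\<^bsub>M\<^esub> d (Y j)) {..<N} \<in> carrier M" if "w \<in> ?B" for w
      using cl that by (intro M.M.finsum_closed) auto
    show ?case unfolding 1 2 d_add[OF uV(1,2)] add.IH
      using f[OF add(1)] f[OF add(2)] clE[OF add(1)] clE[OF add(2)] by (simp add: M.M.a_ac)
  next
    case (monomial a i)
    have aV: "a \<in> V" and yi: "y [^] i \<in> V" and di: "dpow y i \<in> V"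
      using monomial A(3) subring_pow_closed[OF V y] dpow_mem_subring[OF V y] by auto
    have "finsum M (\<lambda>j. D' j (a \<otimes> y [^] i) \<odot>\<^bsub>M\<^esub> d (Y j)) {..<N}
        = finsum M (\<lambda>j. y [^] i \<odot>\<^bsub>M\<^esub> (D j a \<odot>\<^bsub>M\<^esub> d (Y j))) {..<N}"
    proof (intro M.M.finsum_cong' refl)
      fix j assume "j \<in> {..<N}"
      then have j: "j < N" by simp
      have c: "D j a \<in> V" "d (Y j) \<in> carrier M" using DA[OF j monomial(1)] Y[OF j] A(3) d_closed by auto
      then have "D j a \<otimes> y [^] i = y [^] i \<otimes> D j a" using V_carrier yi by (simp add: m_comm)
      then show "D' j (a \<otimes> y [^] i) \<odot>\<^bsub>M\<^esub> d (Y j) = y [^] i \<odot>\<^bsub>M\<^esub> (D j a \<odot>\<^bsub>M\<^esub> d (Y j))"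
        using D'm[OF j monomial(1)] c yi smult_assoc' by simp
    next
      show "(\<lambda>j. y [^] i \<odot>\<^bsub>M\<^esub> (D j a \<odot>\<^bsub>M\<^esub> d (Y j))) \<in> {..<N} \<rightarrow> carrier M"
        using DA monomial Y A(3) yi by (auto intro!: smult_closed' d_closed)
    qed
    also have "\<dots> = y [^] i \<odot>\<^bsub>M\<^esub> d a"
      unfolding dx[OF monomial(1)]
      by (rule M.finsum_smult_ldistr[symmetric])
         (use yi DA monomial Y A(3) in \<open>auto intro!: smult_closed' d_closed\<close>)
    finally have 1: "finsum M (\<lambda>j. D' j (a \<otimes> y [^] i) \<odot>\<^bsub>M\<^esub> d (Y j)) {..<N} = y [^] i \<odot>\<^bsub>M\<^esub> d a" .
    show ?case unfolding 1 Em[OF monomial(1)] d_mult[OF aV yi] d_pow[OF y]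
      using aV di d_closed[OF y] by (simp add: smult_assoc')
  qed
  have "x \<in> ?F" if xB: "x \<in> ?B" and zero: "\<And>j. j < Suc N \<Longrightarrow> D2 j x = \<zero>" for x
  proof -
    obtain a where a: "\<And>i. i < p \<Longrightarrow> a i \<in> A" "x = (\<Oplus>i\<in>{..<p}. a i \<otimes> y [^] i)"
      using xB by (rule adjoinE) blast
    \<comment> \<open>the factor \<open>y\<close> turns \<open>i a\<^sub>i y\<^sup>i\<^sup>-\<^sup>1\<close> into a multiple of \<open>y\<^sup>i\<close>\<close>
    have "\<zero> = y \<otimes> E x" using zero[of N] yc by (simp add: D2_def)
    also have "E x = (\<Oplus>i\<in>{..<p}. E (a i \<otimes> y [^] i))"
      unfolding a(2) by (rule derivation_finsum[OF E B]) (use a(1) adjoin_monomial[OF A(1) yc yp] in auto)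
    also have "\<dots> = (\<Oplus>i\<in>{..<p}. a i \<otimes> dpow y i)"
      using Em a(1) Ac yc by (intro finsum_cong') auto
    also have "y \<otimes> \<dots> = (\<Oplus>i\<in>{..<p}. y \<otimes> (a i \<otimes> dpow y i))"
      using a(1) Ac yc by (intro finsum_rdistr) auto
    also have "\<dots> = (\<Oplus>i\<in>{..<p}. add_pow R i (a i) \<otimes> y [^] i)"
    proof (intro finsum_cong' refl)
      fix i assume "i \<in> {..<p}"
      then have ai: "a i \<in> carrier R" using a(1) Ac by simp
      then have "y \<otimes> (a i \<otimes> dpow y i) = a i \<otimes> (y \<otimes> dpow y i)" using yc by (simp add: m_lcomm)
      also have "\<dots> = add_pow R i (a i \<otimes> y [^] i)"
        unfolding dpow_mult[OF yc] using ai yc by (intro add_pow_rdistr) auto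
      also have "\<dots> = add_pow R i (a i) \<otimes> y [^] i"
        using ai yc by (intro add_pow_ldistr[symmetric]) auto
      finally show "y \<otimes> (a i \<otimes> dpow y i) = add_pow R i (a i) \<otimes> y [^] i" .
    qed (use a(1) Ac yc in auto)
    finally have sum0: "(\<Oplus>i\<in>{..<p}. add_pow R i (a i) \<otimes> y [^] i) = \<zero>" by simp
    have apA: "add_pow R n b \<in> A" if "b \<in> A" for n :: nat and b
      using that subringE(2,7)[OF A(1)] by (induction n) auto
    have "a i = \<zero>" if i: "0 < i" "i < p" for i
    proof -
      have "add_pow R i (a i) = \<zero>"
        by (rule powers_independentD[where a = "\<lambda>i. add_pow R i (a i)", OF ind _ sum0 i(2)])
           (use a(1) apA in auto)
      then show ?thesis using add_pow_eq_zeroD Ac a(1) i by blast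
    qed
    then have "x = a 0 \<otimes> y [^] (0::nat)"
      unfolding a(2) using a(1) Ac yc p_pos by (intro sum_single) auto
    then have x: "x = a 0 \<otimes> y [^] (0::nat)" "x = a 0" using a(1)[OF p_pos] Ac by auto
    show ?thesis unfolding x(2)
    proof (rule ker)
      show "a 0 \<in> A" using a(1) p_pos by simp
      fix j assume j: "j < N"
      have "D' j x = \<zero>" using zero[of j] j by (simp add: D2_def)
      then show "D j (a 0) = \<zero>"
        using D'm[OF j, of "a 0" 0] a(1)[OF p_pos] x(1) DA[OF j] Ac by simp
    qed
  qed
  moreover have "Y2 j \<in> ?B \<and> D2 j \<in> derivations (R\<lparr>carrier := ?B\<rparr>) ?F" if "j < Suc N" for j
    using that Y BA yB D' E by (auto simp: Y2_def D2_def)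
  ultimately have "dual_basis ?B (Suc N) Y2 D2"
    unfolding dual_basis_def using main split by simp
  then show ?thesis by blast
qed

end

section \<open>Discrete valuation rings of characteristic \<open>p\<close>\<close>

text \<open>A local ring with principal maximal ideal \<open>(s)\<close> inside a field. Locality is stated for elements, without
  reference to ideals, which is the form that computations use.\<close>

locale char_p_principal_local = char_p_field R p for R :: "('a, 'r) ring_scheme" (structure) and p +
  fixes V :: "'a set" and s :: 'a
  assumes V: "subring V R" and s: "s \<in> V" "s \<noteq> \<zero>"
    and unit: "x \<in> V \<Longrightarrow> (\<And>v. v \<in> V \<Longrightarrow> x \<noteq> s \<otimes> v) \<Longrightarrow> \<exists>w\<in>V. x \<otimes> w = \<one>"
    and nonunit: "v \<in> V \<Longrightarrow> s \<otimes> v \<noteq> \<one>"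
begin

definition m :: "'a set" where "m = (\<lambda>v. s \<otimes> v) ` V"

lemma Vc: "x \<in> V \<Longrightarrow> x \<in> carrier R" using subring_carrier[OF V] .

lemmas V_ops = subringE(2,3,5,6,7)[OF V]

lemma V_pow: "x \<in> V \<Longrightarrow> x [^] (n::nat) \<in> V" using subring_pow_closed[OF V] .

lemma sc: "s \<in> carrier R" using s Vc by simp

lemma mV: "m \<subseteq> V" using V_ops s by (auto simp: m_def)

lemma mI: "v \<in> V \<Longrightarrow> s \<otimes> v \<in> m" by (auto simp: m_def)

lemma mE: "x \<in> m \<Longrightarrow> (\<And>v. v \<in> V \<Longrightarrow> x = s \<otimes> v \<Longrightarrow> P) \<Longrightarrow> P" by (auto simp: m_def)

lemma m_zero: "\<zero> \<in> m" using mI[OF V_ops(1)] sc by simp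

lemma m_add:
  assumes "x \<in> m" "y \<in> m" shows "x \<oplus> y \<in> m"
proof -
  obtain v w where "v \<in> V" "w \<in> V" "x = s \<otimes> v" "y = s \<otimes> w" using assms by (auto elim!: mE)
  then show ?thesis using mI[of "v \<oplus> w"] V_ops Vc sc by (simp add: r_distr)
qed

lemma m_mult:
  assumes "x \<in> V" "y \<in> m" shows "x \<otimes> y \<in> m"
proof -
  obtain w where "w \<in> V" "y = s \<otimes> w" using assms by (auto elim!: mE)
  then show ?thesis using mI[of "x \<otimes> w"] V_ops Vc sc assms by (simp add: m_lcomm)
qed

lemma m_mult_r: "x \<in> V \<Longrightarrow> y \<in> m \<Longrightarrow> y \<otimes> x \<in> m"
  using m_mult[of x y] m_comm[of x y] mV Vc by auto

lemma m_neg: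
  assumes "x \<in> m" shows "\<ominus> x \<in> m"
proof -
  obtain w where "w \<in> V" "x = s \<otimes> w" using assms by (auto elim!: mE)
  then show ?thesis using mI[of "\<ominus> w"] V_ops Vc sc by (simp add: r_minus)
qed

lemma V_cring: "cring (R\<lparr>carrier := V\<rparr>)"
  using V subcring_iff subcringI' Vc by (metis subcring.axioms(1) subringE(1))

lemma V_neg: "z \<in> V \<Longrightarrow> \<ominus>\<^bsub>R\<lparr>carrier := V\<rparr>\<^esub> z = \<ominus> z"
proof -
  interpret Rc: cring "R\<lparr>carrier := V\<rparr>" by (rule V_cring)
  show "z \<in> V \<Longrightarrow> \<ominus>\<^bsub>R\<lparr>carrier := V\<rparr>\<^esub> z = \<ominus> z"
    using Rc.minus_equality[of "\<ominus> z" z] V_ops Vc by (simp add: l_neg)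
qed

lemma unit_or_m: "x \<in> V \<Longrightarrow> x \<notin> m \<Longrightarrow> \<exists>w\<in>V. x \<otimes> w = \<one>"
  by (rule unit) (auto simp: m_def)

lemma one_notin_m: "\<one> \<notin> m"
  using nonunit unfolding m_def by force

lemma m_prime:
  assumes "x \<in> V" "x \<notin> m" "y \<in> V" "x \<otimes> y \<in> m" shows "y \<in> m"
proof -
  obtain w where w: "w \<in> V" "x \<otimes> w = \<one>" using unit_or_m[OF assms(1,2)] by blast
  have "y = w \<otimes> (x \<otimes> y)" using w assms Vc by (simp add: m_assoc[symmetric] m_comm[of w x])
  then show ?thesis using m_mult[OF w(1) assms(4)] by simp
qed

lemma m_pow_prime:
  assumes "x \<in> V" "x [^] (n::nat) \<in> m" shows "x \<in> m"
proof (rule ccontr)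
  assume x: "x \<notin> m"
  have "x [^] (k::nat) \<notin> m" for k
  proof (induction k)
    case 0 then show ?case using one_notin_m by simp
  next
    case (Suc k)
    then show ?case using m_prime[OF assms(1) x V_pow[OF assms(1), of k]] assms(1) Vc
      by (auto simp: m_comm)
  qed
  then show False using assms(2) by blast
qed

lemma m_maximal: "maximalideal m (R\<lparr>carrier := V\<rparr>)"
proof (rule maximalidealI)
  interpret Rc: cring "R\<lparr>carrier := V\<rparr>" by (rule V_cring)
  show I: "ideal m (R\<lparr>carrier := V\<rparr>)"
  proof (rule idealI)
    show "ring (R\<lparr>carrier := V\<rparr>)" by (rule Rc.ring_axioms)
    show "subgroup m (add_monoid (R\<lparr>carrier := V\<rparr>))"
    proof (rule Rc.add.subgroupI)
      show "m \<subseteq> carrier (R\<lparr>carrier := V\<rparr>)" using mV by simp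
      show "m \<noteq> {}" using s by (auto simp: m_def)
      fix a assume a: "a \<in> m"
      then show "\<ominus>\<^bsub>R\<lparr>carrier := V\<rparr>\<^esub> a \<in> m"
        using m_neg[OF a] V_neg[of a] mV by auto
    qed (use m_add in simp)
  qed (use m_mult m_mult_r in auto)
  show "carrier (R\<lparr>carrier := V\<rparr>) \<noteq> m" using one_notin_m V_ops by auto
  fix J assume J: "ideal J (R\<lparr>carrier := V\<rparr>)" "m \<subseteq> J" "J \<subseteq> carrier (R\<lparr>carrier := V\<rparr>)"
  show "J = m \<or> J = carrier (R\<lparr>carrier := V\<rparr>)"
  proof (cases "J = m")
    case False
    then obtain x where x: "x \<in> J" "x \<notin> m" "x \<in> V" using J by auto
    then obtain w where w: "w \<in> V" "x \<otimes> w = \<one>" using unit_or_m by blast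
    then have "\<one> \<in> J" using ideal.I_r_closed[OF J(1) x(1), of w] by simp
    then show ?thesis using ideal.one_imp_carrier[OF J(1)] by simp
  qed simp
qed

text \<open>The intersection of the powers of the maximal ideal is a prime ideal properly contained in it. In
  dimension one, the zero ideal is the only such ideal.\<close>

lemma separated_if_krull_dim_one:
  assumes dim: "krull_dim (R\<lparr>carrier := V\<rparr>) = 1"
    and x: "x \<in> V" "\<And>n::nat. \<exists>v\<in>V. x = s [^] n \<otimes> v"
  shows "x = \<zero>"
proof (rule ccontr)
  assume x0: "x \<noteq> \<zero>"
  let ?V = "R\<lparr>carrier := V\<rparr>"
  interpret Vd: domain ?V by (rule subring_is_domain[OF V])
  define I where "I = {a \<in> V. \<forall>n::nat. \<exists>v\<in>V. a = s [^] n \<otimes> v}"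
  have I_V: "a \<in> V" if "a \<in> I" for a using that by (simp add: I_def)
  have I_div: "\<exists>v\<in>V. a = s [^] (n::nat) \<otimes> v" if "a \<in> I" for a n using that by (simp add: I_def)
  have II: "a \<in> I" if "a \<in> V" "\<And>n::nat. \<exists>v\<in>V. a = s [^] n \<otimes> v" for a using that by (simp add: I_def)
  have Sc: "s [^] (n::nat) \<in> carrier R" "s [^] (n::nat) \<noteq> \<zero>" for n
    using sc nonzero_pow_nonzero[OF sc s(2)] by auto
  have I_add: "a \<oplus> b \<in> I" if ab: "a \<in> I" "b \<in> I" for a b
  proof (rule II)
    show "a \<oplus> b \<in> V" using ab I_V V_ops by simp
    fix n :: nat
    obtain v w where "v \<in> V" "a = s [^] n \<otimes> v" "w \<in> V" "b = s [^] n \<otimes> w"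
      using I_div[OF ab(1), of n] I_div[OF ab(2), of n] by blast
    then show "\<exists>v\<in>V. a \<oplus> b = s [^] n \<otimes> v"
      using V_ops Vc Sc by (intro bexI[of _ "v \<oplus> w"]) (auto simp: r_distr)
  qed
  have I_mult: "c \<otimes> a \<in> I" if ca: "c \<in> V" "a \<in> I" for a c
  proof (rule II)
    show "c \<otimes> a \<in> V" using ca I_V V_ops by simp
    fix n :: nat
    obtain v where "v \<in> V" "a = s [^] n \<otimes> v" using I_div[OF ca(2), of n] by blast
    then show "\<exists>v\<in>V. c \<otimes> a = s [^] n \<otimes> v"
      using ca(1) V_ops Vc Sc by (intro bexI[of _ "c \<otimes> v"]) (auto simp: m_lcomm)
  qed
  have I_ideal: "ideal I ?V"
  proof (rule idealI)
    show "ring ?V" by (rule Vd.ring_axioms)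
    show "subgroup I (add_monoid ?V)"
    proof (rule Vd.add.subgroupI)
      show "I \<subseteq> carrier ?V" using I_V by auto
      show "I \<noteq> {}" using II[OF x] by blast
      fix a assume a: "a \<in> I"
      have "\<ominus> a = (\<ominus> \<one>) \<otimes> a" using I_V[OF a] Vc by (simp add: l_minus)
      then show "\<ominus>\<^bsub>?V\<^esub> a \<in> I" using I_mult[OF _ a, of "\<ominus> \<one>"] V_neg[OF I_V[OF a]] V_ops by simp
    qed (use I_add in simp)
  next
    fix a c assume "a \<in> I" "c \<in> carrier ?V"
    then show "c \<otimes>\<^bsub>?V\<^esub> a \<in> I" "a \<otimes>\<^bsub>?V\<^esub> c \<in> I"
      using I_mult[of c a] I_V[of a] Vc m_comm[of a c] by auto
  qed
  have I_m: "a \<in> m" if "a \<in> I" for a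
    using I_div[OF that, of 1] sc mI by auto
  have order: "\<exists>i a'. a = s [^] (i::nat) \<otimes> a' \<and> a' \<in> V \<and> a' \<notin> m" if a: "a \<in> V" "a \<notin> I" for a
  proof -
    \<comment> \<open>the order of \<open>a\<close> is the predecessor of the least indivisible exponent\<close>
    define indivisible where "indivisible = (\<lambda>n::nat. \<not> (\<exists>v\<in>V. a = s [^] n \<otimes> v))"
    have "\<exists>n. indivisible n"
    proof (rule ccontr)
      assume "\<not> (\<exists>n. indivisible n)"
      then have "\<exists>v\<in>V. a = s [^] n \<otimes> v" for n :: nat unfolding indivisible_def by simp
      then show False using a II by simp
    qed
    then obtain n where n': "indivisible n" "\<And>i. i < n \<Longrightarrow> \<not> indivisible i"
      using LeastI_ex[of indivisible] not_less_Least[of _ indivisible] by blast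
    have n: "\<not> (\<exists>v\<in>V. a = s [^] n \<otimes> v)" "\<And>i. i < n \<Longrightarrow> \<exists>v\<in>V. a = s [^] i \<otimes> v"
      using n' unfolding indivisible_def by auto
    have "n \<noteq> 0" using n(1) a(1) Vc by (intro notI) auto
    then obtain i where i: "n = Suc i" by (cases n) auto
    obtain v where v: "v \<in> V" "a = s [^] i \<otimes> v" using n(2)[of i] i by blast
    have "v \<notin> m"
    proof
      assume "v \<in> m"
      then obtain w where "w \<in> V" "v = s \<otimes> w" by (auto elim: mE)
      then have "w \<in> V" "a = s [^] n \<otimes> w" using v(2) i sc Vc by (auto simp: m_assoc)
      then show False using n(1) by blast
    qed
    then show ?thesis using v by blast
  qed
  have I_prime: "primeideal I ?V"
  proof (rule primeidealI[OF I_ideal V_cring])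
    show "carrier ?V \<noteq> I" using I_m one_notin_m V_ops by auto
    fix a b assume ab: "a \<in> carrier ?V" "b \<in> carrier ?V" "a \<otimes>\<^bsub>?V\<^esub> b \<in> I"
    show "a \<in> I \<or> b \<in> I"
    proof (rule ccontr)
      assume "\<not> (a \<in> I \<or> b \<in> I)"
      then obtain i a' j b' where a: "a = s [^] (i::nat) \<otimes> a'" "a' \<in> V" "a' \<notin> m"
        and b: "b = s [^] (j::nat) \<otimes> b'" "b' \<in> V" "b' \<notin> m"
        using order[of a] order[of b] ab by auto
      obtain v where v: "v \<in> V" "a \<otimes> b = s [^] (i + j + 1) \<otimes> v"
        using I_div[of "a \<otimes> b" "i + j + 1"] ab(3) by auto
      have c: "a' \<in> carrier R" "b' \<in> carrier R" "v \<in> carrier R" using a b v Vc by auto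
      have "s [^] (i + j) \<otimes> (a' \<otimes> b') = a \<otimes> b"
        unfolding a(1) b(1) nat_pow_mult[OF sc, symmetric] using c sc by (simp add: m_ac)
      also have "\<dots> = s [^] (i + j) \<otimes> (s \<otimes> v)" unfolding v(2) using c sc by (simp add: m_assoc)
      finally have "a' \<otimes> b' = s \<otimes> v" using m_lcancel[OF Sc(2,1)] c sc by simp
      then show False using m_prime[OF a(2,3) b(2)] b(3) mI[OF v(1)] by simp
    qed
  qed
  have m_prime_ideal: "primeideal m ?V" by (rule Vd.maximalideal_prime[OF m_maximal])
  have zero_prime: "primeideal {\<zero>} ?V" using Vd.zeroprimeideal by simp
  have "\<zero> \<in> I" using additive_subgroup.zero_closed[OF ideal.axioms(1)[OF I_ideal]] by simp
  then have 01: "{\<zero>} \<subset> I" using II[OF x] x0 by blast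
  have "s \<notin> I"
  proof
    assume "s \<in> I"
    then obtain v where v: "v \<in> V" "s = s [^] (2::nat) \<otimes> v" using I_div by blast
    then have e: "s \<otimes> \<one> = s \<otimes> (s \<otimes> v)" using sc Vc by (simp add: numeral_2_eq_2 m_assoc)
    have "s \<otimes> v \<in> carrier R" using sc v(1) Vc by simp
    from m_lcancel[OF s(2) sc one_closed this] have "\<one> = s \<otimes> v" using e by blast
    then show False using nonunit[OF v(1)] by simp
  qed
  moreover have "s \<in> m" using mI[OF V_ops(2)] sc by simp
  ultimately have 12: "I \<subset> m" using I_m by blast
  let ?P = "\<lambda>i::nat. if i = 0 then {\<zero>} else if i = 1 then I else m"
  have chain: "(\<forall>i\<le>2. primeideal (?P i) ?V) \<and> (\<forall>i<2. ?P i \<subset> ?P (Suc i))"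
    using I_prime m_prime_ideal zero_prime 01 12 by (auto simp: less_2_cases_iff)
  have "enat 2 \<in> {enat n | n. \<exists>P. (\<forall>i\<le>n. primeideal (P i) ?V) \<and> (\<forall>i<n. P i \<subset> P (Suc i))}"
    by (rule CollectI, rule exI[of _ 2], rule conjI[OF refl], rule exI[of _ ?P], rule chain)
  then have "enat 2 \<le> krull_dim ?V" unfolding krull_dim_def by (rule Sup_upper)
  then show False unfolding dim by (simp add: one_enat_def)
qed

end

text \<open>A local domain with principal nonzero maximal ideal is a discrete valuation ring if no nonzero element
  is divisible by all powers of the uniformizer.\<close>

locale char_p_dvr = char_p_principal_local +
  assumes separated: "x \<in> V \<Longrightarrow> (\<And>n::nat. \<exists>v\<in>V. x = s [^] n \<otimes> v) \<Longrightarrow> x = \<zero>"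
begin

lemma pth_powers_V: "pth_powers V \<subseteq> V"
  using V_pow by (auto simp: pth_powers_def)

text \<open>The inverse \<open>b\<close> of \<open>a\<close> is \<open>a\<^sup>p\<^sup>-\<^sup>1 b\<^sup>p\<close>.\<close>

lemma inverse_in_subring:
  assumes A: "subring A R" "pth_powers V \<subseteq> A" and a: "a \<in> A" "a \<in> V" and b: "b \<in> V" "a \<otimes> b = \<one>"
  shows "b \<in> A"
proof -
  obtain q where q: "p = Suc q" using p_pos by (cases p) auto
  have "b = (a \<otimes> b) [^] q \<otimes> b" using b Vc by simp
  also have "\<dots> = a [^] q \<otimes> b [^] p" using Vc[OF a(2)] Vc[OF b(1)] q by (simp add: nat_pow_distrib m_assoc)
  finally show ?thesis
    using subringE(6)[OF A(1) subring_pow_closed[OF A(1) a(1)], of "b [^] p" q] A(2) b(1)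
    by (auto simp: pth_powers_def)
qed

text \<open>Reduction modulo the maximal ideal: the image of \<open>A\<close> in the residue field of \<open>V\<close> is a subfield, as \<open>A\<close>
  contains the inverses of its units, and over this subfield the powers of the residue class of \<open>y\<close> are
  independent.\<close>

lemma residues_independent:
  assumes A: "subring A R" "pth_powers V \<subseteq> A" "A \<subseteq> V"
    and y: "y \<in> V" "\<And>a. a \<in> A \<Longrightarrow> y \<ominus> a \<notin> m"
    and a: "\<And>i. i < p \<Longrightarrow> a i \<in> A" and sum: "(\<Oplus>i\<in>{..<p}. a i \<otimes> y [^] i) \<in> m" and j: "j < p"
  shows "a j \<in> m"
proof -
  let ?V = "R\<lparr>carrier := V\<rparr>"
  interpret Vr: cring ?V by (rule V_cring)
  interpret I: maximalideal m ?V by (rule m_maximal)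
  let ?k = "?V Quot m"
  let ?h = "(+>\<^bsub>?V\<^esub>) m"
  interpret k: field ?k by (rule I.quotient_is_field[OF V_cring])
  interpret h: ring_hom_ring ?V ?k ?h by (rule I.rcos_ring_hom_ring)
  have Vminus: "x \<ominus>\<^bsub>?V\<^esub> z = x \<ominus> z" if "x \<in> V" "z \<in> V" for x z
    using V_neg[OF that(2)] by (simp add: a_minus_def)
  have h_eq: "?h x = ?h z \<longleftrightarrow> x \<ominus> z \<in> m" if "x \<in> V" "z \<in> V" for x z
    using Vr.quotient_eq_iff_same_a_r_cos[OF I.is_ideal, of x z] that Vminus by simp
  have h_zero: "?h x = \<zero>\<^bsub>?k\<^esub> \<longleftrightarrow> x \<in> m" if "x \<in> V" for x
    using h_eq[OF that V_ops(1)] h.hom_zero that Vc by (simp add: a_minus_def)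
  have h_add: "?h (x \<oplus> z) = ?h x \<oplus>\<^bsub>?k\<^esub> ?h z" if "x \<in> V" "z \<in> V" for x z
    using h.hom_add[of x z] that by simp
  have h_mult: "?h (x \<otimes> z) = ?h x \<otimes>\<^bsub>?k\<^esub> ?h z" if "x \<in> V" "z \<in> V" for x z
    using h.hom_mult[of x z] that by simp
  have h_closed: "?h x \<in> carrier ?k" if "x \<in> V" for x using h.hom_closed[of x] that by simp
  have h_one: "?h \<one> = \<one>\<^bsub>?k\<^esub>" using h.hom_one by simp
  have h_pow: "?h (x [^] (n::nat)) = ?h x [^]\<^bsub>?k\<^esub> n" if "x \<in> V" for x n
    by (induction n) (use that h_mult V_pow h_one in auto)
  have kp: "char_p_ring ?k p"
  proof
    have "?h (add_pow R n \<one>) = add_pow ?k n \<one>\<^bsub>?k\<^esub> \<and> add_pow R n \<one> \<in> V" for n :: nat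
    proof (induction n)
      case 0 then show ?case using h_zero[OF V_ops(1)] V_ops(1) m_zero by simp
    next
      case (Suc n) then show ?case using h_add V_ops h_one by auto
    qed
    from this[of p] show "add_pow ?k p \<one>\<^bsub>?k\<^esub> = \<zero>\<^bsub>?k\<^esub>"
      using char_p h.hom_zero by simp
  qed (rule prime_p)
  interpret kp: char_p_field ?k p
    by (intro char_p_field.intro k.field_axioms kp)
  have AV: "x \<in> V" if "x \<in> A" for x using that A(3) by blast
  have L: "subfield (?h ` A) ?k"
  proof (rule k.subfieldI')
    have "subring A ?V"
      by (rule Vr.subringI) (use A(3) subringE[OF A(1)] V_neg in \<open>auto simp: subset_iff\<close>)
    then show "subring (?h ` A) ?k" by (rule h.img_is_subring)
    fix l assume "l \<in> ?h ` A - {\<zero>\<^bsub>?k\<^esub>}"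
    then obtain b where b: "b \<in> A" "l = ?h b" "b \<notin> m" using h_zero AV by auto
    obtain w where w: "w \<in> V" "b \<otimes> w = \<one>" using unit_or_m[OF AV[OF b(1)] b(3)] by blast
    have "w \<in> A" using inverse_in_subring[OF A(1,2) b(1) AV[OF b(1)] w] .
    moreover have "inv\<^bsub>?k\<^esub> l = ?h w"
      using k.comm_inv_char[of l "?h w"] h_mult[OF AV[OF b(1)] w(1)] w b h_one h_closed AV by simp
    ultimately show "inv\<^bsub>?k\<^esub> l \<in> ?h ` A" by blast
  qed
  have hsum: "?h (\<Oplus>i\<in>{..<n}. a i \<otimes> y [^] i) = (\<Oplus>\<^bsub>?k\<^esub>i\<in>{..<n}. ?h (a i) \<otimes>\<^bsub>?k\<^esub> ?h y [^]\<^bsub>?k\<^esub> i)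
    \<and> (\<Oplus>i\<in>{..<n}. a i \<otimes> y [^] i) \<in> V" if "n \<le> p" for n
    using that
  proof (induction n)
    case 0 then show ?case using h.hom_zero V_ops by simp
  next
    case (Suc n)
    have t: "a i \<otimes> y [^] i \<in> V" if "i < Suc n" for i using that Suc.prems a AV y(1) V_ops V_pow by simp
    have 1: "(\<Oplus>i\<in>{..<Suc n}. a i \<otimes> y [^] i) = a n \<otimes> y [^] n \<oplus> (\<Oplus>i\<in>{..<n}. a i \<otimes> y [^] i)"
      unfolding lessThan_Suc by (subst finsum_insert) (use t Vc in auto)
    have 2: "(\<Oplus>\<^bsub>?k\<^esub>i\<in>{..<Suc n}. ?h (a i) \<otimes>\<^bsub>?k\<^esub> ?h y [^]\<^bsub>?k\<^esub> i)
        = ?h (a n) \<otimes>\<^bsub>?k\<^esub> ?h y [^]\<^bsub>?k\<^esub> n \<oplus>\<^bsub>?k\<^esub> (\<Oplus>\<^bsub>?k\<^esub>i\<in>{..<n}. ?h (a i) \<otimes>\<^bsub>?k\<^esub> ?h y [^]\<^bsub>?k\<^esub> i)"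
      unfolding lessThan_Suc by (subst k.finsum_insert) (use h_closed a AV y(1) Suc.prems in auto)
    have "?h (a n \<otimes> y [^] n) = ?h (a n) \<otimes>\<^bsub>?k\<^esub> ?h y [^]\<^bsub>?k\<^esub> n"
      using h_mult[OF AV[OF a] V_pow[OF y(1)]] h_pow[OF y(1)] Suc.prems by simp
    then show ?case unfolding 1 2 using Suc t[of n] h_add V_ops by simp
  qed
  have "?h (a j) = \<zero>\<^bsub>?k\<^esub>"
  proof (rule kp.powers_independent_over_subfield[OF L _ _ _ _ _ j])
    show "?h y \<in> carrier ?k" using h_closed y by simp
    show "?h y [^]\<^bsub>?k\<^esub> p \<in> ?h ` A"
      using h_pow[OF y(1), of p] A(2) y(1) by (force simp: pth_powers_def)
    show "?h y \<notin> ?h ` A" using h_eq y AV by auto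
    show "?h (a i) \<in> ?h ` A" if "i < p" for i using a that by blast
    have "?h (\<Oplus>i\<in>{..<p}. a i \<otimes> y [^] i) = \<zero>\<^bsub>?k\<^esub>"
      using h_zero conjunct2[OF hsum[OF order_refl]] sum by blast
    then show "(\<Oplus>\<^bsub>?k\<^esub>i\<in>{..<p}. ?h (a i) \<otimes>\<^bsub>?k\<^esub> ?h y [^]\<^bsub>?k\<^esub> i) = \<zero>\<^bsub>?k\<^esub>"
      unfolding conjunct1[OF hsum[OF order_refl]] .
  qed
  then show ?thesis using h_zero AV a j by blast
qed

text \<open>The subrings \<open>A\<close> between \<open>V\<^sup>p\<close> and \<open>V\<close> in which \<open>s\<^sup>p\<close> is still a uniformizer.\<close>

definition unramified :: "'a set \<Rightarrow> bool"
  where "unramified A \<longleftrightarrow> subring A R \<and> pth_powers V \<subseteq> A \<and> A \<subseteq> V \<and>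
    (\<forall>x\<in>A \<inter> m. \<exists>b\<in>A. x = s [^] p \<otimes> b)"

lemma unramified_pth_powers: "unramified (pth_powers V)"
  unfolding unramified_def
proof (intro conjI ballI)
  fix x assume "x \<in> pth_powers V \<inter> m"
  then obtain w where w: "w \<in> V" "x = w [^] p" "w \<in> m" using m_pow_prime by (auto simp: pth_powers_def)
  then obtain v where "v \<in> V" "w = s \<otimes> v" by (auto simp: m_def)
  then show "\<exists>b\<in>pth_powers V. x = s [^] p \<otimes> b"
    using w Vc sc by (auto simp: pth_powers_def nat_pow_distrib)
qed (use pth_powers_subring[OF V] pth_powers_V in auto)

text \<open>Coefficients of a relation that lie in the maximal ideal are divisible by \<open>s\<^sup>p\<close> in \<open>A\<close>, and dividing by \<open>s\<^sup>p\<close>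
  gives another relation. Hence, if every relation has its coefficients in the maximal ideal, these
  coefficients are divisible by arbitrarily high powers of \<open>s\<close>, and vanish.\<close>

lemma independent_by_descent:
  assumes A: "unramified A" and y: "y \<in> V"
    and step: "\<And>a j. (\<And>i. i < p \<Longrightarrow> a i \<in> A) \<Longrightarrow> (\<Oplus>i\<in>{..<p}. a i \<otimes> y [^] i) = \<zero> \<Longrightarrow> j < p \<Longrightarrow> a j \<in> m"
  shows "powers_independent A y"
proof -
  have A': "subring A R" "A \<subseteq> V" and sat: "\<And>x. x \<in> A \<Longrightarrow> x \<in> m \<Longrightarrow> \<exists>b\<in>A. x = s [^] p \<otimes> b"
    using A by (auto simp: unramified_def)
  have yc: "y \<in> carrier R" using y Vc by simp
  have div: "\<forall>i<p. \<exists>v\<in>V. a i = s [^] (n::nat) \<otimes> v"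
    if "\<And>i. i < p \<Longrightarrow> a i \<in> A" "(\<Oplus>i\<in>{..<p}. a i \<otimes> y [^] i) = \<zero>" for a n
    using that
  proof (induction n arbitrary: a)
    case 0
    then show ?case using A'(2) Vc by force
  next
    case (Suc n)
    have "\<forall>i\<in>{..<p}. \<exists>b. b \<in> A \<and> a i = s [^] p \<otimes> b"
      using sat[OF Suc.prems(1) step[OF Suc.prems]] by blast
    then obtain b where b: "\<And>i. i < p \<Longrightarrow> b i \<in> A" "\<And>i. i < p \<Longrightarrow> a i = s [^] p \<otimes> b i"
      using bchoice[of "{..<p}"] by (metis lessThan_iff)
    have bc: "b i \<in> carrier R" if "i < p" for i using b(1)[OF that] A'(2) Vc by blast
    have "s [^] p \<otimes> (\<Oplus>i\<in>{..<p}. b i \<otimes> y [^] i) = (\<Oplus>i\<in>{..<p}. s [^] p \<otimes> (b i \<otimes> y [^] i))"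
      using bc yc sc by (intro finsum_rdistr) auto
    also have "\<dots> = (\<Oplus>i\<in>{..<p}. a i \<otimes> y [^] i)"
      using bc yc sc b(2) by (intro finsum_cong') (auto simp: m_assoc)
    finally have "s [^] p \<otimes> (\<Oplus>i\<in>{..<p}. b i \<otimes> y [^] i) = \<zero>" using Suc.prems(2) by simp
    moreover have "s [^] p \<noteq> \<zero>" using nonzero_pow_nonzero[OF sc s(2)] .
    ultimately have "(\<Oplus>i\<in>{..<p}. b i \<otimes> y [^] i) = \<zero>"
      using bc yc sc integral[of "s [^] p"] by (auto intro!: finsum_closed)
    from Suc.IH[OF b(1) this] have IH: "\<forall>i<p. \<exists>v\<in>V. b i = s [^] n \<otimes> v" by simp
    obtain q where q: "p = Suc q" using p_pos by (cases p) auto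
    show ?case
    proof (intro allI impI)
      fix i assume i: "i < p"
      then obtain v where v: "v \<in> V" "b i = s [^] n \<otimes> v" using IH by blast
      have "a i = s [^] p \<otimes> (s [^] n \<otimes> v)" using b(2)[OF i] v by simp
      also have "\<dots> = s [^] Suc n \<otimes> (s [^] q \<otimes> v)"
        using sc v Vc q by (simp add: m_ac)
      finally have "a i = s [^] Suc n \<otimes> (s [^] q \<otimes> v)" .
      moreover have "s [^] q \<otimes> v \<in> V" using v V_pow[OF s(1)] V_ops by auto
      ultimately show "\<exists>v\<in>V. a i = s [^] Suc n \<otimes> v" by blast
    qed
  qed
  show ?thesis unfolding powers_independent_def
  proof (intro allI impI, elim conjE)
    fix a i assume a: "\<forall>i<p. a i \<in> A" "(\<Oplus>i\<in>{..<p}. a i \<otimes> y [^] i) = \<zero>" and i: "i < p"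
    show "a i = \<zero>" by (rule separated) (use a i div[of a] A'(2) in auto)
  qed
qed

text \<open>By independence of the residues, an element of \<open>A[y]\<close> lies in the maximal ideal only if its coefficients do.
  Then \<open>s\<^sup>p\<close> can be divided out of each of them.\<close>

lemma unramified_adjoin:
  assumes A: "unramified A" and y: "y \<in> V" "\<And>a. a \<in> A \<Longrightarrow> y \<ominus> a \<notin> m"
  shows "powers_independent A y" "unramified (adjoin A y)"
proof -
  have A': "subring A R" "pth_powers V \<subseteq> A" "A \<subseteq> V" and sat: "\<And>x. x \<in> A \<Longrightarrow> x \<in> m \<Longrightarrow> \<exists>b\<in>A. x = s [^] p \<otimes> b"
    using A by (auto simp: unramified_def)
  have yc: "y \<in> carrier R" using y Vc by simp
  have yp: "y [^] p \<in> A" using y(1) A'(2) by (auto simp: pth_powers_def)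
  show "powers_independent A y"
    by (rule independent_by_descent[OF A y(1)]) (rule residues_independent[OF A' y], auto simp: m_zero)
  show "unramified (adjoin A y)" unfolding unramified_def
  proof (intro conjI ballI)
    show "subring (adjoin A y) R" using adjoin_subring[OF A'(1) yc yp] .
    show "pth_powers V \<subseteq> adjoin A y" using adjoin_superset[OF A'(1) yc yp] A'(2) by blast
    show "adjoin A y \<subseteq> V" using adjoin_subset[OF A'(1) yc yp V A'(3) y(1)] .
    fix x assume x: "x \<in> adjoin A y \<inter> m"
    then obtain a where a: "\<And>i. i < p \<Longrightarrow> a i \<in> A" "x = (\<Oplus>i\<in>{..<p}. a i \<otimes> y [^] i)"
      by (auto elim!: adjoinE)
    have "a i \<in> m" if "i < p" for i
      using residues_independent[OF A' y, of a i] a x that by auto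
    then have "\<forall>i\<in>{..<p}. \<exists>b. b \<in> A \<and> a i = s [^] p \<otimes> b"
      using sat a(1) by blast
    then obtain b where b: "\<And>i. i < p \<Longrightarrow> b i \<in> A" "\<And>i. i < p \<Longrightarrow> a i = s [^] p \<otimes> b i"
      using bchoice[of "{..<p}"] by (metis lessThan_iff)
    have bc: "b i \<in> carrier R" if "i < p" for i using b(1)[OF that] A'(3) Vc by blast
    have "x = (\<Oplus>i\<in>{..<p}. s [^] p \<otimes> (b i \<otimes> y [^] i))"
      unfolding a(2) using bc yc sc b(2) by (intro finsum_cong') (auto simp: m_assoc)
    also have "\<dots> = s [^] p \<otimes> (\<Oplus>i\<in>{..<p}. b i \<otimes> y [^] i)"
      using bc yc sc by (intro finsum_rdistr[symmetric]) auto
    finally show "\<exists>b\<in>adjoin A y. x = s [^] p \<otimes> b" using b(1) unfolding adjoin_def by blast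
  qed
qed

text \<open>The orders of elements of \<open>A\<close> are multiples of \<open>p\<close>, so the orders of the nonzero terms \<open>a\<^sub>i s\<^sup>i\<close> of a
  relation are pairwise incongruent modulo \<open>p\<close>.\<close>

lemma uniformizer_independent:
  assumes A: "unramified A" shows "powers_independent A s"
proof (rule independent_by_descent[OF A s(1)])
  fix a j assume a: "\<And>i. i < p \<Longrightarrow> a i \<in> A" and sum: "(\<Oplus>i\<in>{..<p}. a i \<otimes> s [^] i) = \<zero>" and "j < p"
  have A': "subring A R" "A \<subseteq> V" and sat: "\<And>x. x \<in> A \<Longrightarrow> x \<in> m \<Longrightarrow> \<exists>b\<in>A. x = s [^] p \<otimes> b"
    using A by (auto simp: unramified_def)
  have av: "a i \<in> V" if "i < p" for i using a[OF that] A'(2) by blast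
  have t: "a i \<otimes> s [^] i \<in> V" if "i < p" for i using av that s V_pow V_ops by simp
  show "a j \<in> m" using \<open>j < p\<close>
  proof (induction j rule: less_induct)
    case (less j)
    have div: "\<exists>v. v \<in> V \<and> a i \<otimes> s [^] i = s [^] Suc j \<otimes> v" if i: "i < p" "i \<noteq> j" for i
    proof (cases "i < j")
      case True
      then obtain b where b: "b \<in> A" "a i = s [^] p \<otimes> b" using less.IH[OF True i(1)] sat[OF a[OF i(1)]] by blast
      obtain q where q: "p = Suc j + q" using less.prems less_iff_Suc_add by auto
      have sp: "s [^] p = s [^] Suc j \<otimes> s [^] q" unfolding q by (rule nat_pow_mult[OF sc, symmetric])
      have bc: "b \<in> carrier R" using b(1) A'(2) Vc by blast
      have "a i \<otimes> s [^] i = s [^] Suc j \<otimes> (s [^] q \<otimes> b \<otimes> s [^] i)"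
        unfolding b(2) sp using bc sc by (simp add: m_assoc del: nat_pow_Suc Group.nat_pow_Suc)
      moreover have "s [^] q \<otimes> b \<otimes> s [^] i \<in> V" using b(1) A'(2) V_pow[OF s(1)] V_ops by auto
      ultimately show ?thesis by blast
    next
      case False
      then obtain q where q: "i = Suc j + q" using i(2) less_iff_Suc_add[of j i] by auto
      have si: "s [^] i = s [^] Suc j \<otimes> s [^] q" unfolding q by (rule nat_pow_mult[OF sc, symmetric])
      have "a i \<otimes> s [^] i = s [^] Suc j \<otimes> (s [^] q \<otimes> a i)"
        unfolding si using Vc[OF av[OF i(1)]] sc by (simp add: m_ac del: nat_pow_Suc Group.nat_pow_Suc)
      moreover have "s [^] q \<otimes> a i \<in> V" using av[OF i(1)] V_pow[OF s(1)] V_ops by auto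
      ultimately show ?thesis by blast
    qed
    then have "\<forall>i\<in>{..<p} - {j}. \<exists>v. v \<in> V \<and> a i \<otimes> s [^] i = s [^] Suc j \<otimes> v" by blast
    from bchoice[OF this] obtain v where v: "\<And>i. i < p \<Longrightarrow> i \<noteq> j \<Longrightarrow> v i \<in> V"
      "\<And>i. i < p \<Longrightarrow> i \<noteq> j \<Longrightarrow> a i \<otimes> s [^] i = s [^] Suc j \<otimes> v i" by (auto simp del: nat_pow_Suc Group.nat_pow_Suc)
    have Ins: "{..<p} = insert j ({..<p} - {j})" using less.prems by auto
    have "(\<Oplus>i\<in>{..<p}. a i \<otimes> s [^] i) = a j \<otimes> s [^] j \<oplus> (\<Oplus>i\<in>{..<p} - {j}. a i \<otimes> s [^] i)"
      by (subst Ins, subst finsum_insert) (use t Vc less.prems in auto)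
    also have "(\<Oplus>i\<in>{..<p} - {j}. a i \<otimes> s [^] i) = (\<Oplus>i\<in>{..<p} - {j}. s [^] Suc j \<otimes> v i)"
      using v sc Vc by (intro finsum_cong') (auto simp del: nat_pow_Suc Group.nat_pow_Suc)
    also have "\<dots> = s [^] Suc j \<otimes> (\<Oplus>i\<in>{..<p} - {j}. v i)"
      using v(1) Vc sc by (intro finsum_rdistr[symmetric]) auto
    finally have e: "\<zero> = a j \<otimes> s [^] j \<oplus> s [^] Suc j \<otimes> (\<Oplus>i\<in>{..<p} - {j}. v i)" using sum by simp
    define w where "w = (\<Oplus>i\<in>{..<p} - {j}. v i)"
    have "finite S \<Longrightarrow> S \<subseteq> {..<p} - {j} \<Longrightarrow> (\<Oplus>i\<in>S. v i) \<in> V" for S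
      by (induction S rule: finite_induct) (use v(1) Vc V_ops in \<open>auto simp: subset_iff Pi_def finsum_insert\<close>)
    then have w: "w \<in> V" by (simp add: w_def)
    have "s [^] j \<otimes> (a j \<oplus> s \<otimes> w) = \<zero>"
      using e w av[OF less.prems] Vc sc by (simp add: w_def[symmetric] r_distr m_ac)
    then have "a j \<oplus> s \<otimes> w = \<zero>"
      using nonzero_pow_nonzero[OF sc s(2), of j] integral[of "s [^] j"] w av[OF less.prems] Vc sc by auto
    then have "a j = \<ominus> (s \<otimes> w)" using w av[OF less.prems] Vc sc by (intro minus_equality[symmetric]) auto
    then show ?case using w by (auto intro!: m_neg mI)
  qed
qed

end

section \<open>Finiteness over the \<open>p\<close>-th powers\<close>

context char_p_dvr
begin

text \<open>The submodules of \<open>V\<close> over its subring of \<open>p\<close>-th powers. Closure under negation follows, as \<open>-1\<close> is a \<open>p\<close>-th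
  power.\<close>

definition pth_submodule :: "'a set \<Rightarrow> bool"
  where "pth_submodule W \<longleftrightarrow> W \<subseteq> V \<and> \<zero> \<in> W \<and> (\<forall>x\<in>W. \<forall>y\<in>W. x \<oplus> y \<in> W) \<and>
    (\<forall>f\<in>pth_powers V. \<forall>x\<in>W. f \<otimes> x \<in> W)"

lemma subring_pth_submodule:
  assumes "subring A R" "pth_powers V \<subseteq> A" "A \<subseteq> V" shows "pth_submodule A"
  using assms subringE(2,6,7)[OF assms(1)] by (auto simp: pth_submodule_def)

text \<open>Speaking of the submodules that contain \<open>S\<close> avoids linear combinations over the \<open>p\<close>-th powers.\<close>

definition finite_over_pth_powers :: "'a set \<Rightarrow> bool"
  where "finite_over_pth_powers A \<longleftrightarrow> (\<exists>S. finite S \<and> S \<subseteq> V \<and>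
    (\<forall>W. pth_submodule W \<and> S \<subseteq> W \<longrightarrow> A \<subseteq> W))"

lemma finite_adjoin:
  assumes A: "subring A R" "pth_powers V \<subseteq> A" "A \<subseteq> V" and y: "y \<in> V"
    and fin: "finite_over_pth_powers A"
  shows "finite_over_pth_powers (adjoin A y)"
proof -
  obtain S where S: "finite S" "S \<subseteq> V" "\<And>W. pth_submodule W \<Longrightarrow> S \<subseteq> W \<Longrightarrow> A \<subseteq> W"
    using fin by (auto simp: finite_over_pth_powers_def)
  let ?S = "(\<lambda>(x, i). x \<otimes> y [^] (i::nat)) ` (S \<times> {..<p})"
  have yc: "y \<in> carrier R" using y Vc by simp
  have yp: "y [^] p \<in> A" using y A(2) by (auto simp: pth_powers_def)
  have "adjoin A y \<subseteq> W" if W: "pth_submodule W" "?S \<subseteq> W" for W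
  proof
    have mon: "a \<otimes> y [^] i \<in> W" if a: "a \<in> A" and i: "i < p" for a i
    proof -
      let ?T = "{x \<in> V. x \<otimes> y [^] i \<in> W}"
      have fc: "f \<in> carrier R" if "f \<in> pth_powers V" for f using that pth_powers_V Vc by blast
      have "f \<otimes> x \<otimes> y [^] i \<in> W" if "f \<in> pth_powers V" "x \<in> V" "x \<otimes> y [^] i \<in> W" for f x
        using W(1) that fc Vc yc by (simp add: pth_submodule_def m_assoc)
      moreover have "(x \<oplus> z) \<otimes> y [^] i \<in> W"
        if "x \<in> V" "z \<in> V" "x \<otimes> y [^] i \<in> W" "z \<otimes> y [^] i \<in> W" for x z
        using W(1) that Vc yc by (simp add: pth_submodule_def l_distr)
      moreover have "\<zero> \<otimes> y [^] i \<in> W" using W(1) yc by (simp add: pth_submodule_def)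
      ultimately have "pth_submodule ?T"
        using V_ops pth_powers_V by (auto simp: pth_submodule_def)
      moreover have "S \<subseteq> ?T" using S(2) W(2) i by auto
      ultimately show ?thesis using S(3) a by blast
    qed
    fix x assume "x \<in> adjoin A y"
    then show "x \<in> W"
    proof (induction rule: adjoin_induct[OF A(1) yc yp, consumes 1, case_names zero add monomial])
      case zero then show ?case using W(1) by (simp add: pth_submodule_def)
    next
      case (add u v) then show ?case using W(1) by (simp add: pth_submodule_def)
    next
      case (monomial a i) then show ?case by (rule mon)
    qed
  qed
  moreover have "?S \<subseteq> V" using S(2) V_pow[OF y] V_ops by auto
  moreover have "finite ?S" using S(1) by simp
  ultimately show ?thesis unfolding finite_over_pth_powers_def by blast
qed

lemma finite_if_generated:
  assumes G: "finite G" "G \<subseteq> V"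
    and gen: "\<And>B. subring B R \<Longrightarrow> pth_powers V \<subseteq> B \<Longrightarrow> G \<subseteq> B \<Longrightarrow> V \<subseteq> B"
  shows "finite_over_pth_powers V"
proof -
  have "\<exists>A. subring A R \<and> pth_powers V \<subseteq> A \<and> A \<subseteq> V \<and> G \<subseteq> A \<and> finite_over_pth_powers A"
    using G
  proof (induction G rule: finite_induct)
    case empty
    have "finite_over_pth_powers (pth_powers V)" unfolding finite_over_pth_powers_def
    proof (intro exI[of _ "{\<one>}"] conjI allI impI subsetI)
      fix W x assume W: "pth_submodule W \<and> {\<one>} \<subseteq> W" and x: "x \<in> pth_powers V"
      then have "x \<otimes> \<one> \<in> W" by (auto simp: pth_submodule_def)
      then show "x \<in> W" using x pth_powers_V Vc by (metis r_one subsetD)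
    qed (use V_ops in auto)
    then show ?case using pth_powers_subring[OF V] pth_powers_V by blast
  next
    case (insert g G)
    then obtain A where A: "subring A R" "pth_powers V \<subseteq> A" "A \<subseteq> V" "G \<subseteq> A" "finite_over_pth_powers A"
      by auto
    have g: "g \<in> V" "g \<in> carrier R" using insert.prems Vc by auto
    have gp: "g [^] p \<in> A" using g A(2) by (auto simp: pth_powers_def)
    show ?case
      using adjoin_subring[OF A(1) g(2) gp] adjoin_superset[OF A(1) g(2) gp] A
        adjoin_subset[OF A(1) g(2) gp V A(3) g(1)] adjoin_generator[OF A(1) g(2) gp]
        finite_adjoin[OF A(1-3) g(1) A(5)] by (intro exI[of _ "adjoin A g"]) auto
  qed
  then show ?thesis using gen by (metis subset_antisym)
qed

text \<open>Nakayama's lemma for \<open>V / B\<close> as a module over \<open>V\<^sup>p\<close>: the generators are removed one at a time,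
  since \<open>1 - s\<^sup>p g\<^sup>p = (1 - s g)\<^sup>p\<close> is invertible in \<open>V\<^sup>p\<close>.\<close>

lemma nakayama:
  assumes "finite S" "S \<subseteq> V" and B: "pth_submodule B"
    and span: "\<And>W. pth_submodule W \<Longrightarrow> B \<subseteq> W \<Longrightarrow> S \<subseteq> W \<Longrightarrow> V \<subseteq> W"
    and dense: "\<And>x. x \<in> V \<Longrightarrow> \<exists>b\<in>B. \<exists>v\<in>V. x = b \<oplus> s [^] p \<otimes> v"
  shows "V \<subseteq> B"
  using assms(1,2) span
proof (induction S rule: finite_induct)
  case empty
  then show ?case using B by auto
next
  case (insert z S)
  let ?F = "pth_powers V"
  have z: "z \<in> V" using insert.prems by simp
  have Fring: "subring ?F R" using pth_powers_subring[OF V] .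
  note F_ops = subringE(2,3,5,6,7)[OF Fring]
  have Fc: "f \<in> carrier R" "f \<in> V" if "f \<in> ?F" for f using that pth_powers_V Vc by auto
  have "V \<subseteq> W" if W: "pth_submodule W" "B \<subseteq> W" "S \<subseteq> W" for W
  proof -
    have WV: "W \<subseteq> V" and W0: "\<zero> \<in> W" and Wa: "\<And>x y. x \<in> W \<Longrightarrow> y \<in> W \<Longrightarrow> x \<oplus> y \<in> W"
      and Wm: "\<And>f x. f \<in> ?F \<Longrightarrow> x \<in> W \<Longrightarrow> f \<otimes> x \<in> W"
      using W(1) by (auto simp: pth_submodule_def)
    have Wc: "x \<in> carrier R" if "x \<in> W" for x using that WV Vc by blast
    define W' where "W' = {w \<oplus> f \<otimes> z | w f. w \<in> W \<and> f \<in> ?F}"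
    have W'I: "w \<oplus> f \<otimes> z \<in> W'" if "w \<in> W" "f \<in> ?F" for w f using that by (auto simp: W'_def)
    have zc: "z \<in> carrier R" using z Vc by simp
    have WW': "W \<subseteq> W'" using W'I[OF _ F_ops(1)] zc Wc by auto
    have "pth_submodule W'" unfolding pth_submodule_def
    proof (intro conjI ballI)
      show "W' \<subseteq> V" using WV z V_ops Fc by (auto simp: W'_def)
      show "\<zero> \<in> W'" using WW' W0 by blast
    next
      fix x y assume "x \<in> W'" "y \<in> W'"
      then obtain w f w' f' where x: "w \<in> W" "f \<in> ?F" "x = w \<oplus> f \<otimes> z"
        and y: "w' \<in> W" "f' \<in> ?F" "y = w' \<oplus> f' \<otimes> z" by (auto simp: W'_def)
      have "x \<oplus> y = (w \<oplus> w') \<oplus> (f \<oplus> f') \<otimes> z"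
        using x y Wc Fc zc by (simp add: l_distr a_ac)
      then show "x \<oplus> y \<in> W'" using W'I Wa F_ops(5) x y by simp
    next
      fix g x assume g: "g \<in> ?F" and "x \<in> W'"
      then obtain w f where x: "w \<in> W" "f \<in> ?F" "x = w \<oplus> f \<otimes> z" by (auto simp: W'_def)
      have "g \<otimes> x = g \<otimes> w \<oplus> (g \<otimes> f) \<otimes> z"
        using x g Wc Fc zc by (simp add: r_distr m_assoc)
      then show "g \<otimes> x \<in> W'" using W'I Wm F_ops(4) x g by simp
    qed
    moreover have "z \<in> W'" using W'I[OF W0 F_ops(2)] zc by simp
    ultimately have VW': "V \<subseteq> W'" using insert.prems(2)[of W'] W WW' by auto
    obtain b v where b: "b \<in> B" "v \<in> V" "z = b \<oplus> s [^] p \<otimes> v" using dense[OF z] by blast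
    obtain w f where w: "w \<in> W" "f \<in> ?F" "v = w \<oplus> f \<otimes> z" using VW' b(2) by (auto simp: W'_def)
    obtain g where g: "g \<in> V" "f = g [^] p" using w(2) by (auto simp: pth_powers_def)
    have gc: "g \<in> carrier R" and bc: "b \<in> carrier R" and wc: "w \<in> carrier R"
      using g(1) Vc b(1) W(2) Wc w(1) by auto
    let ?e = "\<one> \<ominus> s \<otimes> g"
    have eV: "?e \<in> V" using V_ops s g by (simp add: a_minus_def)
    have "?e \<notin> m"
    proof
      assume "?e \<in> m"
      then have "?e \<oplus> s \<otimes> g \<in> m" using m_add mI g by simp
      moreover have "?e \<oplus> s \<otimes> g = \<one>" using sc gc by (simp add: a_minus_def a_assoc l_neg)
      ultimately show False using one_notin_m by simp
    qed
    then obtain u where u: "u \<in> V" "?e \<otimes> u = \<one>" using unit_or_m eV by blast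
    have uc: "u \<in> carrier R" and ec: "?e \<in> carrier R" using u eV Vc by auto
    have ep: "?e [^] p = \<one> \<oplus> \<ominus> (s [^] p \<otimes> f)"
      unfolding a_minus_def using sc gc g(2) frobenius_add[of \<one> "\<ominus> (s \<otimes> g)"] frobenius_neg[of "s \<otimes> g"]
      by (simp add: nat_pow_distrib)
    define c where "c = s [^] p"
    have cc: "c \<in> carrier R" and fc: "f \<in> carrier R" using sc Fc w(2) by (auto simp: c_def)
    have "z = b \<oplus> c \<otimes> (w \<oplus> f \<otimes> z)" using b(3) w(3) by (simp add: c_def)
    then have "z \<oplus> \<ominus> (c \<otimes> f \<otimes> z) = b \<oplus> c \<otimes> (w \<oplus> f \<otimes> z) \<oplus> \<ominus> (c \<otimes> f \<otimes> z)" by simp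
    also have "\<dots> = b \<oplus> c \<otimes> w"
      using bc cc wc fc zc by (simp add: r_distr m_assoc a_assoc r_neg)
    finally have "?e [^] p \<otimes> z = b \<oplus> c \<otimes> w"
      unfolding ep c_def[symmetric] using cc fc zc by (simp add: l_distr l_minus)
    moreover have "c \<in> ?F" using s by (auto simp: pth_powers_def c_def)
    ultimately have "?e [^] p \<otimes> z \<in> W" using b(1) W(2) w(1) Wa Wm by auto
    then have "u [^] p \<otimes> (?e [^] p \<otimes> z) \<in> W" using Wm u(1) by (auto simp: pth_powers_def)
    moreover have "u [^] p \<otimes> (?e [^] p \<otimes> z) = (?e \<otimes> u) [^] p \<otimes> z"
      using uc ec zc by (simp add: nat_pow_distrib m_ac)
    ultimately have "z \<in> W" using u(2) zc by simp
    then have "W' \<subseteq> W" using Wa Wm by (auto simp: W'_def)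
    then show "V \<subseteq> W" using VW' by blast
  qed
  then show ?case using insert.IH insert.prems(1) by blast
qed

text \<open>The \<open>s\<close>-adic expansion of \<open>x\<close>, with digits in \<open>A\<close>.\<close>

lemma dense_adjoin_uniformizer:
  assumes A: "subring A R" "pth_powers V \<subseteq> A" "A \<subseteq> V"
    and res: "\<And>x. x \<in> V \<Longrightarrow> \<exists>a\<in>A. x \<ominus> a \<in> m" and x: "x \<in> V"
  shows "\<exists>b\<in>adjoin A s. \<exists>v\<in>V. x = b \<oplus> s [^] (n::nat) \<otimes> v"
proof (induction n)
  have sp: "s [^] p \<in> A" using s A(2) by (auto simp: pth_powers_def)
  case 0
  have "\<zero> \<in> adjoin A s" using subringE(2)[OF adjoin_subring[OF A(1) sc sp]] .
  then show ?case using x Vc by (intro bexI[of _ \<zero>] bexI[of _ x]) auto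
next
  have sp: "s [^] p \<in> A" using s A(2) by (auto simp: pth_powers_def)
  case (Suc n)
  then obtain b v where b: "b \<in> adjoin A s" "v \<in> V" "x = b \<oplus> s [^] n \<otimes> v" by blast
  obtain a where a: "a \<in> A" "v \<ominus> a \<in> m" using res b(2) by blast
  obtain w where w: "w \<in> V" "v \<ominus> a = s \<otimes> w" using a(2) by (auto elim: mE)
  have c: "a \<in> carrier R" "b \<in> carrier R" "w \<in> carrier R" "v \<in> carrier R" "s [^] n \<in> carrier R"
    using a(1) A(3) Vc b w sc adjoin_carrier[OF A(1) sc sp] by auto
  have "v = a \<oplus> (v \<ominus> a)" using c a_comm[of v "\<ominus> a"] by (simp add: a_minus_def r_neg2)
  then have v: "v = a \<oplus> s \<otimes> w" using w(2) by simp
  have "x = (b \<oplus> a \<otimes> s [^] n) \<oplus> s [^] Suc n \<otimes> w"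
    unfolding b(3) v using c sc by (simp add: r_distr m_ac a_ac)
  then show ?case
    using adjoin_add[OF A(1) sc sp b(1) adjoin_monomial[OF A(1) sc sp a(1), of n]] w(1) by blast
qed

end

locale char_p_dvr_derivation = char_p_dvr R p V s + D: char_p_derivation R p V M d
  for R :: "('a, 'r) ring_scheme" (structure) and p V s and M :: "('a, 'm, 'n) module_scheme" and d
begin

text \<open>The elements of \<open>G\<close> are adjoined in turn, except for those whose residue class is already represented.\<close>

lemma residue_field_exhausted:
  assumes G: "finite G" "G \<subseteq> V"
  shows "\<exists>A. unramified A \<and> (\<exists>N Y D. D.dual_basis A N Y D) \<and> (\<forall>g\<in>G. \<exists>a\<in>A. g \<ominus> a \<in> m)"
  using G
proof (induction G rule: finite_induct)
  case empty
  then show ?case using unramified_pth_powers D.dual_basis_pth_powers by blast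
next
  case (insert g G)
  then obtain A N Y D where A: "unramified A" "D.dual_basis A N Y D" "\<forall>g\<in>G. \<exists>a\<in>A. g \<ominus> a \<in> m"
    by auto
  have A': "subring A R" "pth_powers V \<subseteq> A" "A \<subseteq> V" using A(1) by (auto simp: unramified_def)
  have g: "g \<in> V" "g \<in> carrier R" using insert.prems Vc by auto
  show ?case
  proof (cases "\<exists>a\<in>A. g \<ominus> a \<in> m")
    case True
    then show ?thesis using A by blast
  next
    case False
    have gp: "g [^] p \<in> A" using g A'(2) by (auto simp: pth_powers_def)
    have ind: "powers_independent A g" "unramified (adjoin A g)"
      using unramified_adjoin[OF A(1) g(1)] False by auto
    have "\<exists>Y' D'. D.dual_basis (adjoin A g) (Suc N) Y' D'"
      using D.dual_basis_adjoin[OF A' g(1) ind(1) A(2)] .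
    moreover have "A \<subseteq> adjoin A g" "g \<in> adjoin A g"
      using adjoin_superset[OF A'(1) g(2) gp] adjoin_generator[OF A'(1) g(2) gp] by auto
    moreover have "g \<ominus> g \<in> m" using g m_zero by (simp add: a_minus_def r_neg)
    ultimately show ?thesis using ind(2) A(3) by (intro exI[of _ "adjoin A g"]) blast
  qed
qed

text \<open>After enough elements with new residue classes have been adjoined to \<open>V\<^sup>p\<close>, the resulting ring \<open>A\<close> has the
  residue field of \<open>V\<close>: the elements of \<open>V\<close> that are congruent to elements of \<open>A\<close> form a ring \<open>B\<close> that
  contains the generators. So \<open>A[s]\<close> is dense in \<open>V\<close>, hence equal to \<open>V\<close> by Nakayama's lemma.\<close>

theorem dual_basis_exists:
  assumes G: "finite G" "G \<subseteq> V"
    and gen: "\<And>B. subring B R \<Longrightarrow> pth_powers V \<subseteq> B \<Longrightarrow> G \<subseteq> B \<Longrightarrow> V \<subseteq> B"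
  shows "\<exists>N Y D. D.dual_basis V N Y D"
proof -
  obtain A N Y D where A: "unramified A" "D.dual_basis A N Y D" "\<forall>g\<in>G. \<exists>a\<in>A. g \<ominus> a \<in> m"
    using residue_field_exhausted[OF G] by blast
  have A': "subring A R" "pth_powers V \<subseteq> A" "A \<subseteq> V" using A(1) by (auto simp: unramified_def)
  note A_ops = subringE(2,3,5,6,7)[OF A'(1)]
  have Ac: "a \<in> carrier R" "a \<in> V" if "a \<in> A" for a using that A'(3) Vc by auto
  define B where "B = {x \<in> V. \<exists>a\<in>A. x \<ominus> a \<in> m}"
  have BI: "x \<in> B" if "x \<in> V" "a \<in> A" "x \<ominus> a \<in> m" for x a using that by (auto simp: B_def)
  have AB: "A \<subseteq> B"
  proof
    fix a assume a: "a \<in> A"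
    then show "a \<in> B" using BI[OF _ a] Ac m_zero by (simp add: a_minus_def r_neg)
  qed
  have "subring B R"
  proof (rule subringI)
    show "B \<subseteq> carrier R" using Vc by (auto simp: B_def)
    show "\<one> \<in> B" using AB A_ops by blast
    fix x assume "x \<in> B"
    then obtain a where x: "x \<in> V" "a \<in> A" "x \<ominus> a \<in> m" by (auto simp: B_def)
    have "\<ominus> x \<ominus> \<ominus> a = \<ominus> (x \<ominus> a)" using x Vc Ac by (simp add: a_minus_def minus_add a_comm)
    then show "\<ominus> x \<in> B" using BI[of "\<ominus> x" "\<ominus> a"] x m_neg V_ops A_ops by simp
  next
    fix x y assume "x \<in> B" "y \<in> B"
    then obtain a b where x: "x \<in> V" "a \<in> A" "x \<ominus> a \<in> m" and y: "y \<in> V" "b \<in> A" "y \<ominus> b \<in> m"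
      by (auto simp: B_def)
    have c: "x \<in> carrier R" "y \<in> carrier R" "a \<in> carrier R" "b \<in> carrier R" using x y Vc Ac by auto
    have "(x \<oplus> y) \<ominus> (a \<oplus> b) = (x \<ominus> a) \<oplus> (y \<ominus> b)"
      using c by (simp add: a_minus_def minus_add a_ac)
    then show "x \<oplus> y \<in> B" using BI[of "x \<oplus> y" "a \<oplus> b"] x y m_add V_ops A_ops by simp
    have "(x \<otimes> y) \<ominus> (a \<otimes> b) = x \<otimes> (y \<ominus> b) \<oplus> b \<otimes> (x \<ominus> a)"
      using c by (simp add: a_minus_def r_distr r_minus m_comm a_assoc[symmetric])
                 (simp add: a_assoc l_neg)
    then show "x \<otimes> y \<in> B" using BI[of "x \<otimes> y" "a \<otimes> b"] x y m_add m_mult Ac V_ops A_ops by simp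
  qed
  moreover have "pth_powers V \<subseteq> B" using A' AB by blast
  moreover have "G \<subseteq> B" using A(3) G by (auto simp: B_def)
  ultimately have "V \<subseteq> B" by (rule gen)
  then have res: "\<And>x. x \<in> V \<Longrightarrow> \<exists>a\<in>A. x \<ominus> a \<in> m" by (auto simp: B_def)
  have sp: "s [^] p \<in> A" using s A'(2) by (auto simp: pth_powers_def)
  let ?A = "adjoin A s"
  have As: "subring ?A R" "pth_powers V \<subseteq> ?A" "?A \<subseteq> V"
    using adjoin_subring[OF A'(1) sc sp] adjoin_superset[OF A'(1) sc sp] A'(2)
      adjoin_subset[OF A'(1) sc sp V A'(3) s(1)] by auto
  obtain S where S: "finite S" "S \<subseteq> V" "\<And>W. pth_submodule W \<Longrightarrow> S \<subseteq> W \<Longrightarrow> V \<subseteq> W"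
    using finite_if_generated[OF G gen] by (auto simp: finite_over_pth_powers_def)
  have "V \<subseteq> ?A"
    by (rule nakayama[OF S(1,2) subring_pth_submodule[OF As]])
       (use S(3) dense_adjoin_uniformizer[OF A' res] in auto)
  then have "?A = V" using As(3) by blast
  then show ?thesis
    using D.dual_basis_adjoin[OF A' s(1) uniformizer_independent[OF A(1)] A(2)] by metis
qed

end

section \<open>Kaehler differentials\<close>

lemma (in cring) free_module_simps [simp]:
  "\<zero>\<^bsub>free_module R B\<^esub> = (\<lambda>_. \<zero>)"
  "f \<oplus>\<^bsub>free_module R B\<^esub> g = (\<lambda>b. f b \<oplus> g b)"
  "a \<odot>\<^bsub>free_module R B\<^esub> f = (\<lambda>b. a \<otimes> f b)"
  by (simp_all add: free_module_def)

lemma (in cring) free_module_carrier: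
  "f \<in> carrier (free_module R B) \<longleftrightarrow>
     (\<forall>b. f b \<in> carrier R) \<and> finite {b. f b \<noteq> \<zero>} \<and> {b. f b \<noteq> \<zero>} \<subseteq> B"
  by (simp add: free_module_def)

lemma (in cring) free_module_is_module: "module R (free_module R B)"
proof (rule moduleI)
  let ?M = "free_module R B"
  have smult: "(\<lambda>b. a \<otimes> f b) \<in> carrier ?M" if "a \<in> carrier R" "f \<in> carrier ?M" for a f
  proof -
    have "{b. a \<otimes> f b \<noteq> \<zero>} \<subseteq> {b. f b \<noteq> \<zero>}" using that(1) by auto
    then show ?thesis using that by (auto simp: free_module_carrier intro: finite_subset)
  qed
  have add: "(\<lambda>b. f b \<oplus> g b) \<in> carrier ?M" if "f \<in> carrier ?M" "g \<in> carrier ?M" for f g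
  proof -
    have "{b. f b \<oplus> g b \<noteq> \<zero>} \<subseteq> {b. f b \<noteq> \<zero>} \<union> {b. g b \<noteq> \<zero>}" by auto
    then show ?thesis using that unfolding free_module_carrier
      by (meson add.m_closed finite_UnI finite_subset le_sup_iff order_trans)
  qed
  show "abelian_group ?M"
  proof (rule abelian_groupI)
    fix f assume f: "f \<in> carrier ?M"
    have "(\<lambda>b. \<ominus> \<one> \<otimes> f b) \<in> carrier ?M" using smult f by simp
    moreover have "(\<lambda>b. \<ominus> \<one> \<otimes> f b \<oplus> f b) = (\<lambda>b. \<zero>)"
      using f by (auto simp: free_module_carrier l_minus l_neg)
    ultimately show "\<exists>g\<in>carrier ?M. g \<oplus>\<^bsub>?M\<^esub> f = \<zero>\<^bsub>?M\<^esub>" by auto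
  qed (auto simp: add, auto simp: free_module_carrier a_ac)
  show "a \<odot>\<^bsub>?M\<^esub> f \<in> carrier ?M" if "a \<in> carrier R" "f \<in> carrier ?M" for a f
    using smult that by simp
qed (use is_cring in \<open>auto simp: free_module_carrier l_distr r_distr m_assoc\<close>)

lemma (in cring) free_gen_closed:
  "b \<in> B \<Longrightarrow> free_gen R b \<in> carrier (free_module R B)"
  by (auto simp: free_gen_def free_module_carrier)

text \<open>Restricts \<open>M\<close> to the record type for which quotients and spans are defined.\<close>

locale plain_module = module R M for R :: "('r, 'x) ring_scheme" (structure) and M :: "('r, 'e) module" (structure)

lemma (in plain_module) submodule_abelian_subgroup:
  assumes "submodule N R M" shows "abelian_subgroup N M"
  using assms by (intro abelian_subgroupI3 additive_subgroup.intro M.abelian_group_axioms)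
    (auto simp: submodule_def)

lemma (in plain_module) coset_eqI:
  assumes N: "submodule N R M" and "x \<in> carrier M" "y \<in> carrier M" "x \<ominus>\<^bsub>M\<^esub> y \<in> N"
  shows "N +>\<^bsub>M\<^esub> x = N +>\<^bsub>M\<^esub> y"
proof -
  interpret N: abelian_subgroup N M by (rule submodule_abelian_subgroup[OF N])
  have "x = (x \<ominus>\<^bsub>M\<^esub> y) \<oplus>\<^bsub>M\<^esub> y"
    using assms(2,3) by (simp add: a_minus_def M.a_assoc M.l_neg)
  then have "x \<in> N +>\<^bsub>M\<^esub> y"
    using M.a_rcosI[OF assms(4) N.a_subset assms(3)] by simp
  then show ?thesis using M.a_repr_independence assms(3) N.a_subgroup by metis
qed

lemma (in plain_module) quotient_module_smult:
  assumes N: "submodule N R M" and a: "a \<in> carrier R" and x: "x \<in> carrier M"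
  shows "a \<odot>\<^bsub>quotient_module M N\<^esub> (N +>\<^bsub>M\<^esub> x) = N +>\<^bsub>M\<^esub> (a \<odot>\<^bsub>M\<^esub> x)"
proof -
  interpret N: abelian_subgroup N M by (rule submodule_abelian_subgroup[OF N])
  have "N +>\<^bsub>M\<^esub> (a \<odot>\<^bsub>M\<^esub> y) = N +>\<^bsub>M\<^esub> (a \<odot>\<^bsub>M\<^esub> x)" if y: "y \<in> N +>\<^bsub>M\<^esub> x" for y
  proof -
    obtain h where h: "h \<in> N" "y = h \<oplus>\<^bsub>M\<^esub> x" using y by (auto simp: a_r_coset_def')
    have hc: "h \<in> carrier M" using h(1) N.a_subset by blast
    have "a \<odot>\<^bsub>M\<^esub> y \<ominus>\<^bsub>M\<^esub> a \<odot>\<^bsub>M\<^esub> x = a \<odot>\<^bsub>M\<^esub> h"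
      using h hc a x by (simp add: smult_r_distr a_minus_def M.a_assoc M.r_neg)
    then show ?thesis
      using h hc a x submodule.smult_closed[OF N a h(1)] by (intro coset_eqI[OF N]) auto
  qed
  then have "(\<Union>y\<in>N +>\<^bsub>M\<^esub> x. N +>\<^bsub>M\<^esub> (a \<odot>\<^bsub>M\<^esub> y)) = (\<Union>y\<in>N +>\<^bsub>M\<^esub> x. N +>\<^bsub>M\<^esub> (a \<odot>\<^bsub>M\<^esub> x))"
    by (intro SUP_cong refl)
  also have "\<dots> = N +>\<^bsub>M\<^esub> (a \<odot>\<^bsub>M\<^esub> x)"
    using N.a_rcos_self[OF x] by (intro SUP_const) blast
  finally show ?thesis by (simp add: quotient_module_def)
qed

lemma (in plain_module) quotient_module_add:
  assumes N: "submodule N R M" and "x \<in> carrier M" "y \<in> carrier M"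
  shows "(N +>\<^bsub>M\<^esub> x) \<oplus>\<^bsub>quotient_module M N\<^esub> (N +>\<^bsub>M\<^esub> y) = N +>\<^bsub>M\<^esub> (x \<oplus>\<^bsub>M\<^esub> y)"
proof -
  interpret N: abelian_subgroup N M by (rule submodule_abelian_subgroup[OF N])
  show ?thesis using N.a_rcos_sum assms by (simp add: quotient_module_def)
qed

lemma (in plain_module) quotient_module_carrier:
  "carrier (quotient_module M N) = {N +>\<^bsub>M\<^esub> x | x. x \<in> carrier M}"
  by (auto simp: quotient_module_def A_RCOSETS_def')

lemma (in plain_module) quotient_module_is_module:
  assumes N: "submodule N R M" shows "module R (quotient_module M N)"
proof -
  interpret N: abelian_subgroup N M by (rule submodule_abelian_subgroup[OF N])
  note [simp] = quotient_module_smult[OF N] quotient_module_add[OF N]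
  show ?thesis
  proof (rule moduleI)
    show "abelian_group (quotient_module M N)"
    proof (rule abelian_groupI)
      have zero: "\<zero>\<^bsub>quotient_module M N\<^esub> = N +>\<^bsub>M\<^esub> \<zero>\<^bsub>M\<^esub>"
        using M.a_coset_add_zero[OF N.a_subset] by (simp add: quotient_module_def)
      show "\<zero>\<^bsub>quotient_module M N\<^esub> \<in> carrier (quotient_module M N)"
        unfolding zero quotient_module_carrier by blast
      fix Z assume "Z \<in> carrier (quotient_module M N)"
      then obtain x where x: "x \<in> carrier M" "Z = N +>\<^bsub>M\<^esub> x" by (auto simp: quotient_module_carrier)
      then show "\<zero>\<^bsub>quotient_module M N\<^esub> \<oplus>\<^bsub>quotient_module M N\<^esub> Z = Z"
        unfolding zero by simp
      have "(N +>\<^bsub>M\<^esub> \<ominus>\<^bsub>M\<^esub> x) \<oplus>\<^bsub>quotient_module M N\<^esub> Z = \<zero>\<^bsub>quotient_module M N\<^esub>"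
        unfolding zero using x by (simp add: M.l_neg)
      then show "\<exists>Y\<in>carrier (quotient_module M N). Y \<oplus>\<^bsub>quotient_module M N\<^esub> Z = \<zero>\<^bsub>quotient_module M N\<^esub>"
        using x(1) by (intro bexI[of _ "N +>\<^bsub>M\<^esub> \<ominus>\<^bsub>M\<^esub> x"]) (auto simp: quotient_module_carrier)
      show "Z \<oplus>\<^bsub>quotient_module M N\<^esub> Y \<in> carrier (quotient_module M N)"
        "Z \<oplus>\<^bsub>quotient_module M N\<^esub> Y = Y \<oplus>\<^bsub>quotient_module M N\<^esub> Z"
        if Y: "Y \<in> carrier (quotient_module M N)" for Y
      proof -
        obtain y where y: "y \<in> carrier M" "Y = N +>\<^bsub>M\<^esub> y" using Y by (auto simp: quotient_module_carrier)
        show "Z \<oplus>\<^bsub>quotient_module M N\<^esub> Y \<in> carrier (quotient_module M N)"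
          using x y M.a_closed by (auto simp: quotient_module_carrier)
        show "Z \<oplus>\<^bsub>quotient_module M N\<^esub> Y = Y \<oplus>\<^bsub>quotient_module M N\<^esub> Z"
          using x y M.a_comm[of x y] by simp
      qed
      show "Z \<oplus>\<^bsub>quotient_module M N\<^esub> Y \<oplus>\<^bsub>quotient_module M N\<^esub> W
          = Z \<oplus>\<^bsub>quotient_module M N\<^esub> (Y \<oplus>\<^bsub>quotient_module M N\<^esub> W)"
        if "Y \<in> carrier (quotient_module M N)" "W \<in> carrier (quotient_module M N)" for Y W
      proof -
        obtain y w where "y \<in> carrier M" "Y = N +>\<^bsub>M\<^esub> y" "w \<in> carrier M" "W = N +>\<^bsub>M\<^esub> w"
          using \<open>Y \<in> _\<close> \<open>W \<in> _\<close> by (auto simp: quotient_module_carrier)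
        then show ?thesis using x by (simp add: M.a_assoc)
      qed
    qed
  qed (auto simp: quotient_module_carrier smult_l_distr smult_r_distr smult_assoc1 intro: R.cring_axioms)
qed

lemma (in plain_module) submodule_span_is_submodule:
  assumes "S \<subseteq> carrier M" shows "submodule (submodule_span R M S) R M"
proof -
  let ?\<N> = "{N. submodule N R M \<and> S \<subseteq> N}"
  have "carrier M \<in> ?\<N>" using carrier_is_submodule assms by simp
  then have sub: "\<Inter>?\<N> \<subseteq> carrier M" by blast
  show ?thesis unfolding submodule_span_def
  proof (rule submoduleI[OF sub])
    show "\<zero>\<^bsub>M\<^esub> \<in> \<Inter>?\<N>"
      using subgroup.one_closed[OF submodule.axioms(1)] by fastforce
    show "\<ominus>\<^bsub>M\<^esub> a \<in> \<Inter>?\<N>" if "a \<in> \<Inter>?\<N>" for a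
      using that by (auto intro: submoduleE(3))
    show "a \<oplus>\<^bsub>M\<^esub> b \<in> \<Inter>?\<N>" if "a \<in> \<Inter>?\<N>" "b \<in> \<Inter>?\<N>" for a b
      using that by (auto intro: submoduleE(5))
    show "a \<odot>\<^bsub>M\<^esub> x \<in> \<Inter>?\<N>" if "a \<in> carrier R" "x \<in> \<Inter>?\<N>" for a x
      using that by (auto intro: submoduleE(4))
  qed
qed

lemma submodule_span_superset: "S \<subseteq> submodule_span R M S"
  by (auto simp: submodule_span_def)

context cring
begin

context
  fixes k :: "'a set" assumes k: "k \<subseteq> carrier R"
begin

interpretation F: plain_module R "free_module R (carrier R)"
  by (rule plain_module.intro, rule free_module_is_module)

abbreviation "kaehler_gens \<equiv>
  (let M = free_module R (carrier R); d = free_gen R in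
        ({d (a \<oplus>\<^bsub>R\<^esub> b) \<ominus>\<^bsub>M\<^esub> (d a \<oplus>\<^bsub>M\<^esub> d b) | a b. a \<in> carrier R \<and> b \<in> carrier R} \<union>
         {d (a \<otimes>\<^bsub>R\<^esub> b) \<ominus>\<^bsub>M\<^esub> (a \<odot>\<^bsub>M\<^esub> d b \<oplus>\<^bsub>M\<^esub> b \<odot>\<^bsub>M\<^esub> d a) | a b.
            a \<in> carrier R \<and> b \<in> carrier R} \<union>
         {d c | c. c \<in> k}))"

lemma kaehler_gens_closed: "kaehler_gens \<subseteq> carrier (free_module R (carrier R))"
  unfolding Let_def using free_gen_closed[of _ "carrier R"] k
  by (auto simp del: free_module_simps intro!: F.M.minus_closed F.M.a_closed F.smult_closed)

lemma kaehler_relations_submodule: "submodule (kaehler_relations R k) R (free_module R (carrier R))"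
  unfolding kaehler_relations_def Let_def
  using F.submodule_span_is_submodule[OF kaehler_gens_closed] by (simp add: Let_def del: free_module_simps)

lemma kaehler_relations_superset: "kaehler_gens \<subseteq> kaehler_relations R k"
  unfolding kaehler_relations_def Let_def by (rule submodule_span_superset)

lemma kaehler_is_module: "module R (kaehler R k)"
  unfolding kaehler_def by (rule F.quotient_module_is_module[OF kaehler_relations_submodule])

lemma differential_closed: "a \<in> carrier R \<Longrightarrow> differential R k a \<in> carrier (kaehler R k)"
  unfolding differential_def kaehler_def F.quotient_module_carrier
  using free_gen_closed[of a "carrier R"] by blast

lemma differential_add:
  assumes a: "a \<in> carrier R" and b: "b \<in> carrier R"
  shows "differential R k (a \<oplus> b) = differential R k a \<oplus>\<^bsub>kaehler R k\<^esub> differential R k b"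
proof -
  let ?M = "free_module R (carrier R)"
  have g: "free_gen R a \<in> carrier ?M" "free_gen R b \<in> carrier ?M" "free_gen R (a \<oplus> b) \<in> carrier ?M"
    using a b by (auto intro!: free_gen_closed)
  have "free_gen R (a \<oplus> b) \<ominus>\<^bsub>?M\<^esub> (free_gen R a \<oplus>\<^bsub>?M\<^esub> free_gen R b) \<in> kaehler_relations R k"
    by (rule subsetD[OF kaehler_relations_superset], unfold Let_def) (use a b in blast)
  then show ?thesis unfolding differential_def kaehler_def
    using g F.quotient_module_add[OF kaehler_relations_submodule g(1,2)]
      F.coset_eqI[OF kaehler_relations_submodule g(3)] F.M.a_closed[OF g(1,2)] by metis
qed

lemma differential_mult:
  assumes a: "a \<in> carrier R" and b: "b \<in> carrier R"
  shows "differential R k (a \<otimes> b) = a \<odot>\<^bsub>kaehler R k\<^esub> differential R k b \<oplus>\<^bsub>kaehler R k\<^esub>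
    b \<odot>\<^bsub>kaehler R k\<^esub> differential R k a"
proof -
  let ?M = "free_module R (carrier R)"
  have g: "free_gen R a \<in> carrier ?M" "free_gen R b \<in> carrier ?M" "free_gen R (a \<otimes> b) \<in> carrier ?M"
    using a b by (auto intro!: free_gen_closed)
  have s: "a \<odot>\<^bsub>?M\<^esub> free_gen R b \<in> carrier ?M" "b \<odot>\<^bsub>?M\<^esub> free_gen R a \<in> carrier ?M"
    using F.smult_closed a b g by blast+
  have "free_gen R (a \<otimes> b) \<ominus>\<^bsub>?M\<^esub> (a \<odot>\<^bsub>?M\<^esub> free_gen R b \<oplus>\<^bsub>?M\<^esub> b \<odot>\<^bsub>?M\<^esub> free_gen R a) \<in> kaehler_relations R k"
    by (rule subsetD[OF kaehler_relations_superset], unfold Let_def) (use a b in blast)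
  note eq = F.coset_eqI[OF kaehler_relations_submodule g(3) F.M.a_closed[OF s] this]
  show ?thesis unfolding differential_def kaehler_def
    unfolding F.quotient_module_smult[OF kaehler_relations_submodule a g(2)]
      F.quotient_module_smult[OF kaehler_relations_submodule b g(1)]
      F.quotient_module_add[OF kaehler_relations_submodule s] by (rule eq)
qed

text \<open>The linear functional on the free module that a derivation \<open>D\<close> induces.\<close>

definition extend_linear :: "('a \<Rightarrow> 'a) \<Rightarrow> ('a \<Rightarrow> 'a) \<Rightarrow> 'a"
  where "extend_linear D f = (\<Oplus>a\<in>{a. f a \<noteq> \<zero>}. f a \<otimes> D a)"

lemma extend_linear_superset:
  assumes D: "D \<in> carrier R \<rightarrow> carrier R" and f: "f \<in> carrier (free_module R (carrier R))"
    and S: "finite S" "{a. f a \<noteq> \<zero>} \<subseteq> S" "S \<subseteq> carrier R"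
  shows "extend_linear D f = (\<Oplus>a\<in>S. f a \<otimes> D a)"
  unfolding extend_linear_def
proof (rule add.finprod_mono_neutral_cong_left[OF S(1,2)])
  have fc: "f a \<in> carrier R" for a using f by (simp add: free_module_carrier)
  have Dc: "D a \<in> carrier R" if "a \<in> S" for a using that S(3) D by (meson PiE subsetD)
  show "f i \<otimes> D i = \<zero>" if "i \<in> S - {a. f a \<noteq> \<zero>}" for i using that Dc by simp
  show "(\<lambda>a. f a \<otimes> D a) \<in> S \<rightarrow> carrier R" using fc Dc by simp
qed simp

lemma extend_linear_closed:
  assumes D: "D \<in> carrier R \<rightarrow> carrier R" and f: "f \<in> carrier (free_module R (carrier R))"
  shows "extend_linear D f \<in> carrier R"
proof -
  have "f a \<in> carrier R" "f a \<noteq> \<zero> \<Longrightarrow> D a \<in> carrier R" for a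
    using f D by (auto simp: free_module_carrier)
  then show ?thesis unfolding extend_linear_def by (intro finsum_closed) auto
qed

lemma extend_linear_add:
  assumes D: "D \<in> carrier R \<rightarrow> carrier R"
    and f: "f \<in> carrier (free_module R (carrier R))" "g \<in> carrier (free_module R (carrier R))"
  shows "extend_linear D (f \<oplus>\<^bsub>free_module R (carrier R)\<^esub> g) = extend_linear D f \<oplus> extend_linear D g"
proof -
  let ?S = "{a. f a \<noteq> \<zero>} \<union> {a. g a \<noteq> \<zero>}"
  have S: "finite ?S" "?S \<subseteq> carrier R" using f by (auto simp: free_module_carrier)
  have c: "f a \<in> carrier R" "g a \<in> carrier R" for a using f by (simp_all add: free_module_carrier)
  have Dc: "D a \<in> carrier R" if "a \<in> ?S" for a using that S(2) D by (meson PiE subsetD)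
  have "extend_linear D (f \<oplus>\<^bsub>free_module R (carrier R)\<^esub> g) = (\<Oplus>a\<in>?S. (f a \<oplus> g a) \<otimes> D a)"
  proof -
    have "{a. (f \<oplus>\<^bsub>free_module R (carrier R)\<^esub> g) a \<noteq> \<zero>} \<subseteq> ?S" by auto
    from extend_linear_superset[OF D F.M.a_closed[OF f] S(1) this S(2)] show ?thesis by simp
  qed
  also have "\<dots> = (\<Oplus>a\<in>?S. f a \<otimes> D a \<oplus> g a \<otimes> D a)"
    using c Dc by (intro finsum_cong') (auto simp: l_distr)
  also have "\<dots> = (\<Oplus>a\<in>?S. f a \<otimes> D a) \<oplus> (\<Oplus>a\<in>?S. g a \<otimes> D a)"
    using c Dc by (intro finsum_addf) auto
  also have "\<dots> = extend_linear D f \<oplus> extend_linear D g"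
    using extend_linear_superset[OF D f(1) S(1) _ S(2)] extend_linear_superset[OF D f(2) S(1) _ S(2)] by simp
  finally show ?thesis .
qed

lemma extend_linear_smult:
  assumes D: "D \<in> carrier R \<rightarrow> carrier R" and r: "r \<in> carrier R"
    and f: "f \<in> carrier (free_module R (carrier R))"
  shows "extend_linear D (r \<odot>\<^bsub>free_module R (carrier R)\<^esub> f) = r \<otimes> extend_linear D f"
proof -
  let ?S = "{a. f a \<noteq> \<zero>}"
  have S: "finite ?S" "?S \<subseteq> carrier R" using f by (auto simp: free_module_carrier)
  have c: "f a \<in> carrier R" for a using f by (simp add: free_module_carrier)
  have Dc: "D a \<in> carrier R" if "a \<in> ?S" for a using that S(2) D by (meson PiE subsetD)
  have "extend_linear D (r \<odot>\<^bsub>free_module R (carrier R)\<^esub> f) = (\<Oplus>a\<in>?S. (r \<otimes> f a) \<otimes> D a)"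
  proof -
    have "{a. (r \<odot>\<^bsub>free_module R (carrier R)\<^esub> f) a \<noteq> \<zero>} \<subseteq> ?S" using r by auto
    from extend_linear_superset[OF D F.smult_closed[OF r f] S(1) this S(2)] show ?thesis by simp
  qed
  also have "\<dots> = (\<Oplus>a\<in>?S. r \<otimes> (f a \<otimes> D a))"
    using c Dc r by (intro finsum_cong') (auto simp: m_assoc)
  also have "\<dots> = r \<otimes> extend_linear D f"
    unfolding extend_linear_def using S(1) c Dc r by (intro finsum_rdistr[symmetric]) auto
  finally show ?thesis .
qed

lemma extend_linear_gen:
  assumes D: "D \<in> carrier R \<rightarrow> carrier R" and a: "a \<in> carrier R"
  shows "extend_linear D (free_gen R a) = D a"
proof -
  have "D a \<in> carrier R" using D a by blast
  moreover have "{b. free_gen R a b \<noteq> \<zero>} \<subseteq> {a}" by (auto simp: free_gen_def)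
  ultimately show ?thesis using extend_linear_superset[OF D free_gen_closed[OF a], of "{a}"] a
    by (simp add: free_gen_def)
qed

lemma extend_linear_minus:
  assumes D: "D \<in> carrier R \<rightarrow> carrier R"
    and f: "f \<in> carrier (free_module R (carrier R))" "g \<in> carrier (free_module R (carrier R))"
  shows "extend_linear D (f \<ominus>\<^bsub>free_module R (carrier R)\<^esub> g) = extend_linear D f \<ominus> extend_linear D g"
proof -
  let ?M = "free_module R (carrier R)"
  have "extend_linear D (f \<ominus>\<^bsub>?M\<^esub> g) \<oplus> extend_linear D g = extend_linear D ((f \<ominus>\<^bsub>?M\<^esub> g) \<oplus>\<^bsub>?M\<^esub> g)"
    using extend_linear_add[OF D F.M.minus_closed[OF f] f(2)] by simp
  also have "(f \<ominus>\<^bsub>?M\<^esub> g) \<oplus>\<^bsub>?M\<^esub> g = f"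
    using f by (simp add: a_minus_def F.M.a_assoc F.M.l_neg del: free_module_simps)
  finally show ?thesis
    using extend_linear_closed[OF D] f F.M.minus_closed[OF f]
    by (metis a_minus_def a_assoc a_inv_closed r_neg r_zero)
qed

text \<open>The three kinds of generating relations are killed by the functional because \<open>D\<close> is additive, obeys the
  product rule and vanishes on \<open>k\<close>.\<close>

lemma kaehler_relations_kernel:
  assumes D: "D \<in> derivations R k" and f: "f \<in> kaehler_relations R k"
  shows "extend_linear D f = \<zero>"
proof -
  let ?M = "free_module R (carrier R)"
  have Dc: "D \<in> carrier R \<rightarrow> carrier R"
    and Da: "\<And>a b. a \<in> carrier R \<Longrightarrow> b \<in> carrier R \<Longrightarrow> D (a \<oplus> b) = D a \<oplus> D b"
    and Dm: "\<And>a b. a \<in> carrier R \<Longrightarrow> b \<in> carrier R \<Longrightarrow> D (a \<otimes> b) = a \<otimes> D b \<oplus> b \<otimes> D a"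
    and Dk: "\<And>c. c \<in> k \<Longrightarrow> D c = \<zero>" using D by (auto simp: derivations_def)
  have Dcl: "D a \<in> carrier R" if "a \<in> carrier R" for a using Dc that by blast
  let ?N = "{f \<in> carrier ?M. extend_linear D f = \<zero>}"
  have "submodule ?N R ?M"
  proof (rule F.submoduleI)
    show "\<zero>\<^bsub>?M\<^esub> \<in> ?N" using F.M.zero_closed by (simp add: extend_linear_def)
    fix f assume f: "f \<in> ?N"
    have "extend_linear D (\<ominus>\<^bsub>?M\<^esub> f) = extend_linear D (\<zero>\<^bsub>?M\<^esub> \<ominus>\<^bsub>?M\<^esub> f)"
      using f by (simp add: a_minus_def F.M.l_zero del: free_module_simps)
    also have "\<dots> = \<zero>" using extend_linear_minus[OF Dc F.M.zero_closed, of f] f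
      by (simp add: extend_linear_def a_minus_def)
    finally show "\<ominus>\<^bsub>?M\<^esub> f \<in> ?N" using f by (simp del: free_module_simps)
  next
    fix f g assume "f \<in> ?N" "g \<in> ?N"
    then show "f \<oplus>\<^bsub>?M\<^esub> g \<in> ?N" using extend_linear_add[OF Dc, of f g] F.M.a_closed[of f g]
      by (simp del: free_module_simps)
  next
    fix r f assume "r \<in> carrier R" "f \<in> ?N"
    then show "r \<odot>\<^bsub>?M\<^esub> f \<in> ?N" using extend_linear_smult[OF Dc, of r f] F.smult_closed[of r f]
      by (simp del: free_module_simps)
  qed auto
  moreover have "kaehler_gens \<subseteq> ?N"
  proof
    fix g assume g: "g \<in> kaehler_gens"
    then have gc: "g \<in> carrier ?M" using kaehler_gens_closed by blast
    have gen: "free_gen R a \<in> carrier ?M" if "a \<in> carrier R" for a using that by (rule free_gen_closed)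
    have "extend_linear D g = \<zero>"
      using g unfolding Let_def
    proof (elim UnE CollectE exE conjE)
      fix a b assume ab: "g = free_gen R (a \<oplus> b) \<ominus>\<^bsub>?M\<^esub> (free_gen R a \<oplus>\<^bsub>?M\<^esub> free_gen R b)"
        "a \<in> carrier R" "b \<in> carrier R"
      have "extend_linear D g = D (a \<oplus> b) \<ominus> (D a \<oplus> D b)"
        unfolding ab(1) using ab(2,3) gen Dc
        by (subst extend_linear_minus, simp_all add: extend_linear_add extend_linear_gen F.M.a_closed del: free_module_simps)
      then show ?thesis using ab Da Dcl by (simp add: a_minus_def r_neg)
    next
      fix a b assume ab: "g = free_gen R (a \<otimes> b) \<ominus>\<^bsub>?M\<^esub> (a \<odot>\<^bsub>?M\<^esub> free_gen R b \<oplus>\<^bsub>?M\<^esub> b \<odot>\<^bsub>?M\<^esub> free_gen R a)"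
        "a \<in> carrier R" "b \<in> carrier R"
      have "extend_linear D g = D (a \<otimes> b) \<ominus> (a \<otimes> D b \<oplus> b \<otimes> D a)"
        unfolding ab(1) using ab(2,3) gen Dc
        by (subst extend_linear_minus, simp_all add: extend_linear_add extend_linear_smult extend_linear_gen
            F.M.a_closed F.smult_closed del: free_module_simps)
      then show ?thesis using ab Dm Dcl by (simp add: a_minus_def r_neg)
    next
      fix c assume "g = free_gen R c" "c \<in> k"
      then show ?thesis using Dk k extend_linear_gen[OF Dc] by auto
    qed
    then show "g \<in> ?N" using gc by simp
  qed
  ultimately have "kaehler_relations R k \<subseteq> ?N"
    unfolding kaehler_relations_def submodule_span_def Let_def by blast
  then show ?thesis using f by blast
qed

text \<open>A derivation is the universal differential followed by a linear form.\<close>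

lemma derivation_divisible:
  assumes D: "D \<in> derivations R k" and r: "r \<in> carrier R" and u: "u \<in> carrier R"
    and \<omega>: "\<omega> \<in> carrier (kaehler R k)" "differential R k u = r \<odot>\<^bsub>kaehler R k\<^esub> \<omega>"
  shows "\<exists>c\<in>carrier R. D u = r \<otimes> c"
proof -
  let ?M = "free_module R (carrier R)"
  let ?N = "kaehler_relations R k"
  note N = kaehler_relations_submodule
  interpret N: abelian_subgroup ?N ?M by (rule F.submodule_abelian_subgroup[OF N])
  have Dc: "D \<in> carrier R \<rightarrow> carrier R" using D by (auto simp: derivations_def)
  obtain f where f: "f \<in> carrier ?M" "\<omega> = ?N +>\<^bsub>?M\<^esub> f"
    using \<omega>(1) by (auto simp: kaehler_def F.quotient_module_carrier)
  have ug: "free_gen R u \<in> carrier ?M" using u by (rule free_gen_closed)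
  have rf: "r \<odot>\<^bsub>?M\<^esub> f \<in> carrier ?M" using r f(1) by (rule F.smult_closed)
  have "?N +>\<^bsub>?M\<^esub> free_gen R u = ?N +>\<^bsub>?M\<^esub> (r \<odot>\<^bsub>?M\<^esub> f)"
    using \<omega>(2) F.quotient_module_smult[OF N r f(1)] by (simp add: differential_def kaehler_def f(2) del: free_module_simps)
  then have "free_gen R u \<in> ?N +>\<^bsub>?M\<^esub> (r \<odot>\<^bsub>?M\<^esub> f)" using N.a_rcos_self[OF ug] by simp
  then obtain h where h: "h \<in> ?N" "free_gen R u = h \<oplus>\<^bsub>?M\<^esub> (r \<odot>\<^bsub>?M\<^esub> f)"
    by (auto simp: a_r_coset_def' simp del: free_module_simps)
  have hc: "h \<in> carrier ?M" using h(1) N.a_subset by blast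
  have "D u = extend_linear D h \<oplus> r \<otimes> extend_linear D f"
    using extend_linear_gen[OF Dc u] extend_linear_add[OF Dc hc rf] extend_linear_smult[OF Dc r f(1)] h(2) by simp
  also have "\<dots> = r \<otimes> extend_linear D f"
    using kaehler_relations_kernel[OF D h(1)] extend_linear_closed[OF Dc f(1)] r by simp
  finally show ?thesis using extend_linear_closed[OF Dc f(1)] by blast
qed

end

end

section \<open>The order of vanishing of a differential\<close>

text \<open>The computation behind the product rule for a commutator of derivations \<open>\<theta>\<close> and \<open>D\<close>, where \<open>tdb\<close> stands
  for \<open>\<theta> (D b)\<close>, \<open>ta\<close> for \<open>\<theta> a\<close>, and so on.\<close>

lemma (in cring) commutator_leibniz:
  assumes "a \<in> carrier R" "b \<in> carrier R" "ta \<in> carrier R" "tb \<in> carrier R" "da \<in> carrier R" "db \<in> carrier R"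
    "tda \<in> carrier R" "tdb \<in> carrier R" "dta \<in> carrier R" "dtb \<in> carrier R"
  shows "((a \<otimes> tdb \<oplus> db \<otimes> ta) \<oplus> (b \<otimes> tda \<oplus> da \<otimes> tb)) \<ominus> ((a \<otimes> dtb \<oplus> tb \<otimes> da) \<oplus> (b \<otimes> dta \<oplus> ta \<otimes> db))
    = a \<otimes> (tdb \<ominus> dtb) \<oplus> b \<otimes> (tda \<ominus> dta)"
  using assms by algebra

context char_p_field
begin

lemma derivation_commutator:
  assumes V: "subring V R" and \<theta>: "\<theta> \<in> derivations (R\<lparr>carrier := V\<rparr>) k" and D: "D \<in> derivations (R\<lparr>carrier := V\<rparr>) k"
    and k: "k \<subseteq> V"
  shows "(\<lambda>x. \<theta> (D x) \<ominus> D (\<theta> x)) \<in> derivations (R\<lparr>carrier := V\<rparr>) k"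
proof -
  note T = derivationsD[OF \<theta>] and D' = derivationsD[OF D]
  note Vc = subring_carrier[OF V]
  note V_ops = subringE(5,6,7)[OF V]
  let ?E = "\<lambda>x. \<theta> (D x) \<ominus> D (\<theta> x)"
  have "?E a \<in> V" if "a \<in> V" for a
    using that T(1) D'(1) V_ops by (simp add: a_minus_def)
  moreover have "?E (a \<oplus> b) = ?E a \<oplus> ?E b" if "a \<in> V" "b \<in> V" for a b
    using that T(1,2) D'(1,2) Vc by (simp add: a_minus_def minus_add a_ac)
  moreover have "?E (a \<otimes> b) = a \<otimes> ?E b \<oplus> b \<otimes> ?E a" if ab: "a \<in> V" "b \<in> V" for a b
  proof -
    have m: "\<theta> a \<in> V" "\<theta> b \<in> V" "D a \<in> V" "D b \<in> V" using ab T(1) D'(1) by auto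
    have "\<theta> (D (a \<otimes> b)) = (a \<otimes> \<theta> (D b) \<oplus> D b \<otimes> \<theta> a) \<oplus> (b \<otimes> \<theta> (D a) \<oplus> D a \<otimes> \<theta> b)"
      using ab m V_ops by (simp add: D'(3) T(2,3))
    moreover have "D (\<theta> (a \<otimes> b)) = (a \<otimes> D (\<theta> b) \<oplus> \<theta> b \<otimes> D a) \<oplus> (b \<otimes> D (\<theta> a) \<oplus> \<theta> a \<otimes> D b)"
      using ab m V_ops by (simp add: D'(2,3) T(3))
    ultimately show ?thesis
      using commutator_leibniz[of a b "\<theta> a" "\<theta> b" "D a" "D b" "\<theta> (D a)" "\<theta> (D b)" "D (\<theta> a)" "D (\<theta> b)"]
        ab m T(1) D'(1) Vc by simp
  qed
  moreover have "?E c = \<zero>" if "c \<in> k" for c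
    using T(4)[OF that] D'(4)[OF that] derivation_zero[OF \<theta> V] derivation_zero[OF D V]
    by (simp add: a_minus_def)
  ultimately show ?thesis by (simp add: derivations_def)
qed

lemma derivation_one:
  assumes V: "subring V R" and D: "D \<in> derivations (R\<lparr>carrier := V\<rparr>) k"
  shows "D \<one> = \<zero>"
proof -
  have "D \<one> \<in> carrier R" using derivationsD(1)[OF D] subringE(3)[OF V] subring_carrier[OF V] by blast
  moreover have "D \<one> = D \<one> \<oplus> D \<one>"
    using derivationsD(3)[OF D, of \<one> \<one>] subringE(3)[OF V] calculation by simp
  ultimately show ?thesis using add.l_cancel_one' by metis
qed

lemma derivation_pow:
  assumes V: "subring V R" and D: "D \<in> derivations (R\<lparr>carrier := V\<rparr>) k" and y: "y \<in> V"
  shows "D (y [^] i) = dpow y i \<otimes> D y"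
proof (induction i)
  case 0
  then show ?case using derivation_one[OF V D] derivationsD(1)[OF D y] subring_carrier[OF V] by simp
next
  case (Suc i)
  have yc: "y \<in> carrier R" and Dy: "D y \<in> carrier R"
    using derivationsD(1)[OF D y] subring_carrier[OF V] y by auto
  have "D (y [^] Suc i) = y [^] i \<otimes> D y \<oplus> y \<otimes> (dpow y i \<otimes> D y)"
    using derivationsD(3)[OF D subring_pow_closed[OF V y] y] Suc.IH by simp
  also have "\<dots> = dpow y (i + 1) \<otimes> D y"
    unfolding dpow_add[OF yc] using yc Dy by (simp add: dpow_1 l_distr m_assoc)
  finally show ?case by simp
qed

end

context char_p_dvr
begin

text \<open>The integer \<open>n\<close> is invertible modulo \<open>p\<close>.\<close>

lemma multiple_mem_m:
  assumes a: "a \<in> V" and n: "\<not> p dvd n" "add_pow R n a \<in> m"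
  shows "a \<in> m"
proof -
  have "coprime n p" using n(1) prime_p by (metis coprime_commute prime_imp_coprime)
  moreover have "n \<noteq> 0" using n(1) by (metis dvd_0_right)
  ultimately obtain x y where xy: "n * x = p * y + 1" using bezout_nat[of n p] by auto
  have ap: "add_pow R i b \<in> m" if "b \<in> m" for i :: nat and b
    using that m_zero m_add by (induction i) auto
  have ac: "a \<in> carrier R" using a Vc by simp
  have "add_pow R (n * x) a \<in> m"
    using ap[OF n(2), of x] ac add.nat_pow_pow[of a x n] by (simp add: mult.commute)
  moreover have "add_pow R (p * y + 1) a = add_pow R (p * y) a \<oplus> a" using ac by simp
  moreover have "add_pow R (p * y) a = \<zero>" using ac by (intro dvd_add_pow) auto
  ultimately show ?thesis using ac xy by simp
qed

text \<open>Let \<open>D u = s\<^sup>g c\<close>. Since \<open>\<theta> u = 0\<close>, the commutator of \<open>\<theta>\<close> and \<open>D\<close> sends \<open>u\<close> to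
  \<open>\<theta> (D u) = s\<^sup>g \<theta> c + g s\<^sup>g\<^sup>-\<^sup>1 \<theta>(s) c\<close>. The commutator is a derivation too, so this is divisible by \<open>s\<^sup>g\<close>.
  Hence \<open>s\<close> divides \<open>g \<theta>(s) c\<close>, where \<open>g\<close> and \<open>\<theta> s\<close> are units, so that \<open>s\<close> divides \<open>c\<close>.\<close>

lemma divisibility_improves:
  assumes k: "k \<subseteq> V"
    and \<theta>: "\<theta> \<in> derivations (R\<lparr>carrier := V\<rparr>) k" "\<theta> u = \<zero>" "\<theta> s \<notin> m"
    and u: "u \<in> V" and g: "\<not> p dvd g"
    and div: "\<And>D. D \<in> derivations (R\<lparr>carrier := V\<rparr>) k \<Longrightarrow> \<exists>c\<in>V. D u = s [^] g \<otimes> c"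
    and D: "D \<in> derivations (R\<lparr>carrier := V\<rparr>) k"
  shows "\<exists>c\<in>V. D u = s [^] (g + 1) \<otimes> c"
proof -
  note T = derivationsD[OF \<theta>(1)]
  obtain c where c: "c \<in> V" "D u = s [^] g \<otimes> c" using div[OF D] by blast
  obtain e where e: "e \<in> V" "\<theta> (D u) \<ominus> D (\<theta> u) = s [^] g \<otimes> e"
    using div[OF derivation_commutator[OF V \<theta>(1) D k]] by blast
  let ?S = "s [^] g"
  have S: "?S \<in> V" using V_pow s by simp
  have Sc: "?S \<in> carrier R" "?S \<noteq> \<zero>" using S Vc nonzero_pow_nonzero[OF sc s(2)] by auto
  have ts: "\<theta> s \<in> V" "\<theta> c \<in> V" using T(1) s c by auto
  have cl: "c \<in> carrier R" "e \<in> carrier R" "\<theta> s \<in> carrier R" "\<theta> c \<in> carrier R" "dpow s g \<in> carrier R"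
    using c e ts Vc sc by auto
  have "\<theta> (D u) = ?S \<otimes> e"
    using e(2) \<theta>(2) derivation_zero[OF D V] T(1) derivationsD(1)[OF D u] Vc
    by (simp add: a_minus_def)
  moreover have "\<theta> (D u) = ?S \<otimes> \<theta> c \<oplus> c \<otimes> (dpow s g \<otimes> \<theta> s)"
    unfolding c(2) T(3)[OF S c(1)] derivation_pow[OF V \<theta>(1) s(1)] ..
  \<comment> \<open>the factor \<open>s\<close> avoids the exponent \<open>g - 1\<close>\<close>
  ultimately have "s \<otimes> (?S \<otimes> e) = s \<otimes> (?S \<otimes> \<theta> c \<oplus> c \<otimes> (dpow s g \<otimes> \<theta> s))" by simp
  also have "\<dots> = ?S \<otimes> (s \<otimes> \<theta> c) \<oplus> (s \<otimes> dpow s g) \<otimes> (\<theta> s \<otimes> c)"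
    using cl sc Sc by (simp add: r_distr m_ac)
  also have "s \<otimes> dpow s g = ?S \<otimes> add_pow R g \<one>"
    unfolding dpow_mult[OF sc] using add_pow_rdistr[of ?S \<one> g] Sc by simp
  also have "?S \<otimes> (s \<otimes> \<theta> c) \<oplus> ?S \<otimes> add_pow R g \<one> \<otimes> (\<theta> s \<otimes> c)
      = ?S \<otimes> (s \<otimes> \<theta> c \<oplus> add_pow R g \<one> \<otimes> (\<theta> s \<otimes> c))"
    using cl sc Sc by (simp add: r_distr m_assoc)
  also have "add_pow R g \<one> \<otimes> (\<theta> s \<otimes> c) = add_pow R g (\<theta> s \<otimes> c)"
    using cl add_pow_ldistr[of \<one> "\<theta> s \<otimes> c" g] by simp
  finally have "?S \<otimes> (s \<otimes> e) = ?S \<otimes> (s \<otimes> \<theta> c \<oplus> add_pow R g (\<theta> s \<otimes> c))"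
    using cl sc Sc by (simp add: m_lcomm)
  then have "s \<otimes> e = s \<otimes> \<theta> c \<oplus> add_pow R g (\<theta> s \<otimes> c)"
    using m_lcancel[OF Sc(2,1)] cl sc by simp
  then have "add_pow R g (\<theta> s \<otimes> c) = \<ominus> (s \<otimes> \<theta> c) \<oplus> s \<otimes> e"
    using cl sc by (simp add: r_neg1)
  then have "add_pow R g (\<theta> s \<otimes> c) \<in> m" using m_add m_neg mI ts e(1) by simp
  then have "\<theta> s \<otimes> c \<in> m" using multiple_mem_m[OF _ g] ts c V_ops by simp
  then have "c \<in> m" using m_prime[OF ts(1) \<theta>(3) c(1)] by simp
  then obtain c' where c': "c' \<in> V" "c = s \<otimes> c'" by (auto elim: mE)
  then have "D u = s [^] (g + 1) \<otimes> c'" using c(2) sc Vc by (simp add: m_assoc)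
  then show ?thesis using c' by blast
qed

text \<open>A dual basis \<open>D\<close> makes divisibility of \<open>du\<close> by a power of \<open>s\<close> equivalent to divisibility of \<open>\<theta>' u\<close> for all
  derivations \<open>\<theta>'\<close>, so that an exponent prime to \<open>p\<close> can be raised by one and is not the maximum. The
  exponents are bounded, as otherwise all \<open>D i u\<close> would vanish and \<open>u\<close> would be a \<open>p\<close>-th power.\<close>

theorem p_divides_order_of_differential:
  assumes G: "finite G" "G \<subseteq> V"
    and gen: "\<And>B. subring B R \<Longrightarrow> pth_powers V \<subseteq> B \<Longrightarrow> G \<subseteq> B \<Longrightarrow> V \<subseteq> B"
    and k: "k \<subseteq> pth_powers V"
    and u: "u \<in> V" "u \<notin> pth_powers V"
    and \<theta>: "\<theta> \<in> derivations (R\<lparr>carrier := V\<rparr>) k" "\<theta> u = \<zero>" "\<theta> s \<notin> m"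
  shows "p dvd Max {r::nat. \<exists>\<omega>\<in>carrier (kaehler (R\<lparr>carrier := V\<rparr>) k).
    differential (R\<lparr>carrier := V\<rparr>) k u = (s [^] r) \<odot>\<^bsub>kaehler (R\<lparr>carrier := V\<rparr>) k\<^esub> \<omega>}"
proof -
  let ?V = "R\<lparr>carrier := V\<rparr>"
  let ?\<Omega> = "kaehler ?V k"
  let ?d = "differential ?V k"
  have kV: "k \<subseteq> V" using k pth_powers_V by blast
  interpret Vr: cring ?V by (rule V_cring)
  have kV': "k \<subseteq> carrier ?V" using kV by simp
  note km = Vr.kaehler_is_module[OF kV']
  interpret O: module ?V ?\<Omega> by (rule km)
  interpret C: char_p_dvr_derivation R p V s ?\<Omega> ?d
  proof (intro char_p_dvr_derivation.intro char_p_dvr_axioms char_p_derivation.intro char_p_field_axioms km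
      char_p_derivation_axioms.intro V)
    fix x y assume x: "x \<in> V" and y: "y \<in> V"
    show "?d x \<in> carrier ?\<Omega>" using Vr.differential_closed[OF kV'] x by simp
    show "?d (x \<oplus> y) = ?d x \<oplus>\<^bsub>?\<Omega>\<^esub> ?d y" using Vr.differential_add[OF kV', of x y] x y by simp
    show "?d (x \<otimes> y) = x \<odot>\<^bsub>?\<Omega>\<^esub> ?d y \<oplus>\<^bsub>?\<Omega>\<^esub> y \<odot>\<^bsub>?\<Omega>\<^esub> ?d x"
      using Vr.differential_mult[OF kV', of x y] x y by simp
  qed
  obtain N Y D where db: "C.D.dual_basis V N Y D"
    using C.dual_basis_exists[OF G gen] by blast
  let ?F = "pth_powers V"
  have Y: "\<And>i. i < N \<Longrightarrow> Y i \<in> V" and DF: "\<And>i. i < N \<Longrightarrow> D i \<in> derivations ?V ?F"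
    and dx: "\<And>x. x \<in> V \<Longrightarrow> ?d x = finsum ?\<Omega> (\<lambda>i. D i x \<odot>\<^bsub>?\<Omega>\<^esub> ?d (Y i)) {..<N}"
    and ker: "\<And>x. x \<in> V \<Longrightarrow> (\<And>i. i < N \<Longrightarrow> D i x = \<zero>) \<Longrightarrow> x \<in> ?F"
    using db unfolding C.D.dual_basis_def by auto
  have Dk: "D i \<in> derivations ?V k" if "i < N" for i
    using DF[OF that] k by (auto simp: derivations_def)
  let ?G = "{r::nat. \<exists>\<omega>\<in>carrier ?\<Omega>. ?d u = (s [^] r) \<odot>\<^bsub>?\<Omega>\<^esub> \<omega>}"
  have div: "\<exists>c\<in>V. E u = s [^] r \<otimes> c" if "r \<in> ?G" "E \<in> derivations ?V k" for r E
    using Vr.derivation_divisible[OF kV' that(2), of "s [^] r" u] that(1) V_pow[OF s(1)] u(1) by auto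
  have conv: "r \<in> ?G" if "\<And>i. i < N \<Longrightarrow> \<exists>c\<in>V. D i u = s [^] r \<otimes> c" for r
  proof -
    have "\<forall>i\<in>{..<N}. \<exists>c. c \<in> V \<and> D i u = s [^] r \<otimes> c" using that by blast
    then obtain c where c: "\<And>i. i < N \<Longrightarrow> c i \<in> V" "\<And>i. i < N \<Longrightarrow> D i u = s [^] r \<otimes> c i"
      using bchoice[of "{..<N}"] by (metis lessThan_iff)
    have dY: "?d (Y i) \<in> carrier ?\<Omega>" if "i < N" for i using C.D.d_closed Y that by blast
    have t: "c i \<odot>\<^bsub>?\<Omega>\<^esub> ?d (Y i) \<in> carrier ?\<Omega>" if "i < N" for i using c(1) dY that C.D.smult_closed' by blast
    have "?d u = finsum ?\<Omega> (\<lambda>i. s [^] r \<odot>\<^bsub>?\<Omega>\<^esub> (c i \<odot>\<^bsub>?\<Omega>\<^esub> ?d (Y i))) {..<N}"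
      unfolding dx[OF u(1)]
      by (intro O.M.finsum_cong' refl)
         (use c dY t V_pow[OF s(1)] C.D.smult_closed' C.D.smult_assoc' in auto)
    also have "\<dots> = s [^] r \<odot>\<^bsub>?\<Omega>\<^esub> finsum ?\<Omega> (\<lambda>i. c i \<odot>\<^bsub>?\<Omega>\<^esub> ?d (Y i)) {..<N}"
      by (rule O.finsum_smult_ldistr[symmetric]) (use t V_pow[OF s(1)] in auto)
    finally show ?thesis using t by (auto intro!: O.M.finsum_closed bexI)
  qed
  have G0: "0 \<in> ?G"
    using C.D.d_closed[OF u(1)] O.smult_one[of "?d u"] by auto
  have "finite ?G"
  proof -
    obtain i where i: "i < N" "D i u \<noteq> \<zero>" using ker[OF u(1)] u(2) by blast
    have DuV: "D i u \<in> V" using derivationsD(1)[OF Dk[OF i(1)] u(1)] .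
    obtain n :: nat where n: "\<not> (\<exists>v\<in>V. D i u = s [^] n \<otimes> v)" using separated[OF DuV] i(2) by blast
    have "r < n" if r: "r \<in> ?G" for r
    proof (rule ccontr)
      assume "\<not> r < n"
      then obtain q where q: "r = n + q" using le_Suc_ex not_less by blast
      obtain c where c: "c \<in> V" "D i u = s [^] r \<otimes> c" using div[OF r Dk[OF i(1)]] by blast
      have "D i u = s [^] n \<otimes> (s [^] q \<otimes> c)"
        unfolding c(2) q nat_pow_mult[OF sc, symmetric] using sc c(1) Vc by (simp add: m_assoc)
      moreover have "s [^] q \<otimes> c \<in> V" using c(1) V_pow[OF s(1)] V_ops by simp
      ultimately show False using n by blast
    qed
    then have "?G \<subseteq> {..<n}" by blast
    then show ?thesis by (rule finite_subset) simp
  qed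
  show ?thesis
  proof (rule ccontr)
    assume np: "\<not> p dvd Max ?G"
    have mem: "Max ?G \<in> ?G" by (rule Max_in[OF \<open>finite ?G\<close>]) (use G0 in \<open>metis empty_iff\<close>)
    have "Max ?G + 1 \<in> ?G"
    proof (rule conv)
      fix i assume "i < N"
      then show "\<exists>c\<in>V. D i u = s [^] (Max ?G + 1) \<otimes> c"
        using divisibility_improves[OF kV \<theta> u(1) np, where D = "D i"] div[OF mem] Dk by blast
    qed
    then show False using Max_ge[OF \<open>finite ?G\<close>] by fastforce
  qed
qed

text \<open>For \<open>p\<close> dividing \<open>n\<close> the factor \<open>s\<^sup>n\<close> is a constant of \<open>\<theta>\<close>.\<close>

lemma kills_unit_part:
  assumes \<theta>: "\<theta> \<in> derivations (R\<lparr>carrier := V\<rparr>) k" and u: "u \<in> V" and n: "p dvd n"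
    and zero: "\<theta> (u \<otimes> s [^] (n::nat)) = \<zero>"
  shows "\<theta> u = \<zero>"
proof -
  note T = derivationsD[OF \<theta>]
  have S: "s [^] n \<in> V" using V_pow s by simp
  have "\<theta> (s [^] n) = \<zero>"
    using derivation_pow[OF V \<theta> s(1), of n] dpow_multiple[OF sc n] T(1)[OF s(1)] Vc by simp
  then have "s [^] n \<otimes> \<theta> u = \<zero>"
    using zero T(3)[OF u S] u S T(1)[OF u] Vc by simp
  then show ?thesis
    using integral[of "s [^] n" "\<theta> u"] nonzero_pow_nonzero[OF sc s(2), of n] S T(1)[OF u] Vc by auto
qed

end

section \<open>Tensor products\<close>

subsection \<open>Monoid rings\<close>

context comm_monoid
begin

abbreviation "Z \<equiv> monoid_ring G"

lemma monoid_ring_simps: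
  "\<zero>\<^bsub>Z\<^esub> = (\<lambda>_. 0)" "\<one>\<^bsub>Z\<^esub> = single \<one>" "f \<oplus>\<^bsub>Z\<^esub> g = (\<lambda>x. f x + g x)"
  by (simp_all add: monoid_ring_def single_def fun_eq_iff)

lemma monoid_ring_carrier: "f \<in> carrier Z \<longleftrightarrow> finite {x. f x \<noteq> 0} \<and> {x. f x \<noteq> 0} \<subseteq> carrier G"
  by (simp add: monoid_ring_def)

text \<open>A sum over fixed sets that contain the supports, so that products of different elements can be compared.\<close>

lemma monoid_ring_mult_superset:
  assumes "finite S" "{x. f x \<noteq> 0} \<subseteq> S" "finite T" "{y. g y \<noteq> 0} \<subseteq> T"
  shows "(f \<otimes>\<^bsub>Z\<^esub> g) z = (\<Sum>x\<in>S. \<Sum>y\<in>T. if x \<otimes> y = z then f x * g y else 0)"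
proof -
  have "(f \<otimes>\<^bsub>Z\<^esub> g) z = (\<Sum>(x, y)\<in>{(x, y). f x \<noteq> 0 \<and> g y \<noteq> 0 \<and> x \<otimes> y = z}. f x * g y)"
    by (simp add: monoid_ring_def)
  also have "\<dots> = (\<Sum>(x, y)\<in>S \<times> T. if x \<otimes> y = z then f x * g y else 0)"
    by (rule sum.mono_neutral_cong_left) (use assms in \<open>auto split: if_splits\<close>)
  also have "\<dots> = (\<Sum>x\<in>S. \<Sum>y\<in>T. if x \<otimes> y = z then f x * g y else 0)"
    by (simp add: sum.cartesian_product)
  finally show ?thesis .
qed

lemma single_closed: "x \<in> carrier G \<Longrightarrow> single x \<in> carrier Z"
  by (simp add: monoid_ring_carrier single_def)

lemma single_mult: "single x \<otimes>\<^bsub>Z\<^esub> single y = single (x \<otimes> y)"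
proof
  fix z
  show "(single x \<otimes>\<^bsub>Z\<^esub> single y) z = single (x \<otimes> y) z"
    by (subst monoid_ring_mult_superset[of "{x}" _ "{y}"]) (auto simp: single_def)
qed

lemma monoid_ring_induct [consumes 1, case_names zero add neg single]:
  assumes f: "f \<in> carrier Z" and "Q (\<lambda>_. 0)"
    and add: "\<And>f g. f \<in> carrier Z \<Longrightarrow> g \<in> carrier Z \<Longrightarrow> Q f \<Longrightarrow> Q g \<Longrightarrow> Q (\<lambda>x. f x + g x)"
    and neg: "\<And>f. f \<in> carrier Z \<Longrightarrow> Q f \<Longrightarrow> Q (\<lambda>x. - f x)"
    and single: "\<And>x. x \<in> carrier G \<Longrightarrow> Q (single x)"
  shows "Q f"
proof -
  have nat: "Q (\<lambda>y. int n * single x y) \<and> (\<lambda>y. int n * single x y) \<in> carrier Z" if x: "x \<in> carrier G" for n x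
  proof (induction n)
    case 0 then show ?case using assms(2) by (simp add: monoid_ring_carrier)
  next
    case (Suc n)
    have "(\<lambda>y. int (Suc n) * single x y) = (\<lambda>y. int n * single x y + single x y)"
      by (auto simp: algebra_simps)
    moreover have "(\<lambda>y. int (Suc n) * single x y) \<in> carrier Z"
      using x by (simp add: monoid_ring_carrier single_def)
    ultimately show ?case using add[OF _ single_closed[OF x]] single[OF x] Suc by auto
  qed
  have int: "Q (\<lambda>y. c * single x y)" if x: "x \<in> carrier G" for c x
  proof (cases "c \<ge> 0")
    case True then show ?thesis using nat[OF x, of "nat c"] by simp
  next
    case False
    then have "(\<lambda>y. c * single x y) = (\<lambda>y. - (int (nat (- c)) * single x y))" by simp
    then show ?thesis using neg nat[OF x, of "nat (- c)"] by simp
  qed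
  have "finite S \<Longrightarrow> \<forall>f\<in>carrier Z. {x. f x \<noteq> 0} \<subseteq> S \<longrightarrow> Q f" for S
  proof (induction S rule: finite_induct)
    case empty
    have "f = (\<lambda>_. 0)" if "{x. f x \<noteq> 0} \<subseteq> {}" for f :: "'a \<Rightarrow> int" using that by auto
    then show ?case using assms(2) by metis
  next
    case (insert x S)
    show ?case
    proof (intro ballI impI)
      fix f assume f: "f \<in> carrier Z" "{x. f x \<noteq> 0} \<subseteq> insert x S"
      show "Q f"
      proof (cases "f x = 0")
        case True then show ?thesis using f insert.IH by auto
      next
        case False
        then have x: "x \<in> carrier G" using f(1) by (auto simp: monoid_ring_carrier)
        let ?g = "f(x := 0)" and ?h = "\<lambda>y. f x * single x y"
        have "{y. ?g y \<noteq> 0} \<subseteq> {y. f y \<noteq> 0}" by auto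
        then have g: "?g \<in> carrier Z" using f(1) unfolding monoid_ring_carrier by (meson finite_subset order_trans)
        have h: "?h \<in> carrier Z" using x by (auto simp: monoid_ring_carrier single_def)
        have "{y. ?g y \<noteq> 0} \<subseteq> S" using f(2) by auto
        then have "Q ?g" using insert.IH g by blast
        moreover have "f = (\<lambda>y. ?g y + ?h y)" by (auto simp: single_def)
        ultimately show ?thesis using add[OF g h _ int[OF x]] by metis
      qed
    qed
  qed
  then show ?thesis using f by (auto simp: monoid_ring_carrier)
qed

lemma monoid_ring_add_closed:
  assumes "f \<in> carrier Z" "g \<in> carrier Z" shows "(\<lambda>x. f x + g x) \<in> carrier Z"
proof -
  have "{x. f x + g x \<noteq> 0} \<subseteq> {x. f x \<noteq> 0} \<union> {x. g x \<noteq> 0}" by auto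
  then show ?thesis using assms unfolding monoid_ring_carrier
    by (meson finite_UnI finite_subset le_sup_iff order_trans)
qed

lemma monoid_ring_neg_closed: "f \<in> carrier Z \<Longrightarrow> (\<lambda>x. - f x) \<in> carrier Z"
  by (simp add: monoid_ring_carrier)

lemma monoid_ring_mult_closed:
  assumes "f \<in> carrier Z" "g \<in> carrier Z" shows "f \<otimes>\<^bsub>Z\<^esub> g \<in> carrier Z"
proof -
  let ?S = "{x. f x \<noteq> 0}" and ?T = "{x. g x \<noteq> 0}"
  have fin: "finite ?S" "finite ?T" "?S \<subseteq> carrier G" "?T \<subseteq> carrier G"
    using assms by (auto simp: monoid_ring_carrier)
  have "{z. (f \<otimes>\<^bsub>Z\<^esub> g) z \<noteq> 0} \<subseteq> (\<lambda>(x, y). x \<otimes> y) ` (?S \<times> ?T)"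
  proof
    fix z assume z: "z \<in> {z. (f \<otimes>\<^bsub>Z\<^esub> g) z \<noteq> 0}"
    show "z \<in> (\<lambda>(x, y). x \<otimes> y) ` (?S \<times> ?T)"
    proof (rule ccontr)
      assume "z \<notin> (\<lambda>(x, y). x \<otimes> y) ` (?S \<times> ?T)"
      then have "(f \<otimes>\<^bsub>Z\<^esub> g) z = 0"
        by (subst monoid_ring_mult_superset[OF fin(1) _ fin(2)]) (auto intro!: sum.neutral)
      then show False using z by simp
    qed
  qed
  moreover have "(\<lambda>(x, y). x \<otimes> y) ` (?S \<times> ?T) \<subseteq> carrier G" using fin by auto
  ultimately show ?thesis unfolding monoid_ring_carrier
    using fin(1,2) by (meson finite_SigmaI finite_imageI finite_subset order_trans)
qed

lemma monoid_ring_distrib: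
  assumes "f \<in> carrier Z" "g \<in> carrier Z" "e \<in> carrier Z"
  shows "(\<lambda>x. f x + g x) \<otimes>\<^bsub>Z\<^esub> e = (\<lambda>x. (f \<otimes>\<^bsub>Z\<^esub> e) x + (g \<otimes>\<^bsub>Z\<^esub> e) x)"
proof
  fix z
  let ?S = "{x. f x \<noteq> 0} \<union> {x. g x \<noteq> 0}" and ?T = "{x. e x \<noteq> 0}"
  have fin: "finite ?S" "finite ?T" using assms by (auto simp: monoid_ring_carrier)
  have "((\<lambda>x. f x + g x) \<otimes>\<^bsub>Z\<^esub> e) z = (\<Sum>x\<in>?S. \<Sum>y\<in>?T. if x \<otimes> y = z then (f x + g x) * e y else 0)"
    by (rule monoid_ring_mult_superset[OF fin(1) _ fin(2)]) auto
  also have "\<dots> = (\<Sum>x\<in>?S. \<Sum>y\<in>?T. (if x \<otimes> y = z then f x * e y else 0) + (if x \<otimes> y = z then g x * e y else 0))"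
    by (intro sum.cong refl) (simp add: algebra_simps)
  also have "\<dots> = (f \<otimes>\<^bsub>Z\<^esub> e) z + (g \<otimes>\<^bsub>Z\<^esub> e) z"
    using monoid_ring_mult_superset[OF fin(1) _ fin(2), of f e z] monoid_ring_mult_superset[OF fin(1) _ fin(2), of g e z]
    by (simp add: sum.distrib)
  finally show "((\<lambda>x. f x + g x) \<otimes>\<^bsub>Z\<^esub> e) z = (f \<otimes>\<^bsub>Z\<^esub> e) z + (g \<otimes>\<^bsub>Z\<^esub> e) z" .
qed

lemma monoid_ring_neg_mult:
  assumes "f \<in> carrier Z" "e \<in> carrier Z"
  shows "(\<lambda>x. - f x) \<otimes>\<^bsub>Z\<^esub> e = (\<lambda>x. - (f \<otimes>\<^bsub>Z\<^esub> e) x)"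
proof
  fix z
  let ?S = "{x. f x \<noteq> 0}" and ?T = "{x. e x \<noteq> 0}"
  have fin: "finite ?S" "finite ?T" using assms by (auto simp: monoid_ring_carrier)
  have "((\<lambda>x. - f x) \<otimes>\<^bsub>Z\<^esub> e) z = (\<Sum>x\<in>?S. \<Sum>y\<in>?T. if x \<otimes> y = z then - f x * e y else 0)"
    by (rule monoid_ring_mult_superset[OF fin(1) _ fin(2)]) auto
  also have "\<dots> = (\<Sum>x\<in>?S. \<Sum>y\<in>?T. - (if x \<otimes> y = z then f x * e y else 0))"
    by (intro sum.cong refl) simp
  also have "\<dots> = - (f \<otimes>\<^bsub>Z\<^esub> e) z"
    using monoid_ring_mult_superset[OF fin(1) _ fin(2), of f e z] by (simp add: sum_negf)
  finally show "((\<lambda>x. - f x) \<otimes>\<^bsub>Z\<^esub> e) z = - (f \<otimes>\<^bsub>Z\<^esub> e) z" .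
qed

lemma monoid_ring_zero_mult: "(\<lambda>_. 0) \<otimes>\<^bsub>Z\<^esub> e = (\<lambda>_. 0)"
  by (simp add: monoid_ring_def)

lemma monoid_ring_comm:
  assumes "f \<in> carrier Z" "g \<in> carrier Z" shows "f \<otimes>\<^bsub>Z\<^esub> g = g \<otimes>\<^bsub>Z\<^esub> f"
proof
  fix z
  let ?S = "{x. f x \<noteq> 0}" and ?T = "{x. g x \<noteq> 0}"
  have fin: "finite ?S" "finite ?T" "?S \<subseteq> carrier G" "?T \<subseteq> carrier G"
    using assms by (auto simp: monoid_ring_carrier)
  have "(f \<otimes>\<^bsub>Z\<^esub> g) z = (\<Sum>x\<in>?S. \<Sum>y\<in>?T. if x \<otimes> y = z then f x * g y else 0)"
    by (rule monoid_ring_mult_superset[OF fin(1) _ fin(2)]) auto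
  also have "\<dots> = (\<Sum>y\<in>?T. \<Sum>x\<in>?S. if x \<otimes> y = z then f x * g y else 0)" by (rule sum.swap)
  also have "\<dots> = (\<Sum>y\<in>?T. \<Sum>x\<in>?S. if y \<otimes> x = z then g y * f x else 0)"
  proof (intro sum.cong refl)
    fix x y assume "x \<in> ?S" "y \<in> ?T"
    then have "x \<otimes> y = y \<otimes> x" using fin by (intro m_comm) auto
    then show "(if x \<otimes> y = z then f x * g y else 0) = (if y \<otimes> x = z then g y * f x else 0)" by simp
  qed
  also have "\<dots> = (g \<otimes>\<^bsub>Z\<^esub> f) z"
    by (rule monoid_ring_mult_superset[OF fin(2) _ fin(1), symmetric]) auto
  finally show "(f \<otimes>\<^bsub>Z\<^esub> g) z = (g \<otimes>\<^bsub>Z\<^esub> f) z" .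
qed

lemma monoid_ring_assoc:
  assumes f: "f \<in> carrier Z" and g: "g \<in> carrier Z" and e: "e \<in> carrier Z"
  shows "f \<otimes>\<^bsub>Z\<^esub> g \<otimes>\<^bsub>Z\<^esub> e = f \<otimes>\<^bsub>Z\<^esub> (g \<otimes>\<^bsub>Z\<^esub> e)"
proof -
  have dr: "u \<otimes>\<^bsub>Z\<^esub> (\<lambda>x. v x + w x) = (\<lambda>x. (u \<otimes>\<^bsub>Z\<^esub> v) x + (u \<otimes>\<^bsub>Z\<^esub> w) x)"
    if "u \<in> carrier Z" "v \<in> carrier Z" "w \<in> carrier Z" for u v w
    using that by (simp add: monoid_ring_comm[of u] monoid_ring_distrib monoid_ring_add_closed)
  have nr: "u \<otimes>\<^bsub>Z\<^esub> (\<lambda>x. - v x) = (\<lambda>x. - (u \<otimes>\<^bsub>Z\<^esub> v) x)"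
    if "u \<in> carrier Z" "v \<in> carrier Z" for u v
    using that by (simp add: monoid_ring_comm[of u] monoid_ring_neg_mult monoid_ring_neg_closed)
  have z: "(\<lambda>_. 0) \<in> carrier Z" by (simp add: monoid_ring_carrier)
  have zr: "u \<otimes>\<^bsub>Z\<^esub> (\<lambda>_. 0) = (\<lambda>_. 0)" if "u \<in> carrier Z" for u
    using that z by (simp add: monoid_ring_comm[of u] monoid_ring_zero_mult)
  note cl = monoid_ring_add_closed monoid_ring_neg_closed monoid_ring_mult_closed single_closed
  note laws = dr nr zr monoid_ring_distrib monoid_ring_neg_mult monoid_ring_zero_mult
  have ss: "single x \<otimes>\<^bsub>Z\<^esub> single y \<otimes>\<^bsub>Z\<^esub> e = single x \<otimes>\<^bsub>Z\<^esub> (single y \<otimes>\<^bsub>Z\<^esub> e)"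
    if x: "x \<in> carrier G" and y: "y \<in> carrier G" for x y
    using e
  proof (induction rule: monoid_ring_induct)
    case (single w) then show ?case using x y by (simp add: single_mult m_assoc)
  qed (use x y in \<open>simp_all add: laws cl\<close>)
  have s: "single x \<otimes>\<^bsub>Z\<^esub> g \<otimes>\<^bsub>Z\<^esub> e = single x \<otimes>\<^bsub>Z\<^esub> (g \<otimes>\<^bsub>Z\<^esub> e)" if x: "x \<in> carrier G" for x
    using g
  proof (induction rule: monoid_ring_induct)
    case (single y) then show ?case using ss[OF x] by simp
  qed (use x e in \<open>simp_all add: laws cl\<close>)
  from f show ?thesis
  proof (induction rule: monoid_ring_induct)
    case (single x) then show ?case using s by simp
  qed (use g e in \<open>simp_all add: laws cl\<close>)
qed

lemma monoid_ring_is_cring: "cring Z"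
proof (rule cringI)
  show "abelian_group Z"
  proof (rule abelian_groupI)
    fix f assume "f \<in> carrier Z"
    then show "\<exists>g\<in>carrier Z. g \<oplus>\<^bsub>Z\<^esub> f = \<zero>\<^bsub>Z\<^esub>"
      using monoid_ring_neg_closed by (intro bexI[of _ "\<lambda>x. - f x"]) (auto simp: monoid_ring_simps)
  qed (auto simp: monoid_ring_simps monoid_ring_add_closed algebra_simps, simp add: monoid_ring_carrier)
  show "comm_monoid Z"
  proof (rule comm_monoidI)
    show "\<one>\<^bsub>Z\<^esub> \<in> carrier Z" using single_closed by (simp add: monoid_ring_simps)
    fix f assume "f \<in> carrier Z"
    then have "f \<otimes>\<^bsub>Z\<^esub> single \<one> = f"
    proof (induction rule: monoid_ring_induct)
      case (single x) then show ?case by (simp add: single_mult)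
    qed (simp_all add: single_closed monoid_ring_distrib monoid_ring_neg_mult monoid_ring_zero_mult)
    then show "\<one>\<^bsub>Z\<^esub> \<otimes>\<^bsub>Z\<^esub> f = f"
      using \<open>f \<in> carrier Z\<close> by (simp add: monoid_ring_simps single_closed monoid_ring_comm[of _ f])
  qed (simp_all add: monoid_ring_mult_closed monoid_ring_assoc, rule monoid_ring_comm)
qed (simp add: monoid_ring_simps monoid_ring_distrib)

end


subsection \<open>Additive functionals on monoid rings\<close>

context abelian_group
begin

text \<open>The monoid ring is the free abelian group on the monoid, so every function \<open>h\<close> extends additively.\<close>

definition extend_additive :: "('g \<Rightarrow> 'a) \<Rightarrow> ('g \<Rightarrow> int) \<Rightarrow> 'a"
  where "extend_additive h f = (\<Oplus>x\<in>{x. f x \<noteq> 0}. add_pow G (f x) (h x))"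

lemma extend_additive_superset:
  assumes h: "\<And>x. x \<in> S \<Longrightarrow> h x \<in> carrier G" and S: "finite S" "{x. f x \<noteq> 0} \<subseteq> S"
  shows "extend_additive h f = (\<Oplus>x\<in>S. add_pow G (f x) (h x))"
  unfolding extend_additive_def
proof (rule add.finprod_mono_neutral_cong_left[OF S])
  show "add_pow G (f i) (h i) = \<zero>" if "i \<in> S - {x. f x \<noteq> 0}" for i
    using that by (simp add: add_pow_def)
  show "(\<lambda>x. add_pow G (f x) (h x)) \<in> S \<rightarrow> carrier G" using h add.int_pow_closed by simp
qed simp

lemma extend_additive_add:
  assumes h: "\<And>x. x \<in> C \<Longrightarrow> h x \<in> carrier G"
    and f: "finite {x. f x \<noteq> 0}" "{x. f x \<noteq> 0} \<subseteq> C" and g: "finite {x. g x \<noteq> 0}" "{x. g x \<noteq> 0} \<subseteq> C"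
  shows "extend_additive h (\<lambda>x. f x + g x) = extend_additive h f \<oplus> extend_additive h g"
proof -
  let ?S = "{x. f x \<noteq> 0} \<union> {x. g x \<noteq> 0}"
  have S: "finite ?S" using f g by simp
  have hS: "h x \<in> carrier G" if "x \<in> ?S" for x using that h f g by blast
  have "extend_additive h (\<lambda>x. f x + g x) = (\<Oplus>x\<in>?S. add_pow G (f x + g x) (h x))"
    by (rule extend_additive_superset) (use hS S in auto)
  also have "\<dots> = (\<Oplus>x\<in>?S. add_pow G (f x) (h x) \<oplus> add_pow G (g x) (h x))"
    using hS by (intro finsum_cong') (auto simp: add.int_pow_mult)
  also have "\<dots> = (\<Oplus>x\<in>?S. add_pow G (f x) (h x)) \<oplus> (\<Oplus>x\<in>?S. add_pow G (g x) (h x))"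
    using hS by (intro finsum_addf) auto
  also have "(\<Oplus>x\<in>?S. add_pow G (f x) (h x)) = extend_additive h f"
    by (rule extend_additive_superset[symmetric]) (use hS S in auto)
  also have "(\<Oplus>x\<in>?S. add_pow G (g x) (h x)) = extend_additive h g"
    by (rule extend_additive_superset[symmetric]) (use hS S in auto)
  finally show ?thesis .
qed

lemma extend_additive_closed:
  assumes "\<And>x. x \<in> C \<Longrightarrow> h x \<in> carrier G" "{x. f x \<noteq> 0} \<subseteq> C"
  shows "extend_additive h f \<in> carrier G"
proof -
  have "h x \<in> carrier G" if "f x \<noteq> 0" for x using assms that by blast
  then show ?thesis unfolding extend_additive_def by (intro finsum_closed) auto
qed

lemma extend_additive_zero: "extend_additive h (\<lambda>_. 0) = \<zero>"
  by (simp add: extend_additive_def)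

lemma extend_additive_neg:
  assumes h: "\<And>x. x \<in> C \<Longrightarrow> h x \<in> carrier G" and f: "finite {x. f x \<noteq> 0}" "{x. f x \<noteq> 0} \<subseteq> C"
  shows "extend_additive h (\<lambda>x. - f x) = \<ominus> extend_additive h f"
proof -
  have "extend_additive h (\<lambda>x. - f x) \<oplus> extend_additive h f = extend_additive h (\<lambda>x. - f x + f x)"
    by (rule extend_additive_add[symmetric, of C]) (use h f in auto)
  also have "\<dots> = \<zero>" by (simp add: extend_additive_zero)
  finally have sum: "extend_additive h (\<lambda>x. - f x) \<oplus> extend_additive h f = \<zero>" .
  have "extend_additive h f \<in> carrier G" by (rule extend_additive_closed[OF h f(2)])
  moreover have "extend_additive h (\<lambda>x. - f x) \<in> carrier G"
    by (rule extend_additive_closed[of C]) (use h f in auto)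
  ultimately show ?thesis using minus_equality[OF sum] by simp
qed

lemma extend_additive_single:
  assumes "h x \<in> carrier G" shows "extend_additive h (single x) = h x"
  using extend_additive_superset[of "{x}" h "single x"] assms by (auto simp: single_def)

end

subsection \<open>Tensor products of algebras\<close>

locale algebra_pair = A: cring A + B: cring B
  for R :: "('r, 'm) ring_scheme" and \<phi> :: "'r \<Rightarrow> 'a" and A :: "('a, 'n) ring_scheme"
    and \<psi> :: "'r \<Rightarrow> 'b" and B :: "('b, 'l) ring_scheme" +
  assumes \<phi>_closed: "r \<in> carrier R \<Longrightarrow> \<phi> r \<in> carrier A"
    and \<psi>_closed: "r \<in> carrier R \<Longrightarrow> \<psi> r \<in> carrier B"
begin

sublocale P: comm_monoid "A \<times>\<times> B"
  using A.monoid_axioms B.monoid_axioms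
  by (intro monoid.monoid_comm_monoidI DirProd_monoid) (auto simp: DirProd_def A.m_comm B.m_comm)

abbreviation "Z \<equiv> monoid_ring (A \<times>\<times> B)"
abbreviation "T \<equiv> tensor_ring R \<phi> A \<psi> B"
abbreviation "I \<equiv> tensor_ideal R \<phi> A \<psi> B"
abbreviation "t \<equiv> \<lambda>a b. tensor_class R \<phi> A \<psi> B (single (a, b))"

sublocale Z: cring Z by (rule P.monoid_ring_is_cring)

definition gens :: "('a \<times> 'b \<Rightarrow> int) set"
  where "gens =
        ({single (a \<oplus>\<^bsub>A\<^esub> a', b) \<ominus>\<^bsub>Z\<^esub> (single (a, b) \<oplus>\<^bsub>Z\<^esub> single (a', b)) | a a' b.
            a \<in> carrier A \<and> a' \<in> carrier A \<and> b \<in> carrier B} \<union>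
         {single (a, b \<oplus>\<^bsub>B\<^esub> b') \<ominus>\<^bsub>Z\<^esub> (single (a, b) \<oplus>\<^bsub>Z\<^esub> single (a, b')) | a b b'.
            a \<in> carrier A \<and> b \<in> carrier B \<and> b' \<in> carrier B} \<union>
         {single (\<phi> r \<otimes>\<^bsub>A\<^esub> a, b) \<ominus>\<^bsub>Z\<^esub> single (a, \<psi> r \<otimes>\<^bsub>B\<^esub> b) | r a b.
            r \<in> carrier R \<and> a \<in> carrier A \<and> b \<in> carrier B})"

lemma tensor_ideal_gens: "I = Idl\<^bsub>Z\<^esub> gens"
  unfolding tensor_ideal_def gens_def Let_def ..

lemma single_in_Z: "a \<in> carrier A \<Longrightarrow> b \<in> carrier B \<Longrightarrow> single (a, b) \<in> carrier Z"
  by (rule P.single_closed) (simp add: DirProd_def)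

lemma gens_closed: "gens \<subseteq> carrier Z"
  unfolding gens_def using \<phi>_closed \<psi>_closed
  by (auto intro!: Z.minus_closed Z.a_closed single_in_Z)

lemma ideal_I: "ideal I Z"
  unfolding tensor_ideal_gens by (rule Z.genideal_ideal[OF gens_closed])

sublocale T: cring T
  unfolding tensor_ring_def by (rule ideal.quotient_is_cring[OF ideal_I Z.is_cring])

lemma class_hom: "tensor_class R \<phi> A \<psi> B \<in> ring_hom Z T"
proof -
  have "tensor_class R \<phi> A \<psi> B = (+>\<^bsub>Z\<^esub>) I" by (auto simp: tensor_class_def)
  then show ?thesis unfolding tensor_ring_def using ideal.rcos_ring_hom[OF ideal_I] by simp
qed

lemmas class_closed = ring_hom_closed[OF class_hom]
lemmas class_mult = ring_hom_mult[OF class_hom]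
lemmas class_add = ring_hom_add[OF class_hom]

lemma class_eq_iff:
  assumes "f \<in> carrier Z" "g \<in> carrier Z"
  shows "tensor_class R \<phi> A \<psi> B f = tensor_class R \<phi> A \<psi> B g \<longleftrightarrow> f \<ominus>\<^bsub>Z\<^esub> g \<in> I"
  unfolding tensor_class_def using Z.quotient_eq_iff_same_a_r_cos[OF ideal_I assms] by simp

lemma gen_in_I: "x \<in> gens \<Longrightarrow> x \<in> I"
  unfolding tensor_ideal_gens using Z.genideal_self[OF gens_closed] by blast

lemma t_closed: "a \<in> carrier A \<Longrightarrow> b \<in> carrier B \<Longrightarrow> t a b \<in> carrier T"
  by (intro class_closed single_in_Z)

lemma t_mult:
  assumes "a \<in> carrier A" "b \<in> carrier B" "a' \<in> carrier A" "b' \<in> carrier B"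
  shows "t a b \<otimes>\<^bsub>T\<^esub> t a' b' = t (a \<otimes>\<^bsub>A\<^esub> a') (b \<otimes>\<^bsub>B\<^esub> b')"
  using class_mult[OF single_in_Z[OF assms(1,2)] single_in_Z[OF assms(3,4)]]
  by (simp add: P.single_mult)

lemma t_one: "t \<one>\<^bsub>A\<^esub> \<one>\<^bsub>B\<^esub> = \<one>\<^bsub>T\<^esub>"
  using ring_hom_one[OF class_hom] by (simp add: P.monoid_ring_simps)

lemma t_add_left:
  assumes "a \<in> carrier A" "a' \<in> carrier A" "b \<in> carrier B"
  shows "t (a \<oplus>\<^bsub>A\<^esub> a') b = t a b \<oplus>\<^bsub>T\<^esub> t a' b"
proof -
  have "single (a \<oplus>\<^bsub>A\<^esub> a', b) \<ominus>\<^bsub>Z\<^esub> (single (a, b) \<oplus>\<^bsub>Z\<^esub> single (a', b)) \<in> I"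
    using assms by (intro gen_in_I) (auto simp: gens_def)
  then show ?thesis
    using assms class_eq_iff[of "single (a \<oplus>\<^bsub>A\<^esub> a', b)" "single (a, b) \<oplus>\<^bsub>Z\<^esub> single (a', b)"]
    by (simp add: class_add single_in_Z)
qed

lemma t_balanced:
  assumes "r \<in> carrier R" "a \<in> carrier A" "b \<in> carrier B"
  shows "t (\<phi> r \<otimes>\<^bsub>A\<^esub> a) b = t a (\<psi> r \<otimes>\<^bsub>B\<^esub> b)"
proof -
  have "single (\<phi> r \<otimes>\<^bsub>A\<^esub> a, b) \<ominus>\<^bsub>Z\<^esub> single (a, \<psi> r \<otimes>\<^bsub>B\<^esub> b) \<in> I"
    using assms by (intro gen_in_I) (auto simp: gens_def)
  then show ?thesis
    using assms class_eq_iff[of "single (\<phi> r \<otimes>\<^bsub>A\<^esub> a, b)" "single (a, \<psi> r \<otimes>\<^bsub>B\<^esub> b)"] \<phi>_closed \<psi>_closed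
    by (simp add: single_in_Z)
qed

lemma t_zero_left:
  assumes "b \<in> carrier B" shows "t \<zero>\<^bsub>A\<^esub> b = \<zero>\<^bsub>T\<^esub>"
proof -
  have "t \<zero>\<^bsub>A\<^esub> b = t \<zero>\<^bsub>A\<^esub> b \<oplus>\<^bsub>T\<^esub> t \<zero>\<^bsub>A\<^esub> b"
    using t_add_left[of "\<zero>\<^bsub>A\<^esub>" "\<zero>\<^bsub>A\<^esub>" b] assms by simp
  then show ?thesis using t_closed[of "\<zero>\<^bsub>A\<^esub>" b] assms T.add.l_cancel_one' by auto
qed

lemma t_pow:
  assumes "a \<in> carrier A" "b \<in> carrier B"
  shows "t a b [^]\<^bsub>T\<^esub> (n::nat) = t (a [^]\<^bsub>A\<^esub> n) (b [^]\<^bsub>B\<^esub> n)"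
  by (induction n) (use assms in \<open>auto simp: t_one t_mult\<close>)

lemma t_char:
  assumes "add_pow A p \<one>\<^bsub>A\<^esub> = \<zero>\<^bsub>A\<^esub>" shows "add_pow T (p::nat) \<one>\<^bsub>T\<^esub> = \<zero>\<^bsub>T\<^esub>"
proof -
  have "add_pow T n \<one>\<^bsub>T\<^esub> = t (add_pow A n \<one>\<^bsub>A\<^esub>) \<one>\<^bsub>B\<^esub>" for n :: nat
    by (induction n) (simp_all add: t_zero_left t_add_left t_one[symmetric])
  then show ?thesis using assms t_zero_left by simp
qed

text \<open>The map \<open>(a, b) \<mapsto> \<psi>(l a) b\<close> is biadditive and balanced, hence its additive extension kills the
  generators of the tensor ideal. To get from the generators to the ideal, one considers the elements \<open>f\<close> all
  of whose multiples \<open>y f\<close>, for \<open>y = (a', b')\<close>, are killed: they form an ideal \<open>J\<close>, and the generators still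
  lie in it. Here \<open>h y\<close> is the map composed with multiplication by \<open>y\<close>.\<close>

lemma tensor_ideal_functional:
  assumes R: "cring R" and \<psi>: "\<psi> \<in> ring_hom R B"
    and l: "l \<in> carrier A \<rightarrow> carrier R"
      "\<And>a a'. a \<in> carrier A \<Longrightarrow> a' \<in> carrier A \<Longrightarrow> l (a \<oplus>\<^bsub>A\<^esub> a') = l a \<oplus>\<^bsub>R\<^esub> l a'"
      "\<And>r a. r \<in> carrier R \<Longrightarrow> a \<in> carrier A \<Longrightarrow> l (\<phi> r \<otimes>\<^bsub>A\<^esub> a) = r \<otimes>\<^bsub>R\<^esub> l a"
    and f: "f \<in> I"
  shows "B.extend_additive (\<lambda>(a, b). \<psi> (l a) \<otimes>\<^bsub>B\<^esub> b) f = \<zero>\<^bsub>B\<^esub>"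
proof -
  interpret R: cring R by (rule R)
  let ?C = "carrier (A \<times>\<times> B)"
  define h where "h = (\<lambda>(a', b'). \<lambda>(a, b). \<psi> (l (a' \<otimes>\<^bsub>A\<^esub> a)) \<otimes>\<^bsub>B\<^esub> (b' \<otimes>\<^bsub>B\<^esub> b))"
  note ea = B.extend_additive_def
  have lc: "l a \<in> carrier R" if "a \<in> carrier A" for a using l(1) that by blast
  have hc: "h y x \<in> carrier B" if "y \<in> ?C" "x \<in> ?C" for x y
    using that lc \<psi>_closed by (auto simp: h_def DirProd_def)
  have hshift: "h y (x \<otimes>\<^bsub>A \<times>\<times> B\<^esub> z) = h (y \<otimes>\<^bsub>A \<times>\<times> B\<^esub> x) z" if "y \<in> ?C" "x \<in> ?C" "z \<in> ?C" for x y z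
    using that by (auto simp: h_def DirProd_def A.m_assoc B.m_assoc)
  define E where "E = (\<lambda>y. B.extend_additive (h y))"
  have Zs: "finite {x. g x \<noteq> 0}" "{x. g x \<noteq> 0} \<subseteq> ?C" if "g \<in> carrier Z" for g
    using that P.monoid_ring_carrier by auto
  have Eadd: "E y (\<lambda>x. f x + g x) = E y f \<oplus>\<^bsub>B\<^esub> E y g" if "y \<in> ?C" "f \<in> carrier Z" "g \<in> carrier Z" for y f g
    unfolding E_def using hc[OF that(1)] Zs[OF that(2)] Zs[OF that(3)]
    by (intro B.extend_additive_add[of ?C]) auto
  have Eneg: "E y (\<lambda>x. - f x) = \<ominus>\<^bsub>B\<^esub> E y f" if "y \<in> ?C" "f \<in> carrier Z" for y f
    unfolding E_def using hc[OF that(1)] Zs[OF that(2)] by (intro B.extend_additive_neg[of ?C]) auto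
  have Esingle: "E y (single x) = h y x" if "y \<in> ?C" "x \<in> ?C" for x y
    unfolding E_def using hc[OF that] by (rule B.extend_additive_single)
  have E0: "E y (\<lambda>_. 0) = \<zero>\<^bsub>B\<^esub>" for y unfolding E_def by (rule B.extend_additive_zero)
  have neg: "\<ominus>\<^bsub>Z\<^esub> g = (\<lambda>x. - g x)" if "g \<in> carrier Z" for g
    using that by (intro Z.minus_equality) (auto simp: P.monoid_ring_simps P.monoid_ring_neg_closed)
  define J where "J = {f \<in> carrier Z. \<forall>y\<in>?C. E y f = \<zero>\<^bsub>B\<^esub>}"
  have Eshift: "E y (single x \<otimes>\<^bsub>Z\<^esub> f) = E (y \<otimes>\<^bsub>A \<times>\<times> B\<^esub> x) f"
    if y: "y \<in> ?C" and x: "x \<in> ?C" and f: "f \<in> carrier Z" for x y f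
  proof -
   note sx = P.single_closed[OF x]
   note yx = P.m_closed[OF y x]
   from f show ?thesis
   proof (induction rule: P.monoid_ring_induct)
    case zero
    have "single x \<otimes>\<^bsub>Z\<^esub> (\<lambda>_. 0) = (\<lambda>_. 0)"
      using Z.r_null[OF P.single_closed[OF x]] by (simp add: P.monoid_ring_simps)
    then show ?case by (simp add: E0)
  next
    case (add f g)
    have "single x \<otimes>\<^bsub>Z\<^esub> (\<lambda>x. f x + g x) = (\<lambda>z. (single x \<otimes>\<^bsub>Z\<^esub> f) z + (single x \<otimes>\<^bsub>Z\<^esub> g) z)"
      using Z.r_distr[OF add(1,2) P.single_closed[OF x]] by (simp add: P.monoid_ring_simps)
    then show ?case
      using Eadd[OF y Z.m_closed[OF sx add(1)] Z.m_closed[OF sx add(2)]] Eadd[OF yx add(1,2)] add.IH by simp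
  next
    case (neg f)
    have "single x \<otimes>\<^bsub>Z\<^esub> (\<lambda>x. - f x) = (\<lambda>z. - (single x \<otimes>\<^bsub>Z\<^esub> f) z)"
      using P.monoid_ring_neg_mult[OF neg(1) P.single_closed[OF x]] P.monoid_ring_neg_closed[OF neg(1)]
        Z.m_comm[OF P.single_closed[OF x]] neg(1) by metis
    then show ?case using Eneg[OF y Z.m_closed[OF sx neg(1)]] Eneg[OF yx neg(1)] neg.IH by simp
  next
    case (single z)
    then show ?case
      using Esingle[OF y P.m_closed[OF x single]] Esingle[OF yx single] hshift[OF y x single]
      by (simp add: P.single_mult)
   qed
  qed
  have Jmult: "g \<otimes>\<^bsub>Z\<^esub> f \<in> J" if f: "f \<in> J" and g: "g \<in> carrier Z" for f g
  proof -
    have fZ: "f \<in> carrier Z" and f0: "\<And>y. y \<in> ?C \<Longrightarrow> E y f = \<zero>\<^bsub>B\<^esub>" using f by (auto simp: J_def)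
    have "E y (g \<otimes>\<^bsub>Z\<^esub> f) = \<zero>\<^bsub>B\<^esub>" if y: "y \<in> ?C" for y
      using g
    proof (induction rule: P.monoid_ring_induct)
      case zero then show ?case by (simp add: P.monoid_ring_zero_mult E0)
    next
      case (add u v) then show ?case
        using fZ Eadd[OF y Z.m_closed[OF add(1) fZ] Z.m_closed[OF add(2) fZ]] by (simp add: P.monoid_ring_distrib)
    next
      case (neg u) then show ?case
        using fZ Eneg[OF y Z.m_closed[OF neg(1) fZ]] by (simp add: P.monoid_ring_neg_mult)
    next
      case (single x) then show ?case using Eshift[OF y single fZ] f0[OF P.m_closed[OF y single]] by simp
    qed
    then show ?thesis using fZ g by (simp add: J_def)
  qed
  have "ideal J Z"
  proof (rule idealI)
    show "ring Z" by (rule Z.ring_axioms)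
    show "subgroup J (add_monoid Z)"
    proof (rule Z.add.subgroupI)
      show "J \<subseteq> carrier Z" by (auto simp: J_def)
      show "J \<noteq> {}" using Z.zero_closed E0 by (auto simp: J_def P.monoid_ring_simps)
      fix a assume a: "a \<in> J"
      then show "\<ominus>\<^bsub>Z\<^esub> a \<in> J"
        using neg[of a] Eneg P.monoid_ring_neg_closed by (simp add: J_def)
      fix b assume "b \<in> J"
      then show "a \<oplus>\<^bsub>Z\<^esub> b \<in> J" using a Eadd P.monoid_ring_add_closed by (simp add: J_def P.monoid_ring_simps)
    qed
    fix a x assume "a \<in> J" "x \<in> carrier Z"
    then show "x \<otimes>\<^bsub>Z\<^esub> a \<in> J" "a \<otimes>\<^bsub>Z\<^esub> x \<in> J"
      using Jmult[of a x] Z.m_comm[of a x] by (auto simp: J_def)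
  qed
  moreover have "gens \<subseteq> J"
  proof
    fix g assume g: "g \<in> gens"
    have Eminus: "E y (u \<ominus>\<^bsub>Z\<^esub> v) = E y u \<ominus>\<^bsub>B\<^esub> E y v" if "y \<in> ?C" "u \<in> carrier Z" "v \<in> carrier Z" for y u v
      using Eadd[OF that(1,2) P.monoid_ring_neg_closed[OF that(3)]] Eneg[OF that(1,3)] neg[OF that(3)]
      by (simp add: a_minus_def P.monoid_ring_simps)
    have Eplus: "E y (u \<oplus>\<^bsub>Z\<^esub> v) = E y u \<oplus>\<^bsub>B\<^esub> E y v" if "y \<in> ?C" "u \<in> carrier Z" "v \<in> carrier Z" for y u v
      using that by (simp add: P.monoid_ring_simps Eadd)
    have h_eq: "h (a', b') (a, b) = \<psi> (l (a' \<otimes>\<^bsub>A\<^esub> a)) \<otimes>\<^bsub>B\<^esub> (b' \<otimes>\<^bsub>B\<^esub> b)" for a' b' a b by (simp add: h_def)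
    have C: "(a, b) \<in> ?C \<longleftrightarrow> a \<in> carrier A \<and> b \<in> carrier B" for a b by (simp add: DirProd_def)
    have "E (a', b') g = \<zero>\<^bsub>B\<^esub>" if y: "a' \<in> carrier A" "b' \<in> carrier B" for a' b'
      using g unfolding gens_def
    proof (elim UnE CollectE exE conjE)
      fix a c b assume g: "g = single (a \<oplus>\<^bsub>A\<^esub> c, b) \<ominus>\<^bsub>Z\<^esub> (single (a, b) \<oplus>\<^bsub>Z\<^esub> single (c, b))"
        and m: "a \<in> carrier A" "c \<in> carrier A" "b \<in> carrier B"
      have "\<psi> (l (a' \<otimes>\<^bsub>A\<^esub> (a \<oplus>\<^bsub>A\<^esub> c))) = \<psi> (l (a' \<otimes>\<^bsub>A\<^esub> a)) \<oplus>\<^bsub>B\<^esub> \<psi> (l (a' \<otimes>\<^bsub>A\<^esub> c))"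
        using m y lc by (simp add: A.r_distr l(2) ring_hom_add[OF \<psi>])
      then show ?thesis unfolding g using m y lc \<psi>_closed
        by (simp add: Eminus Eplus Esingle single_in_Z C Z.a_closed h_eq B.l_distr)
    next
      fix a b c assume g: "g = single (a, b \<oplus>\<^bsub>B\<^esub> c) \<ominus>\<^bsub>Z\<^esub> (single (a, b) \<oplus>\<^bsub>Z\<^esub> single (a, c))"
        and m: "a \<in> carrier A" "b \<in> carrier B" "c \<in> carrier B"
      show ?thesis unfolding g using m y lc \<psi>_closed
        by (simp add: Eminus Eplus Esingle single_in_Z C Z.a_closed h_eq B.r_distr)
    next
      fix r a b assume g: "g = single (\<phi> r \<otimes>\<^bsub>A\<^esub> a, b) \<ominus>\<^bsub>Z\<^esub> single (a, \<psi> r \<otimes>\<^bsub>B\<^esub> b)"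
        and m: "r \<in> carrier R" "a \<in> carrier A" "b \<in> carrier B"
      have "a' \<otimes>\<^bsub>A\<^esub> (\<phi> r \<otimes>\<^bsub>A\<^esub> a) = \<phi> r \<otimes>\<^bsub>A\<^esub> (a' \<otimes>\<^bsub>A\<^esub> a)"
        using m y \<phi>_closed by (simp add: A.m_lcomm)
      then have "\<psi> (l (a' \<otimes>\<^bsub>A\<^esub> (\<phi> r \<otimes>\<^bsub>A\<^esub> a))) = \<psi> r \<otimes>\<^bsub>B\<^esub> \<psi> (l (a' \<otimes>\<^bsub>A\<^esub> a))"
        using m y lc by (simp add: l(3) ring_hom_mult[OF \<psi>])
      moreover have "\<psi> (l (a' \<otimes>\<^bsub>A\<^esub> a)) \<in> carrier B" "\<psi> r \<in> carrier B" using m y lc \<psi>_closed by auto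
      then have "\<psi> r \<otimes>\<^bsub>B\<^esub> \<psi> (l (a' \<otimes>\<^bsub>A\<^esub> a)) \<otimes>\<^bsub>B\<^esub> (b' \<otimes>\<^bsub>B\<^esub> b)
          = \<psi> (l (a' \<otimes>\<^bsub>A\<^esub> a)) \<otimes>\<^bsub>B\<^esub> (b' \<otimes>\<^bsub>B\<^esub> (\<psi> r \<otimes>\<^bsub>B\<^esub> b))"
        using m y by (simp add: B.m_ac)
      ultimately show ?thesis unfolding g using m y lc \<phi>_closed \<psi>_closed
        by (simp add: Eminus Esingle single_in_Z C h_eq)
    qed
    then show "g \<in> J" using g gens_closed by (auto simp: J_def DirProd_def)
  qed
  ultimately have "I \<subseteq> J" unfolding tensor_ideal_gens by (rule Z.genideal_minimal)
  then have fJ: "f \<in> J" using f by blast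
  have "(\<one>\<^bsub>A\<^esub>, \<one>\<^bsub>B\<^esub>) \<in> ?C" by (simp add: DirProd_def)
  then have "E (\<one>\<^bsub>A\<^esub>, \<one>\<^bsub>B\<^esub>) f = \<zero>\<^bsub>B\<^esub>" using fJ by (simp add: J_def)
  moreover have "B.extend_additive (\<lambda>(a, b). \<psi> (l a) \<otimes>\<^bsub>B\<^esub> b) f = E (\<one>\<^bsub>A\<^esub>, \<one>\<^bsub>B\<^esub>) f"
    unfolding E_def ea
  proof (intro B.finsum_cong' refl)
    have fc: "x \<in> ?C" if "x \<in> {x. f x \<noteq> 0}" for x using that fJ Zs by (auto simp: J_def)
    show "add_pow B (f x) (case x of (a, b) \<Rightarrow> \<psi> (l a) \<otimes>\<^bsub>B\<^esub> b) = add_pow B (f x) (h (\<one>\<^bsub>A\<^esub>, \<one>\<^bsub>B\<^esub>) x)"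
      if "x \<in> {x. f x \<noteq> 0}" for x
      using fc[OF that] lc \<psi>_closed by (cases x) (auto simp: h_def DirProd_def)
    show "(\<lambda>x. add_pow B (f x) (h (\<one>\<^bsub>A\<^esub>, \<one>\<^bsub>B\<^esub>) x)) \<in> {x. f x \<noteq> 0} \<rightarrow> carrier B"
      using fc hc \<open>(\<one>\<^bsub>A\<^esub>, \<one>\<^bsub>B\<^esub>) \<in> ?C\<close> by auto
  qed
  ultimately show ?thesis by simp
qed

lemma functional_of_tensors_eq:
  assumes R: "cring R" and \<psi>: "\<psi> \<in> ring_hom R B"
    and l: "l \<in> carrier A \<rightarrow> carrier R"
      "\<And>a a'. a \<in> carrier A \<Longrightarrow> a' \<in> carrier A \<Longrightarrow> l (a \<oplus>\<^bsub>A\<^esub> a') = l a \<oplus>\<^bsub>R\<^esub> l a'"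
      "\<And>r a. r \<in> carrier R \<Longrightarrow> a \<in> carrier A \<Longrightarrow> l (\<phi> r \<otimes>\<^bsub>A\<^esub> a) = r \<otimes>\<^bsub>R\<^esub> l a"
    and ab: "a \<in> carrier A" "b \<in> carrier B" "a' \<in> carrier A" "b' \<in> carrier B" and eq: "t a b = t a' b'"
  shows "\<psi> (l a) \<otimes>\<^bsub>B\<^esub> b = \<psi> (l a') \<otimes>\<^bsub>B\<^esub> b'"
proof -
  let ?h = "\<lambda>(a, b). \<psi> (l a) \<otimes>\<^bsub>B\<^esub> b"
  let ?C = "carrier A \<times> carrier B"
  have hc: "?h x \<in> carrier B" if "x \<in> ?C" for x using that l(1) \<psi>_closed by auto
  have sup: "finite {y. single x y \<noteq> 0}" "{y. single x y \<noteq> 0} \<subseteq> {x}" for x :: "'a \<times> 'b"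
    by (auto simp: single_def)
  have "\<ominus>\<^bsub>Z\<^esub> single (a', b') = (\<lambda>x. - single (a', b') x)"
    using single_in_Z[OF ab(3,4)] by (intro Z.minus_equality) (auto simp: P.monoid_ring_simps P.monoid_ring_neg_closed)
  then have diff: "single (a, b) \<ominus>\<^bsub>Z\<^esub> single (a', b') = (\<lambda>x. single (a, b) x + - single (a', b') x)"
    by (simp add: a_minus_def P.monoid_ring_simps)
  have "single (a, b) \<ominus>\<^bsub>Z\<^esub> single (a', b') \<in> I"
    using eq class_eq_iff[OF single_in_Z[OF ab(1,2)] single_in_Z[OF ab(3,4)]] by simp
  from tensor_ideal_functional[OF R \<psi> l this]
  have "\<zero>\<^bsub>B\<^esub> = B.extend_additive ?h (\<lambda>x. single (a, b) x + - single (a', b') x)" unfolding diff by simp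
  also have "\<dots> = B.extend_additive ?h (single (a, b)) \<oplus>\<^bsub>B\<^esub> B.extend_additive ?h (\<lambda>x. - single (a', b') x)"
    by (rule B.extend_additive_add[of ?C]) (use hc sup ab in \<open>auto simp: single_def split: if_splits\<close>)
  also have "B.extend_additive ?h (\<lambda>x. - single (a', b') x) = \<ominus>\<^bsub>B\<^esub> B.extend_additive ?h (single (a', b'))"
    by (rule B.extend_additive_neg[of ?C]) (use hc sup ab in \<open>auto simp: single_def split: if_splits\<close>)
  also have "B.extend_additive ?h (single (a, b)) = \<psi> (l a) \<otimes>\<^bsub>B\<^esub> b"
    using B.extend_additive_single[of ?h "(a, b)"] hc[of "(a, b)"] ab by simp
  also have "B.extend_additive ?h (single (a', b')) = \<psi> (l a') \<otimes>\<^bsub>B\<^esub> b'"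
    using B.extend_additive_single[of ?h "(a', b')"] hc[of "(a', b')"] ab by simp
  finally have "\<psi> (l a) \<otimes>\<^bsub>B\<^esub> b \<ominus>\<^bsub>B\<^esub> \<psi> (l a') \<otimes>\<^bsub>B\<^esub> b' = \<zero>\<^bsub>B\<^esub>" by (simp add: a_minus_def)
  then show ?thesis using hc[of "(a, b)"] hc[of "(a', b')"] ab by simp
qed

end

section \<open>Localizations, linear functionals and roots\<close>

lemma (in cring) proper_ideal_in_prime:
  assumes J: "ideal J R" "\<one> \<notin> J"
  shows "\<exists>Q. primeideal Q R \<and> J \<subseteq> Q"
proof -
  let ?S = "{I. ideal I R \<and> J \<subseteq> I \<and> \<one> \<notin> I}"
  have "\<exists>M\<in>?S. \<forall>W1\<in>?S. M \<subseteq> W1 \<longrightarrow> W1 = M"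
  proof (rule subset_Zorn)
    fix C assume C: "subset.chain ?S C"
    show "\<exists>U\<in>?S. \<forall>W1\<in>C. W1 \<subseteq> U"
    proof (cases "C = {}")
      case True then show ?thesis using J by auto
    next
      case False
      have "subset.chain {I. ideal I R} C" using C unfolding subset.chain_def by auto
      then have "ideal (\<Union>C) R" using chain_Union_is_ideal[of C] False by simp
      moreover have "J \<subseteq> \<Union>C" "\<one> \<notin> \<Union>C" using C False unfolding subset.chain_def by blast+
      ultimately show ?thesis by blast
    qed
  qed
  then obtain M where MS: "M \<in> ?S" and M_max: "\<forall>W1\<in>?S. M \<subseteq> W1 \<longrightarrow> W1 = M" by (rule bexE)
  have M: "ideal M R" "J \<subseteq> M" "\<one> \<notin> M" using MS by auto
  have max: "W1 = M" if "ideal W1 R" "J \<subseteq> W1" "\<one> \<notin> W1" "M \<subseteq> W1" for W1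
    using M_max[rule_format, of W1] that by simp
  have "maximalideal M R"
  proof (rule maximalidealI[OF M(1)])
    show "carrier R \<noteq> M" using M(3) by auto
    fix W1 assume W1: "ideal W1 R" "M \<subseteq> W1" "W1 \<subseteq> carrier R"
    then show "W1 = M \<or> W1 = carrier R"
      using max[of W1] M(2) ideal.one_imp_carrier[OF W1(1)] by blast
  qed
  then show ?thesis using maximalideal_prime M(2) by blast
qed

context cring
begin

context
  fixes S assumes S: "S \<subseteq> carrier R" "\<one> \<in> S" "\<And>x y. x \<in> S \<Longrightarrow> y \<in> S \<Longrightarrow> x \<otimes> y \<in> S"
begin

lemma fraction_one_iff:
  assumes "r \<in> carrier R"
  shows "(a, s) \<in> fraction R S r \<one> \<longleftrightarrow> a \<in> carrier R \<and> s \<in> S \<and> (\<exists>w\<in>S. w \<otimes> (r \<otimes> s) = w \<otimes> a)"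
proof -
  have "w \<otimes> (r \<otimes> s \<ominus> a \<otimes> \<one>) = \<zero> \<longleftrightarrow> w \<otimes> (r \<otimes> s) = w \<otimes> a" if "w \<in> S" "s \<in> S" "a \<in> carrier R" for w
  proof -
    have c: "w \<in> carrier R" "s \<in> carrier R" using that S(1) by auto
    have "w \<otimes> (r \<otimes> s \<ominus> a \<otimes> \<one>) = w \<otimes> (r \<otimes> s) \<ominus> w \<otimes> a"
      using c that(3) assms by (simp add: a_minus_def r_distr r_minus)
    then show ?thesis using c that(3) assms by simp
  qed
  then show ?thesis by (auto simp: fraction_def)
qed

text \<open>All representatives of \<open>r/1\<close> define the same class. This makes the unions in the definition of the
  multiplication collapse.\<close>

lemma fraction_eqI:
  assumes r: "r \<in> carrier R" and x: "(a, s) \<in> fraction R S r \<one>"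
  shows "fraction R S a s = fraction R S r \<one>"
proof -
  obtain w where w: "w \<in> S" "w \<otimes> (r \<otimes> s) = w \<otimes> a" "a \<in> carrier R" "s \<in> S"
    using x fraction_one_iff[OF r] by blast
  have c: "w \<in> carrier R" "s \<in> carrier R" using w S(1) by auto
  have "(b, t) \<in> fraction R S a s \<longleftrightarrow> (b, t) \<in> fraction R S r \<one>" for b t
  proof
    assume "(b, t) \<in> fraction R S a s"
    then obtain v where v: "v \<in> S" "v \<otimes> (a \<otimes> t \<ominus> b \<otimes> s) = \<zero>" "b \<in> carrier R" "t \<in> S"
      by (auto simp: fraction_def)
    have d: "v \<in> carrier R" "t \<in> carrier R" using v S(1) by auto
    have "v \<otimes> (a \<otimes> t) \<ominus> v \<otimes> (b \<otimes> s) = \<zero>"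
      using v d w(3) c by (simp add: a_minus_def r_distr r_minus)
    then have e: "v \<otimes> (a \<otimes> t) = v \<otimes> (b \<otimes> s)" using v d w(3) c by simp
    have "(w \<otimes> v \<otimes> s) \<otimes> (r \<otimes> t) = (w \<otimes> (r \<otimes> s)) \<otimes> (v \<otimes> t)" using c d r by (simp add: m_ac)
    also have "\<dots> = w \<otimes> (v \<otimes> (a \<otimes> t))" unfolding w(2) using c d w(3) by (simp add: m_ac)
    also have "\<dots> = (w \<otimes> v \<otimes> s) \<otimes> b" unfolding e using c d v(3) by (simp add: m_ac)
    finally show "(b, t) \<in> fraction R S r \<one>"
      unfolding fraction_one_iff[OF r] using v w S(3) by blast
  next
    assume "(b, t) \<in> fraction R S r \<one>"
    then obtain v where v: "v \<in> S" "v \<otimes> (r \<otimes> t) = v \<otimes> b" "b \<in> carrier R" "t \<in> S"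
      using fraction_one_iff[OF r] by blast
    have d: "v \<in> carrier R" "t \<in> carrier R" using v S(1) by auto
    have "(w \<otimes> v) \<otimes> (a \<otimes> t) = (w \<otimes> a) \<otimes> (v \<otimes> t)" using c d w(3) by (simp add: m_ac)
    also have "\<dots> = w \<otimes> ((v \<otimes> (r \<otimes> t)) \<otimes> s)" unfolding w(2)[symmetric] using c d r by (simp add: m_ac)
    also have "\<dots> = (w \<otimes> v) \<otimes> (b \<otimes> s)" unfolding v(2) using c d v(3) by (simp add: m_ac)
    finally have "(w \<otimes> v) \<otimes> (a \<otimes> t) \<ominus> (w \<otimes> v) \<otimes> (b \<otimes> s) = \<zero>" using c d v(3) w(3) by simp
    then have "(w \<otimes> v) \<otimes> (a \<otimes> t \<ominus> b \<otimes> s) = \<zero>"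
      using c d v(3) w(3) by (simp add: a_minus_def r_distr r_minus)
    then show "(b, t) \<in> fraction R S a s" using v w S(3) by (auto simp: fraction_def)
  qed
  then show ?thesis by auto
qed

lemma fraction_one_mult:
  assumes r: "r \<in> carrier R" and q: "q \<in> carrier R"
  shows "fraction R S r \<one> \<otimes>\<^bsub>ring_of_fractions R S\<^esub> fraction R S q \<one> = fraction R S (r \<otimes> q) \<one>"
proof -
  have rq: "r \<otimes> q \<in> carrier R" using r q by simp
  have each: "fraction R S (a \<otimes> b) (s \<otimes> t) = fraction R S (r \<otimes> q) \<one>"
    if as: "(a, s) \<in> fraction R S r \<one>" and bt: "(b, t) \<in> fraction R S q \<one>" for a s b t
  proof (rule fraction_eqI[OF rq])
    obtain w where w: "w \<in> S" "w \<otimes> (r \<otimes> s) = w \<otimes> a" "a \<in> carrier R" "s \<in> S"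
      using as fraction_one_iff[OF r] by blast
    obtain v where v: "v \<in> S" "v \<otimes> (q \<otimes> t) = v \<otimes> b" "b \<in> carrier R" "t \<in> S"
      using bt fraction_one_iff[OF q] by blast
    have c: "w \<in> carrier R" "s \<in> carrier R" "v \<in> carrier R" "t \<in> carrier R" using w v S(1) by auto
    have "(w \<otimes> v) \<otimes> (r \<otimes> q \<otimes> (s \<otimes> t)) = (w \<otimes> (r \<otimes> s)) \<otimes> (v \<otimes> (q \<otimes> t))"
      using c r q by (simp add: m_ac)
    also have "\<dots> = (w \<otimes> v) \<otimes> (a \<otimes> b)" unfolding w(2) v(2) using c w(3) v(3) by (simp add: m_ac)
    finally show "(a \<otimes> b, s \<otimes> t) \<in> fraction R S (r \<otimes> q) \<one>"
      unfolding fraction_one_iff[OF rq] using w v S(3) by auto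
  qed
  have mem: "(x, \<one>) \<in> fraction R S x \<one>" if "x \<in> carrier R" for x
    unfolding fraction_one_iff[OF that] using that S by auto
  have "fraction R S r \<one> \<otimes>\<^bsub>ring_of_fractions R S\<^esub> fraction R S q \<one>
      = (\<Union>(a, s)\<in>fraction R S r \<one>. \<Union>(b, t)\<in>fraction R S q \<one>. fraction R S (a \<otimes> b) (s \<otimes> t))"
    by (simp add: ring_of_fractions_def)
  also have "\<dots> = (\<Union>(a, s)\<in>fraction R S r \<one>. \<Union>(b, t)\<in>fraction R S q \<one>. fraction R S (r \<otimes> q) \<one>)"
    using each by (intro SUP_cong refl) auto
  also have "\<dots> = fraction R S (r \<otimes> q) \<one>"
    using mem[OF r] mem[OF q] by (auto simp: split_beta)
  finally show ?thesis .
qed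

lemma fraction_one_pow:
  assumes r: "r \<in> carrier R"
  shows "fraction R S r \<one> [^]\<^bsub>ring_of_fractions R S\<^esub> (n::nat) = fraction R S (r [^] n) \<one>"
proof (induction n)
  case 0
  then show ?case by (simp add: ring_of_fractions_def)
next
  case (Suc n)
  then show ?case using fraction_one_mult[of "r [^] n" r] r by simp
qed

end

text \<open>If \<open>z \<noteq> 0\<close>, its annihilator lies in a prime ideal \<open>Q\<close>. Then no element outside \<open>Q\<close> kills \<open>z\<close>, so \<open>z\<close> is a
  nonzero nilpotent element of the localization at \<open>Q\<close>.\<close>

lemma reduced_localizations:
  assumes z: "z \<in> carrier R" "z [^] (n::nat) = \<zero>"
    and red: "\<And>Q. primeideal Q R \<Longrightarrow> reduced_ring (ring_of_fractions R (carrier R - Q))"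
  shows "z = \<zero>"
proof (rule ccontr)
  assume nz: "z \<noteq> \<zero>"
  let ?J = "{x \<in> carrier R. x \<otimes> z = \<zero>}"
  have "ideal ?J R"
  proof (rule idealI[OF ring_axioms])
    show "subgroup ?J (add_monoid R)"
      by (rule add.subgroupI) (use z in \<open>auto simp: l_distr l_minus intro!: exI[of _ \<zero>]\<close>)
    fix a x assume a: "a \<in> ?J" and x: "x \<in> carrier R"
    then show "x \<otimes> a \<in> ?J" using z by (simp add: m_assoc)
    then show "a \<otimes> x \<in> ?J" using a x m_comm[of a x] by simp
  qed
  moreover have "\<one> \<notin> ?J" using z nz by simp
  ultimately obtain Q where Q: "primeideal Q R" "?J \<subseteq> Q" using proper_ideal_in_prime by blast
  interpret Q: primeideal Q R by (rule Q(1))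
  let ?S = "carrier R - Q"
  have S: "?S \<subseteq> carrier R" "\<one> \<in> ?S" "\<And>x y. x \<in> ?S \<Longrightarrow> y \<in> ?S \<Longrightarrow> x \<otimes> y \<in> ?S"
    using Q.I_notcarr Q.one_imp_carrier Q.I_prime by auto
  have "fraction R ?S z \<one> [^]\<^bsub>ring_of_fractions R ?S\<^esub> n = \<zero>\<^bsub>ring_of_fractions R ?S\<^esub>"
    using fraction_one_pow[OF S z(1), of n] z(2) by (simp add: ring_of_fractions_def)
  moreover have "fraction R ?S z \<one> \<in> carrier (ring_of_fractions R ?S)"
    using z S(2) by (auto simp: ring_of_fractions_def)
  ultimately have "fraction R ?S z \<one> = fraction R ?S \<zero> \<one>"
    using red[OF Q(1)] unfolding reduced_ring_def by (auto simp: ring_of_fractions_def)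
  moreover have "(z, \<one>) \<in> fraction R ?S z \<one>"
    using fraction_one_iff[OF S z(1)] z S by auto
  ultimately have "(z, \<one>) \<in> fraction R ?S \<zero> \<one>" by simp
  then obtain w where w: "w \<in> ?S" "w \<otimes> (\<zero> \<otimes> \<one>) = w \<otimes> z"
    using fraction_one_iff[OF S zero_closed] by blast
  then have "w \<in> ?J" by auto
  then show False using Q(2) w(1) by blast
qed

end

text \<open>A subspace that is maximal among those that contain \<open>1\<close> but not \<open>w\<close> is a complement of the line
  spanned by \<open>w\<close>.\<close>

lemma (in field) linear_functional_exists:
  assumes F: "subfield F R" and w: "w \<in> carrier R" "w \<notin> F"
  shows "\<exists>l\<in>carrier R \<rightarrow> F. (\<forall>a\<in>carrier R. \<forall>b\<in>carrier R. l (a \<oplus> b) = l a \<oplus> l b) \<and>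
    (\<forall>r\<in>F. \<forall>a\<in>carrier R. l (r \<otimes> a) = r \<otimes> l a) \<and> l \<one> = \<zero> \<and> l w = \<one>"
proof -
  note Fr = subfieldE(1)[OF F]
  note Fc = subfieldE(3)[OF F]
  note F_ops = subringE(2,3,5,6,7)[OF Fr]
  define good where "good = (\<lambda>H. H \<subseteq> carrier R \<and> (\<forall>x\<in>H. \<forall>y\<in>H. x \<oplus> y \<in> H) \<and>
    (\<forall>r\<in>F. \<forall>x\<in>H. r \<otimes> x \<in> H) \<and> \<one> \<in> H \<and> w \<notin> H)"
  have goodI: "good H" if "H \<subseteq> carrier R" "\<And>x y. x \<in> H \<Longrightarrow> y \<in> H \<Longrightarrow> x \<oplus> y \<in> H"
    "\<And>r x. r \<in> F \<Longrightarrow> x \<in> H \<Longrightarrow> r \<otimes> x \<in> H" "\<one> \<in> H" "w \<notin> H" for H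
    using that by (simp add: good_def)
  have good_sub: "H \<subseteq> carrier R" and good_one: "\<one> \<in> H" and good_w: "w \<notin> H" if "good H" for H
    using that by (simp_all add: good_def)
  have good_add: "x \<oplus> y \<in> H" if "good H" "x \<in> H" "y \<in> H" for H x y
    using that by (simp add: good_def)
  have good_mult: "r \<otimes> x \<in> H" if "good H" "r \<in> F" "x \<in> H" for H r x
    using that by (simp add: good_def)
  have "\<exists>H\<in>Collect good. \<forall>W\<in>Collect good. H \<subseteq> W \<longrightarrow> W = H"
  proof (rule subset_Zorn)
    fix C assume C: "subset.chain (Collect good) C"
    have P: "good W" if "W \<in> C" for W using C that unfolding subset.chain_def by blast
    show "\<exists>U\<in>Collect good. \<forall>W\<in>C. W \<subseteq> U"
    proof (cases "C = {}")
      case True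
      have "good F" by (rule goodI) (use F_ops Fc w in auto)
      then show ?thesis using True by blast
    next
      case False
      have "good (\<Union>C)"
      proof (rule goodI)
        fix x y assume xy: "x \<in> \<Union>C" "y \<in> \<Union>C"
        obtain W1 W2 where W: "W1 \<in> C" "W2 \<in> C" "x \<in> W1" "y \<in> W2" using xy by blast
        then have "W1 \<subseteq> W2 \<or> W2 \<subseteq> W1" using C unfolding subset.chain_def by blast
        then show "x \<oplus> y \<in> \<Union>C"
        proof
          assume "W1 \<subseteq> W2"
          then have "x \<oplus> y \<in> W2" using good_add[OF P[OF W(2)]] W by blast
          then show ?thesis using W(2) by blast
        next
          assume "W2 \<subseteq> W1"
          then have "x \<oplus> y \<in> W1" using good_add[OF P[OF W(1)]] W by blast
          then show ?thesis using W(1) by blast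
        qed
      next
        fix r x assume r: "r \<in> F" "x \<in> \<Union>C"
        then obtain W where W: "W \<in> C" "x \<in> W" by blast
        then show "r \<otimes> x \<in> \<Union>C" using good_mult[OF P[OF W(1)] r(1) W(2)] by blast
      next
        show "\<Union>C \<subseteq> carrier R" using good_sub[OF P] by blast
        show "\<one> \<in> \<Union>C" using good_one[OF P] False by blast
        show "w \<notin> \<Union>C" using good_w[OF P] by blast
      qed
      then show ?thesis by blast
    qed
  qed
  then obtain H where HS: "H \<in> Collect good" and H_max: "\<forall>W\<in>Collect good. H \<subseteq> W \<longrightarrow> W = H" by (rule bexE)
  have PH: "good H" using HS by (rule CollectD)
  have max: "W = H" if "good W" "H \<subseteq> W" for W
    using H_max[rule_format, OF CollectI[of good, OF that(1)] that(2)] .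
  have Hc: "x \<in> carrier R" if "x \<in> H" for x using good_sub[OF PH] that by blast
  note Hadd = good_add[OF PH]
  note Hmul = good_mult[OF PH]
  have H1: "\<one> \<in> H" "w \<notin> H" using good_one[OF PH] good_w[OF PH] by auto
  have H0: "\<zero> \<in> H" using Hmul[OF F_ops(1) H1(1)] by simp
  have fc: "r \<in> carrier R" if "r \<in> F" for r using that Fc by blast
  have ex: "\<exists>c\<in>F. \<exists>h\<in>H. x = h \<oplus> c \<otimes> w" if x: "x \<in> carrier R" for x
  proof (cases "x \<in> H")
    case True then show ?thesis using F_ops(1) x w by (intro bexI[of _ \<zero>] bexI[of _ x]) auto
  next
    case False
    let ?X = "{h \<oplus> c \<otimes> x | h c. h \<in> H \<and> c \<in> F}"
    have XI: "h \<oplus> c \<otimes> x \<in> ?X" if "h \<in> H" "c \<in> F" for h c using that by blast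
    have HX: "H \<subseteq> ?X"
    proof
      fix h assume "h \<in> H"
      then show "h \<in> ?X" using XI[of h \<zero>] F_ops(1) x Hc by simp
    qed
    have "x \<in> ?X" using XI[OF H0 F_ops(2)] x by simp
    then have "?X \<noteq> H" using False by blast
    then have "\<not> good ?X" using max[OF _ HX] by blast
    moreover have "good ?X" if "w \<notin> ?X"
    proof (rule goodI)
      show "?X \<subseteq> carrier R" using Hc fc x by auto
      show "\<one> \<in> ?X" using HX H1 by blast
      show "w \<notin> ?X" by (rule that)
    next
      fix u v assume uv: "u \<in> ?X" "v \<in> ?X"
      obtain h c where u: "h \<in> H" "c \<in> F" "u = h \<oplus> c \<otimes> x" using uv(1) by blast
      obtain h' c' where v: "h' \<in> H" "c' \<in> F" "v = h' \<oplus> c' \<otimes> x" using uv(2) by blast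
      have "u \<oplus> v = (h \<oplus> h') \<oplus> (c \<oplus> c') \<otimes> x"
        unfolding u(3) v(3) using Hc[OF u(1)] Hc[OF v(1)] fc[OF u(2)] fc[OF v(2)] x by (simp add: l_distr a_ac)
      then show "u \<oplus> v \<in> ?X" using XI[OF Hadd[OF u(1) v(1)] F_ops(5)[OF u(2) v(2)]] by simp
    next
      fix r u assume r: "r \<in> F" "u \<in> ?X"
      obtain h c where u: "h \<in> H" "c \<in> F" "u = h \<oplus> c \<otimes> x" using r(2) by blast
      have "r \<otimes> u = r \<otimes> h \<oplus> (r \<otimes> c) \<otimes> x"
        unfolding u(3) using Hc[OF u(1)] fc[OF u(2)] fc[OF r(1)] x by (simp add: r_distr m_assoc)
      then show "r \<otimes> u \<in> ?X" using XI[OF Hmul[OF r(1) u(1)] F_ops(4)[OF r(1) u(2)]] by simp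
    qed
    ultimately have "w \<in> ?X" by blast
    then obtain h c where hc: "h \<in> H" "c \<in> F" "w = h \<oplus> c \<otimes> x" by blast
    have c0: "c \<noteq> \<zero>" using hc H1(2) Hc x by auto
    have ci: "inv c \<in> F" "inv c \<otimes> c = \<one>" using subfield_m_inv[OF F, of c] hc(2) c0 by auto
    have cl: "h \<in> carrier R" "c \<in> carrier R" "inv c \<in> carrier R" using hc Hc fc ci by auto
    have "inv c \<otimes> w = inv c \<otimes> h \<oplus> x"
      unfolding hc(3) using cl x ci(2) by (simp add: r_distr m_assoc[symmetric])
    then have "x = \<ominus> (inv c \<otimes> h) \<oplus> inv c \<otimes> w" using cl x w by (simp add: r_neg1)
    also have "\<ominus> (inv c \<otimes> h) = (\<ominus> (inv c)) \<otimes> h" using cl by (simp add: l_minus)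
    finally have "x = (\<ominus> (inv c)) \<otimes> h \<oplus> inv c \<otimes> w" .
    moreover have "(\<ominus> (inv c)) \<otimes> h \<in> H" using Hmul F_ops(3) ci(1) hc(1) by blast
    ultimately show ?thesis using ci(1) by blast
  qed
  have uniq: "c = c'" if e: "h \<oplus> c \<otimes> w = h' \<oplus> c' \<otimes> w" and m: "h \<in> H" "h' \<in> H" "c \<in> F" "c' \<in> F" for h h' c c'
  proof (rule ccontr)
    assume ne: "c \<noteq> c'"
    let ?e = "c \<ominus> c'"
    have eF: "?e \<in> F" using F_ops m by (simp add: a_minus_def)
    have e0: "?e \<noteq> \<zero>" using ne fc m by simp
    have ei: "inv ?e \<in> F" "inv ?e \<otimes> ?e = \<one>" using subfield_m_inv[OF F, of ?e] eF e0 by auto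
    have cl: "h \<in> carrier R" "h' \<in> carrier R" "c \<in> carrier R" "c' \<in> carrier R" "?e \<in> carrier R" "inv ?e \<in> carrier R"
      using m Hc fc ei eF by auto
    have "?e \<otimes> w = c \<otimes> w \<oplus> \<ominus> (c' \<otimes> w)" using cl w by (simp add: a_minus_def l_distr l_minus)
    also have "c \<otimes> w = \<ominus> h \<oplus> (h' \<oplus> c' \<otimes> w)" using e[symmetric] cl w by (simp add: r_neg1)
    also have "\<ominus> h \<oplus> (h' \<oplus> c' \<otimes> w) \<oplus> \<ominus> (c' \<otimes> w) = (\<ominus> \<one>) \<otimes> h \<oplus> h'"
      using cl w by (simp add: a_assoc r_neg l_minus)
    also have "\<dots> \<in> H" using Hadd Hmul F_ops m by simp
    finally have "inv ?e \<otimes> (?e \<otimes> w) \<in> H" using Hmul ei(1) by blast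
    then show False using H1(2) cl w ei(2) by (simp add: m_assoc[symmetric])
  qed
  define l where "l = (\<lambda>x. SOME c. c \<in> F \<and> (\<exists>h\<in>H. x = h \<oplus> c \<otimes> w))"
  have lI: "l x \<in> F \<and> (\<exists>h\<in>H. x = h \<oplus> l x \<otimes> w)" if "x \<in> carrier R" for x
    unfolding l_def by (rule someI_ex) (use ex[OF that] in blast)
  have leq: "l x = c" if x: "x = h \<oplus> c \<otimes> w" "h \<in> H" "c \<in> F" for x h c
  proof -
    have "x \<in> carrier R" using x Hc fc w by simp
    then obtain h' where "h' \<in> H" "x = h' \<oplus> l x \<otimes> w" "l x \<in> F" using lI by blast
    then show ?thesis using uniq x by metis
  qed
  have "l (a \<oplus> b) = l a \<oplus> l b" if ab: "a \<in> carrier R" "b \<in> carrier R" for a b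
  proof -
    obtain h where h: "h \<in> H" "a = h \<oplus> l a \<otimes> w" "l a \<in> F" using lI ab by blast
    obtain h' where h': "h' \<in> H" "b = h' \<oplus> l b \<otimes> w" "l b \<in> F" using lI ab by blast
    have "(h \<oplus> l a \<otimes> w) \<oplus> (h' \<oplus> l b \<otimes> w) = (h \<oplus> h') \<oplus> (l a \<oplus> l b) \<otimes> w"
      using h(1,3) h'(1,3) Hc fc w by (simp add: l_distr a_ac)
    then have "a \<oplus> b = (h \<oplus> h') \<oplus> (l a \<oplus> l b) \<otimes> w" using h(2) h'(2) by metis
    then show ?thesis using leq Hadd F_ops(5) h h' by blast
  qed
  moreover have "l (r \<otimes> a) = r \<otimes> l a" if ra: "r \<in> F" "a \<in> carrier R" for r a
  proof -
    obtain h where h: "h \<in> H" "a = h \<oplus> l a \<otimes> w" "l a \<in> F" using lI ra by blast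
    have "r \<otimes> (h \<oplus> l a \<otimes> w) = r \<otimes> h \<oplus> (r \<otimes> l a) \<otimes> w"
      using h(1,3) ra(1) Hc fc w by (simp add: r_distr m_assoc)
    then have "r \<otimes> a = r \<otimes> h \<oplus> (r \<otimes> l a) \<otimes> w" using h(2) by metis
    then show ?thesis using leq Hmul F_ops(4) h ra by blast
  qed
  moreover have "l \<one> = \<zero>" using leq[of \<one> \<one> \<zero>] H1 F_ops w by simp
  moreover have "l w = \<one>" using leq[of w \<zero> \<one>] H0 F_ops w by simp
  ultimately show ?thesis using lI by (intro bexI[of _ l]) auto
qed

lemma (in algebraically_closed) root_exists:
  assumes a: "a \<in> carrier L" and n: "0 < n"
  shows "\<exists>b\<in>carrier L. b [^] (n::nat) = a"
proof -
  obtain k where k: "n = Suc k" using n by (cases n) auto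
  let ?P = "\<one> # replicate k \<zero> @ [\<ominus> a]"
  have P: "?P \<in> carrier (poly_ring L)"
    using a by (auto simp: sym[OF univ_poly_carrier] polynomial_def)
  have "size (roots ?P) = degree ?P" using roots_over_carrier[OF P] by (simp add: splitted_def)
  then have "roots ?P \<noteq> {#}" by auto
  then obtain b where "b \<in># roots ?P" by blast
  then have "is_root ?P b" using roots_mem_iff_is_root[OF P] by simp
  then have b: "b \<in> carrier L" "eval ?P b = \<zero>" by (auto simp: is_root_def)
  have "eval ?P b = b [^] n \<oplus> eval (replicate k \<zero> @ [\<ominus> a]) b" using b k by simp
  also have "eval (replicate k \<zero> @ [\<ominus> a]) b = \<ominus> a"
    using a b by (subst eval_replicate) auto
  finally have "b [^] n \<ominus> a = \<zero>" using b by (simp add: a_minus_def)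
  then show ?thesis using a b by auto
qed

section \<open>Local rings of models\<close>

context field
begin

lemma nonzero_inv:
  assumes "s \<in> carrier R" "s \<noteq> \<zero>"
  shows "inv s \<in> carrier R" "inv s \<noteq> \<zero>" "s \<otimes> inv s = \<one>" "inv s \<otimes> s = \<one>"
  using subfield_m_inv[OF carrier_is_subfield, of s] assms by auto

lemma inv_mult_nonzero:
  assumes "s \<in> carrier R" "s \<noteq> \<zero>" "t \<in> carrier R" "t \<noteq> \<zero>"
  shows "inv (s \<otimes> t) = inv s \<otimes> inv t"
proof (rule comm_inv_char)
  have "s \<otimes> t \<otimes> (inv s \<otimes> inv t) = (s \<otimes> inv s) \<otimes> (t \<otimes> inv t)"
    using assms nonzero_inv[OF assms(1,2)] nonzero_inv[OF assms(3,4)] by (simp add: m_ac del: nonzero_inv)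
  then show "s \<otimes> t \<otimes> (inv s \<otimes> inv t) = \<one>"
    using nonzero_inv[OF assms(1,2)] nonzero_inv[OF assms(3,4)] by simp
qed (use assms nonzero_inv in auto)

lemma fractions_subring:
  assumes B: "subring B R"
    and S: "S \<subseteq> B" "\<one> \<in> S" "\<And>s t. s \<in> S \<Longrightarrow> t \<in> S \<Longrightarrow> s \<otimes> t \<in> S" "\<zero> \<notin> S"
  shows "subring {b \<otimes> inv s | b s. b \<in> B \<and> s \<in> S} R"
proof -
  let ?Q = "{b \<otimes> inv s | b s. b \<in> B \<and> s \<in> S}"
  note B_ops = subringE(2,3,5,6,7)[OF B]
  have Bc: "b \<in> carrier R" if "b \<in> B" for b using that subringE(1)[OF B] by blast
  have Sc: "s \<in> carrier R" "s \<noteq> \<zero>" "s \<in> B" if "s \<in> S" for s using that S Bc by auto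
  have Si: "inv s \<in> carrier R" "inv s \<noteq> \<zero>" "s \<otimes> inv s = \<one>" "inv s \<otimes> s = \<one>" if "s \<in> S" for s
    using nonzero_inv[OF Sc(1)[OF that] Sc(2)[OF that]] by auto
  have QI: "b \<otimes> inv s \<in> ?Q" if "b \<in> B" "s \<in> S" for b s using that by blast
  show ?thesis
  proof (rule subringI)
    show "?Q \<subseteq> carrier R" using Bc Si(1) by auto
    show "\<one> \<in> ?Q" using QI[OF B_ops(2) S(2)] by simp
  next
    fix x assume "x \<in> ?Q"
    then obtain b s where x: "x = b \<otimes> inv s" "b \<in> B" "s \<in> S" by blast
    then have "\<ominus> x = (\<ominus> b) \<otimes> inv s" using Bc Si(1) by (simp add: l_minus)
    then show "\<ominus> x \<in> ?Q" using QI[OF B_ops(3)] x by simp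
  next
    fix x y assume "x \<in> ?Q" "y \<in> ?Q"
    then obtain b s c t where x: "x = b \<otimes> inv s" "b \<in> B" "s \<in> S" and y: "y = c \<otimes> inv t" "c \<in> B" "t \<in> S" by blast
    note st = Sc[OF x(3)] Si[OF x(3)] Sc[OF y(3)] Si[OF y(3)]
    have bc: "b \<in> carrier R" "c \<in> carrier R" using Bc x y by auto
    have i: "inv (s \<otimes> t) = inv s \<otimes> inv t" using st by (intro inv_mult_nonzero) auto
    have "x \<otimes> y = (b \<otimes> c) \<otimes> inv (s \<otimes> t)"
      unfolding i x(1) y(1) using st(4,11) bc by (simp add: m_ac)
    then show "x \<otimes> y \<in> ?Q" using QI[OF B_ops(4)[OF x(2) y(2)] S(3)[OF x(3) y(3)]] by simp
    have "(b \<otimes> t) \<otimes> (inv s \<otimes> inv t) = b \<otimes> inv s \<otimes> (t \<otimes> inv t)"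
      using st(4,8,11) bc by (simp add: m_ac del: st)
    moreover have "(c \<otimes> s) \<otimes> (inv s \<otimes> inv t) = c \<otimes> inv t \<otimes> (s \<otimes> inv s)"
      using st(1,4,11) bc by (simp add: m_ac del: st)
    ultimately have "x \<oplus> y = (b \<otimes> t \<oplus> c \<otimes> s) \<otimes> inv (s \<otimes> t)"
      unfolding i x(1) y(1) using st(1,4,6,8,11,13) bc by (simp add: l_distr)
    then show "x \<oplus> y \<in> ?Q"
      using QI[OF B_ops(5)[OF B_ops(4)[OF x(2) st(10)] B_ops(4)[OF y(2) st(3)]] S(3)[OF x(3) y(3)]] by simp
  qed
qed

lemma ess_finite_type_subring:
  assumes k: "k \<subseteq> carrier R" and A: "ess_finite_type R k A"
  shows "subring A R"
proof -
  obtain G S where G: "finite G" "G \<subseteq> carrier R" and S: "submonoid S R" "S \<subseteq> generate_ring R (k \<union> G)" "\<zero> \<notin> S"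
    and A: "A = {b \<otimes> inv s | b s. b \<in> generate_ring R (k \<union> G) \<and> s \<in> S}"
    using A unfolding ess_finite_type_def by blast
  have "subring (generate_ring R (k \<union> G)) R" using k G by (intro generate_ring_is_subring) auto
  then show ?thesis unfolding A
    using S submonoid.one_closed[OF S(1)] submonoid.m_closed[OF S(1)] by (intro fractions_subring) auto
qed

lemma localize_at_subring:
  assumes A: "subring A R" and P: "primeideal P (R\<lparr>carrier := A\<rparr>)"
  shows "subring (localize_at R A P) R" "A \<subseteq> localize_at R A P"
    and "\<And>b. b \<in> A - P \<Longrightarrow> inv b \<in> localize_at R A P"
proof -
  interpret P: primeideal P "R\<lparr>carrier := A\<rparr>" by (rule P)
  have Ac: "a \<in> carrier R" if "a \<in> A" for a using that subringE(1)[OF A] by blast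
  have 1: "\<one> \<in> A - P" using P.one_imp_carrier P.I_notcarr subringE(3)[OF A] by auto
  have 0: "\<zero> \<in> P" using additive_subgroup.zero_closed[OF P.is_additive_subgroup] by simp
  have m: "s \<otimes> t \<in> A - P" if "s \<in> A - P" "t \<in> A - P" for s t
    using that P.I_prime[of s t] subringE(6)[OF A] by auto
  show "subring (localize_at R A P) R"
    unfolding localize_at_def by (rule fractions_subring[OF A]) (use 0 1 m in auto)
  have I: "a \<otimes> inv b \<in> localize_at R A P" if "a \<in> A" "b \<in> A - P" for a b
    using that by (auto simp: localize_at_def)
  show "A \<subseteq> localize_at R A P"
  proof
    fix a assume a: "a \<in> A"
    have "a \<otimes> inv \<one> = a" using Ac[OF a] by simp
    then show "a \<in> localize_at R A P" using I[OF a 1] by simp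
  qed
  fix b assume b: "b \<in> A - P"
  then have "b \<in> carrier R" "b \<noteq> \<zero>" using Ac 0 by auto
  then have "\<one> \<otimes> inv b = inv b" using nonzero_inv(1)[of b] by (intro l_one)
  then show "inv b \<in> localize_at R A P" using I[OF subringE(3)[OF A] b] by simp
qed

lemma scheme_model_cover:
  assumes "scheme_model R k XX"
  shows "\<exists>\<U>. \<U> \<noteq> {} \<and> XX = (\<Union>A\<in>\<U>. affine_points R A) \<and>
    (\<forall>A\<in>\<U>. ess_finite_type R k A \<and> carrier R = {a \<otimes> inv b | a b. a \<in> A \<and> b \<in> A - {\<zero>}})"
  using assms unfolding scheme_model_def by (elim conjE exE) (intro exI conjI; assumption)

text \<open>The localization of an affine chart at the zero ideal is the function field.\<close>

lemma generic_point:
  assumes k: "k \<subseteq> carrier R" and XX: "scheme_model R k XX"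
  shows "carrier R \<in> XX"
proof -
  obtain U where U0: "U \<noteq> {}" and U1: "XX = (\<Union>A\<in>U. affine_points R A)"
    and U2: "\<forall>A\<in>U. ess_finite_type R k A \<and> carrier R = {a \<otimes> inv b | a b. a \<in> A \<and> b \<in> A - {\<zero>}}"
    using scheme_model_cover[OF XX] by (elim exE conjE)
  obtain A where A: "A \<in> U" using U0 by blast
  note A_props = bspec[OF U2 A, THEN conjunct1] bspec[OF U2 A, THEN conjunct2]
  interpret A: domain "R\<lparr>carrier := A\<rparr>"
    by (rule subring_is_domain[OF ess_finite_type_subring[OF k A_props(1)]])
  have "primeideal {\<zero>} (R\<lparr>carrier := A\<rparr>)" using A.zeroprimeideal by simp
  then have "localize_at R A {\<zero>} \<in> affine_points R A" unfolding affine_points_def by blast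
  moreover have "localize_at R A {\<zero>} = carrier R"
    unfolding localize_at_def by (rule A_props(2)[symmetric])
  ultimately show ?thesis unfolding U1 by (intro UN_I[OF A]) simp
qed

lemma model_point:
  assumes k: "k \<subseteq> carrier R" and XX: "scheme_model R k XX" and x: "x \<in> XX"
  obtains A P where "ess_finite_type R k A" "subring A R" "primeideal P (R\<lparr>carrier := A\<rparr>)"
    "x = localize_at R A P" "carrier R = {a \<otimes> inv b | a b. a \<in> A \<and> b \<in> A - {\<zero>}}"
proof -
  obtain U where U1: "XX = (\<Union>A\<in>U. affine_points R A)"
    and U2: "\<forall>A\<in>U. ess_finite_type R k A \<and> carrier R = {a \<otimes> inv b | a b. a \<in> A \<and> b \<in> A - {\<zero>}}"
    using scheme_model_cover[OF XX] by (elim exE conjE)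
  obtain A where A: "A \<in> U" and xA: "x \<in> affine_points R A" using x unfolding U1 by (rule UN_E)
  note A_props = bspec[OF U2 A, THEN conjunct1] bspec[OF U2 A, THEN conjunct2]
  obtain P where "x = localize_at R A P" "primeideal P (R\<lparr>carrier := A\<rparr>)"
    using xA unfolding affine_points_def by (elim CollectE exE conjE)
  then show thesis using that A_props ess_finite_type_subring[OF k A_props(1)] by blast
qed

lemma max_ideal_subring:
  assumes "subring A R"
  shows "x \<in> max_ideal (R\<lparr>carrier := A\<rparr>) \<longleftrightarrow> x \<in> A \<and> \<not> (\<exists>y\<in>A. x \<otimes> y = \<one>)"
proof (cases "x \<in> A")
  case True
  have c: "x \<otimes> y = y \<otimes> x" if "y \<in> A" for y
    using True that subringE(1)[OF assms] by (intro m_comm) blast+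
  have "x \<in> Units (R\<lparr>carrier := A\<rparr>) \<longleftrightarrow> (\<exists>y\<in>A. x \<otimes> y = \<one>)"
    unfolding Units_def using True by (simp add: c[symmetric] cong: bex_cong)
  then show ?thesis using True by (simp add: max_ideal_def)
qed (simp add: max_ideal_def)

lemma max_ideal_subfield:
  assumes F: "subfield F R" shows "max_ideal (R\<lparr>carrier := F\<rparr>) = {\<zero>}"
proof -
  have "x \<in> max_ideal (R\<lparr>carrier := F\<rparr>) \<longleftrightarrow> x = \<zero>" for x
  proof (cases "x \<in> F - {\<zero>}")
    case True
    then show ?thesis using subfield_m_inv[OF F True] max_ideal_subring[OF subfieldE(1)[OF F], of x] by blast
  next
    case False
    have "\<zero> \<otimes> y \<noteq> \<one>" if "y \<in> F" for y using that subfieldE(3)[OF F] by (simp add: subset_iff)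
    then show ?thesis
      using False max_ideal_subring[OF subfieldE(1)[OF F], of x] subringE(2)[OF subfieldE(1)[OF F]] by auto
  qed
  then show ?thesis by auto
qed

lemma principal_max_ideal_units:
  assumes "subring A R" and s: "s \<in> A"
    and m: "max_ideal (R\<lparr>carrier := A\<rparr>) = PIdl\<^bsub>R\<lparr>carrier := A\<rparr>\<^esub> s" and x: "x \<in> A"
  shows "(\<exists>y\<in>A. x \<otimes> y = \<one>) \<longleftrightarrow> \<not> (\<exists>v\<in>A. x = s \<otimes> v)"
proof -
  have Ac: "a \<in> carrier R" if "a \<in> A" for a using that subringE(1)[OF assms(1)] by blast
  have "PIdl\<^bsub>R\<lparr>carrier := A\<rparr>\<^esub> s = {v \<otimes> s | v. v \<in> A}" by (simp add: cgenideal_def)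
  also have "\<dots> = {x \<in> A. \<exists>v\<in>A. x = s \<otimes> v}"
  proof (rule Set.set_eqI, rule iffI)
    fix x assume "x \<in> {v \<otimes> s | v. v \<in> A}"
    then obtain v where v: "v \<in> A" "x = v \<otimes> s" by blast
    then have "x \<in> A" "x = s \<otimes> v"
      using subringE(6)[OF assms(1) v(1) s] m_comm[OF Ac[OF v(1)] Ac[OF s]] by simp_all
    then show "x \<in> {x \<in> A. \<exists>v\<in>A. x = s \<otimes> v}" using v(1) by blast
  next
    fix x assume "x \<in> {x \<in> A. \<exists>v\<in>A. x = s \<otimes> v}"
    then obtain v where v: "v \<in> A" "x = s \<otimes> v" by blast
    then have "x = v \<otimes> s" using m_comm[OF Ac[OF v(1)] Ac[OF s]] by simp
    then show "x \<in> {v \<otimes> s | v. v \<in> A}" using v(1) by blast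
  qed
  finally have "PIdl\<^bsub>R\<lparr>carrier := A\<rparr>\<^esub> s = {x \<in> A. \<exists>v\<in>A. x = s \<otimes> v}" .
  moreover have "x \<in> max_ideal (R\<lparr>carrier := A\<rparr>) \<longleftrightarrow> \<not> (\<exists>y\<in>A. x \<otimes> y = \<one>)"
    using max_ideal_subring[OF assms(1), of x] x by simp
  ultimately show ?thesis using m x by simp
qed

end

context char_p_field
begin

text \<open>As a fraction \<open>a/c\<close> equals \<open>a c\<^sup>p\<^sup>-\<^sup>1 (1/c)\<^sup>p\<close>, denominators can be absorbed into the \<open>p\<close>-th powers. The same
  holds for the elements of \<open>k\<close>, which is perfect. So the algebra generators \<open>G\<close> of the affine chart
  suffice.\<close>

lemma finitely_generated_over_pth_powers:
  assumes k: "k \<subseteq> carrier R" "\<And>c. c \<in> k \<Longrightarrow> \<exists>b\<in>k. b [^] p = c"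
    and A: "ess_finite_type R k A" and P: "primeideal P (R\<lparr>carrier := A\<rparr>)"
    and E: "E = localize_at R A P"
  shows "k \<subseteq> pth_powers E"
    and "\<exists>G. finite G \<and> G \<subseteq> E \<and> (\<forall>B. subring B R \<longrightarrow> pth_powers E \<subseteq> B \<longrightarrow> G \<subseteq> B \<longrightarrow> E \<subseteq> B)"
proof -
  note Ar = ess_finite_type_subring[OF k(1) A]
  have Ac: "a \<in> carrier R" if "a \<in> A" for a using that subringE(1)[OF Ar] by blast
  obtain G S where G: "finite G" "G \<subseteq> carrier R" and S: "submonoid S R" "S \<subseteq> generate_ring R (k \<union> G)" "\<zero> \<notin> S"
    and Aeq: "A = {b \<otimes> inv s | b s. b \<in> generate_ring R (k \<union> G) \<and> s \<in> S}"
    using A unfolding ess_finite_type_def by blast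
  define B0 where "B0 = generate_ring R (k \<union> G)"
  have kG: "k \<union> G \<subseteq> carrier R" using k G by auto
  have B0: "subring B0 R" unfolding B0_def by (rule generate_ring_is_subring[OF kG])
  have B0c: "b \<in> carrier R" if "b \<in> B0" for b using that subringE(1)[OF B0] by blast
  have Sc: "s \<in> B0" "s \<in> carrier R" "s \<noteq> \<zero>" if "s \<in> S" for s using that S B0c by (auto simp: B0_def)
  have AI: "b \<otimes> inv s \<in> A" if "b \<in> B0" "s \<in> S" for b s using that by (auto simp: Aeq B0_def)
  have S1: "\<one> \<in> S" using submonoid.one_closed[OF S(1)] .
  have B0A: "b \<in> A" if "b \<in> B0" for b using AI[OF that S1] B0c[OF that] by simp
  have SiA: "inv s \<in> A" if "s \<in> S" for s
    using AI[OF subringE(3)[OF B0] that] nonzero_inv(1)[OF Sc(2,3)[OF that]] by simp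
  have kGB: "k \<union> G \<subseteq> B0" unfolding B0_def by (auto intro: generate_ring.incl)
  note Er = localize_at_subring(1)[OF Ar P, folded E]
  note AE = localize_at_subring(2)[OF Ar P, folded E]
  note invE = localize_at_subring(3)[OF Ar P, folded E]
  have Ec: "x \<in> carrier R" if "x \<in> E" for x using that subringE(1)[OF Er] by blast
  show kp: "k \<subseteq> pth_powers E"
  proof
    fix c assume "c \<in> k"
    then obtain b where "b \<in> k" "b [^] p = c" using k(2) by blast
    moreover from this have "b \<in> E" using kGB B0A AE by blast
    ultimately show "c \<in> pth_powers E" by (auto simp: pth_powers_def)
  qed
  have "E \<subseteq> B" if B: "subring B R" "pth_powers E \<subseteq> B" "G \<subseteq> B" for B
  proof
    have B0B: "B0 \<subseteq> B" unfolding B0_def by (rule generate_ring_min_subring1[OF _ B(1)]) (use kG kp B in auto)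
    fix x assume "x \<in> E"
    then obtain a b where x: "x = a \<otimes> inv b" "a \<in> A" "b \<in> A - P" unfolding E localize_at_def by blast
    obtain \<alpha> \<sigma> where a: "a = \<alpha> \<otimes> inv \<sigma>" "\<alpha> \<in> B0" "\<sigma> \<in> S" using x(2) unfolding Aeq B0_def by blast
    obtain \<beta> \<tau> where b: "b = \<beta> \<otimes> inv \<tau>" "\<beta> \<in> B0" "\<tau> \<in> S" using x(3) unfolding Aeq B0_def by blast
    have "\<zero> \<in> P" using additive_subgroup.zero_closed[OF ideal.axioms(1)[OF primeideal.axioms(1)[OF P]]] by simp
    then have b0: "b \<in> carrier R" "b \<noteq> \<zero>" using x(3) Ac by auto
    note \<sigma> = Sc[OF a(3)] and \<tau> = Sc[OF b(3)]
    note \<sigma>i = nonzero_inv[OF \<sigma>(2,3)] and \<tau>i = nonzero_inv[OF \<tau>(2,3)]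
    note \<alpha>c = B0c[OF a(2)] and \<beta>c = B0c[OF b(2)]
    have \<beta>0: "\<beta> \<noteq> \<zero>" using b0 b(1) \<tau>i by auto
    let ?c = "\<beta> \<otimes> \<sigma>"
    have c: "?c \<in> carrier R" "?c \<noteq> \<zero>" using \<beta>c \<beta>0 \<sigma> integral by auto
    note ci = nonzero_inv[OF c]
    have bi: "inv b \<in> E" using invE[OF x(3)] .
    have "b \<otimes> \<tau> = \<beta>" unfolding b(1) using \<beta>c \<tau> \<tau>i by (simp add: m_assoc)
    then have "inv \<beta> = inv b \<otimes> inv \<tau>" using inv_mult_nonzero[OF b0 \<tau>(2,3)] by simp
    then have \<beta>i: "inv \<beta> \<in> E" using bi SiA[OF b(3)] AE subringE(6)[OF Er] by auto
    have cE: "inv ?c \<in> E"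
      using inv_mult_nonzero[OF \<beta>c \<beta>0 \<sigma>(2,3)] \<beta>i SiA[OF a(3)] AE subringE(6)[OF Er] by auto
    have xc: "x \<in> carrier R" using \<open>x \<in> E\<close> Ec by blast
    have "x \<otimes> b = a" unfolding x(1) using nonzero_inv[OF b0] b0 Ac x(2) by (simp add: m_assoc)
    then have "x \<otimes> (b \<otimes> \<tau>) \<otimes> \<sigma> = a \<otimes> \<tau> \<otimes> \<sigma>" using xc b0 \<tau> \<sigma> by (simp add: m_assoc[symmetric])
    also have "\<dots> = \<alpha> \<otimes> \<tau> \<otimes> (inv \<sigma> \<otimes> \<sigma>)" unfolding a(1) using \<alpha>c \<tau>(2) \<sigma>(2) \<sigma>i(1) by (simp add: m_ac)
    finally have xeq: "x \<otimes> ?c = \<alpha> \<otimes> \<tau>"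
      using \<open>b \<otimes> \<tau> = \<beta>\<close> xc \<beta>c \<sigma> \<sigma>i \<alpha>c \<tau> by (simp add: m_assoc)
    obtain q where q: "p = Suc q" using p_pos by (cases p) auto
    have "x = x \<otimes> (?c \<otimes> inv ?c) [^] p" using xc ci by simp
    also have "\<dots> = x \<otimes> (?c [^] p \<otimes> inv ?c [^] p)" using c(1) ci(1) by (simp only: nat_pow_distrib)
    also have "\<dots> = (x \<otimes> ?c) \<otimes> ?c [^] q \<otimes> inv ?c [^] p"
      unfolding q using xc c(1) ci(1) by (simp only: nat_pow_Suc2 m_assoc nat_pow_closed m_closed)
    finally have "x = (\<alpha> \<otimes> \<tau>) \<otimes> ?c [^] q \<otimes> inv ?c [^] p" unfolding xeq .
    moreover have "inv ?c [^] p \<in> B" using cE B(2) by (auto simp: pth_powers_def)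
    moreover have "?c [^] q \<in> B"
      using subring_pow_closed[OF B(1)] subringE(6)[OF B(1)] B0B b(2) \<sigma>(1) by blast
    ultimately show "x \<in> B" using subringE(6)[OF B(1)] B0B a(2) \<tau>(1) by (metis subsetD)
  qed
  moreover have "G \<subseteq> E" using kGB B0A AE by blast
  ultimately show "\<exists>G. finite G \<and> G \<subseteq> E \<and> (\<forall>B. subring B R \<longrightarrow> pth_powers E \<subseteq> B \<longrightarrow> G \<subseteq> B \<longrightarrow> E \<subseteq> B)"
    using G(1) by blast
qed

end

text \<open>Infinite descent: if \<open>a\<^sup>p = t b\<^sup>p\<close>, then \<open>t\<close> divides \<open>a\<close>, hence also \<open>b\<close>, and the quotients satisfy the same
  equation. So \<open>a\<close> is divisible by all powers of \<open>t\<close>, a fortiori by all powers of \<open>s\<close>, and vanishes.\<close>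

lemma (in char_p_dvr) uniformizer_not_pth_power:
  assumes C: "subring C R" "C \<subseteq> V" 
    and tC: "t \<in> C" "t \<noteq> \<zero>" and tm: "t \<in> m"
    and unit: "\<And>x. x \<in> C \<Longrightarrow> (\<exists>y\<in>C. x \<otimes> y = \<one>) \<longleftrightarrow> \<not> (\<exists>v\<in>C. x = t \<otimes> v)"
    and ab: "a \<in> C" "b \<in> C" "b \<noteq> \<zero>"
  shows "a [^] p \<noteq> t \<otimes> b [^] p"
proof
  assume eq: "a [^] p = t \<otimes> b [^] p"
  have Cc: "x \<in> carrier R" if "x \<in> C" for x using that subringE(1)[OF C(1)] by blast
  note Cm = subringE(6)[OF C(1)]
  have div: "\<exists>v\<in>C. x = t \<otimes> v" if x: "x \<in> C" and y: "y \<in> C" and e: "x [^] p = t \<otimes> y" for x y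
  proof (rule ccontr)
    assume "\<not> (\<exists>v\<in>C. x = t \<otimes> v)"
    then obtain w where w: "w \<in> C" "x \<otimes> w = \<one>" using unit[OF x] by blast
    have "t \<otimes> (y \<otimes> w [^] p) = (x \<otimes> w) [^] p"
      using e Cc[OF x] Cc[OF y] Cc[OF w(1)] Cc[OF tC(1)] by (simp add: nat_pow_distrib m_assoc)
    then have "t \<otimes> (y \<otimes> w [^] p) = \<one>" using w(2) by simp
    moreover have "y \<otimes> w [^] p \<in> C" using Cm y subring_pow_closed[OF C(1) w(1)] by blast
    ultimately have "\<exists>y\<in>C. t \<otimes> y = \<one>" by blast
    moreover have "t = t \<otimes> \<one>" using Cc[OF tC(1)] by simp
    ultimately show False using unit[OF tC(1)] subringE(3)[OF C(1)] by blast
  qed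
  obtain r where r: "r \<in> V" "t = s \<otimes> r" using tm by (auto elim: mE)
  obtain q where q: "p = Suc (Suc q)" using p_gt_1 by (metis Suc_lessE One_nat_def less_imp_Suc_add plus_1_eq_Suc)
  have descent: "\<exists>v\<in>V. a = s [^] (n::nat) \<otimes> v" if "a \<in> C" "b \<in> C" "a [^] p = t \<otimes> b [^] p" for a b n
    using that
  proof (induction n arbitrary: a b)
    case 0
    then show ?case using C(2) Cc by force
  next
    case (Suc n)
    have bp: "b [^] p \<in> C" using subring_pow_closed[OF C(1) Suc.prems(2)] .
    obtain a' where a': "a' \<in> C" "a = t \<otimes> a'" using div[OF Suc.prems(1) bp Suc.prems(3)] by blast
    have c: "t \<in> carrier R" "a' \<in> carrier R" "b \<in> carrier R" using tC(1) a'(1) Suc.prems(2) Cc by auto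
    have "t \<otimes> b [^] p = (t \<otimes> a') [^] p" using Suc.prems(3) a'(2) by simp
    also have "\<dots> = t [^] Suc (Suc q) \<otimes> a' [^] p" using c q by (simp only: nat_pow_distrib)
    also have "\<dots> = t \<otimes> (t \<otimes> (t [^] q \<otimes> a' [^] p))"
      using c by (simp only: nat_pow_Suc2 m_assoc nat_pow_closed m_closed)
    finally have b1: "b [^] p = t \<otimes> (t [^] q \<otimes> a' [^] p)" using m_lcancel[OF tC(2) c(1)] c by simp
    have "t [^] q \<otimes> a' [^] p \<in> C" using Cm subring_pow_closed[OF C(1)] tC(1) a'(1) by blast
    then obtain b' where b': "b' \<in> C" "b = t \<otimes> b'" using div[OF Suc.prems(2) _ b1] by blast
    have b'c: "b' \<in> carrier R" using b'(1) Cc by blast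
    have "t [^] p \<otimes> a' [^] p = a [^] p" using c a'(2) by (simp only: nat_pow_distrib)
    also have "\<dots> = t \<otimes> (t [^] p \<otimes> b' [^] p)" unfolding Suc.prems(3) b'(2) using c b'c by (simp only: nat_pow_distrib)
    also have "\<dots> = t [^] p \<otimes> (t \<otimes> b' [^] p)" using c b'c by (intro m_lcomm) auto
    finally have "a' [^] p = t \<otimes> b' [^] p"
      using m_lcancel[OF nonzero_pow_nonzero[OF c(1) tC(2), of p], of "a' [^] p" "t \<otimes> b' [^] p"] c b'c by simp
    then obtain v where v: "v \<in> V" "a' = s [^] n \<otimes> v" using Suc.IH[OF a'(1) b'(1)] by blast
    have "a = s [^] Suc n \<otimes> (r \<otimes> v)" unfolding a'(2) r(2) v(2) using sc Vc r(1) v(1) by (simp add: m_ac)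
    moreover have "r \<otimes> v \<in> V" using r(1) v(1) V_ops by simp
    ultimately show ?case by blast
  qed
  have "a = \<zero>" by (rule separated) (use descent[OF ab(1,2) eq] ab(1) C(2) in auto)
  then have "t \<otimes> b [^] p = \<zero>" using eq p_pos by (simp add: nat_pow_zero)
  then show False
    using integral[of t "b [^] p"] tC Cc ab nonzero_pow_nonzero[of b p] by auto
qed

section \<open>Inseparable elements and the geometric generic fiber\<close>

context char_p_field
begin

text \<open>Suppose that \<open>w\<close> is not in \<open>F\<close>, and let \<open>\<tau>\<close> be a \<open>p\<close>-th root of \<open>w\<^sup>p\<close> in the algebraic closure \<open>L\<close> of \<open>F\<close>. Then
  \<open>z = w \<otimes> 1 - 1 \<otimes> \<tau>\<close> satisfies \<open>z\<^sup>p = w\<^sup>p \<otimes> 1 - 1 \<otimes> w\<^sup>p = 0\<close> in the tensor product of \<open>R\<close> and \<open>L\<close> over \<open>F\<close>.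
  All prime ideals of this ring are points of the geometric generic fiber, since every nonzero element of
  \<open>R\<close> is invertible; so \<open>z = 0\<close> by reducedness. But an \<open>F\<close>-linear form \<open>l\<close> on \<open>R\<close> with \<open>l 1 = 0\<close> and
  \<open>l w = 1\<close> separates \<open>w \<otimes> 1\<close> from \<open>1 \<otimes> \<tau>\<close>.\<close>

lemma pth_root_in_generic_base:
  assumes F: "subfield F R" and XX: "carrier R \<in> XX"
    and red: "geometrically_reduced_fiber R XX F"
    and w: "w \<in> carrier R" "w [^] p \<in> F"
  shows "w \<in> F"
proof (rule ccontr)
  assume wF: "w \<notin> F"
  let ?F = "R\<lparr>carrier := F\<rparr>"
  define L where "L = residue_closure R F"
  define \<psi> where "\<psi> = to_residue_closure R F"
  have RR: "R\<lparr>carrier := carrier R\<rparr> = R" by (cases R) simp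
  interpret F: field ?F by (rule subfield_iff(2)[OF F])
  \<comment> \<open>the residue field of the generic point is \<open>F\<close>, in the form of the quotient by the zero ideal\<close>
  have m0: "max_ideal ?F = {\<zero>}" by (rule max_ideal_subfield[OF F])
  have mR: "max_ideal R = {\<zero>}" using max_ideal_subfield[OF carrier_is_subfield] RR by simp
  interpret M: maximalideal "max_ideal ?F" ?F unfolding m0 using F.zeromaximalideal by simp
  interpret k: field "residue_field R F"
    unfolding residue_field_def by (rule M.quotient_is_field[OF F.is_cring])
  interpret L: algebraic_closure L "k.indexed_const ` carrier (residue_field R F)"
    unfolding L_def residue_closure_def by (rule k.alg_closureE)
  have \<psi>: "\<psi> \<in> ring_hom ?F L"
  proof -
    have "k.indexed_const \<circ> (+>\<^bsub>?F\<^esub>) (max_ideal ?F) \<in> ring_hom ?F L"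
      using k.alg_closureE(2) M.rcos_ring_hom
      unfolding L_def residue_closure_def residue_field_def by (intro ring_hom_trans)
    moreover have "\<psi> = k.indexed_const \<circ> (+>\<^bsub>?F\<^esub>) (max_ideal ?F)"
      unfolding \<psi>_def to_residue_closure_def by (simp add: fun_eq_iff)
    ultimately show ?thesis by simp
  qed
  have Fc: "a \<in> carrier R" if "a \<in> F" for a using that subfieldE(3)[OF F] by blast
  interpret T: algebra_pair ?F id R \<psi> L
    by unfold_locales (use Fc ring_hom_closed[OF \<psi>] in auto)
  have T_eq: "geom_ring R F (carrier R) = T.T" by (simp add: RR L_def \<psi>_def)
  interpret Tp: char_p_ring T.T p
    by unfold_locales (use prime_p T.t_char[OF char_p] in auto)
  have L1: "\<one>\<^bsub>L\<^esub> \<in> carrier L" using ring_hom_closed[OF \<psi> F.one_closed] ring_hom_one[OF \<psi>] by simp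
  obtain \<tau> where \<tau>: "\<tau> \<in> carrier L" "\<tau> [^]\<^bsub>L\<^esub> p = \<psi> (w [^] p)"
    using L.root_exists[OF ring_hom_closed[OF \<psi>], of "w [^] p" p] w p_pos by auto
  define z where "z = T.t w \<one>\<^bsub>L\<^esub> \<ominus>\<^bsub>T.T\<^esub> T.t \<one> \<tau>"
  have tc: "T.t w \<one>\<^bsub>L\<^esub> \<in> carrier T.T" "T.t \<one> \<tau> \<in> carrier T.T" using w \<tau> by (auto intro: T.t_closed)
  have zc: "z \<in> carrier T.T" unfolding z_def using tc by simp
  have "T.t \<one> \<tau> [^]\<^bsub>T.T\<^esub> p = T.t \<one> (\<psi> (w [^] p) \<otimes>\<^bsub>L\<^esub> \<one>\<^bsub>L\<^esub>)"
    using T.t_pow[of \<one> \<tau> p] \<tau> ring_hom_closed[OF \<psi>, of "w [^] p"] w by simp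
  also have "\<dots> = T.t (w [^] p) \<one>\<^bsub>L\<^esub>"
    using T.t_balanced[of "w [^] p" \<one> "\<one>\<^bsub>L\<^esub>"] w by simp
  also have "\<dots> = T.t w \<one>\<^bsub>L\<^esub> [^]\<^bsub>T.T\<^esub> p" using T.t_pow[of w "\<one>\<^bsub>L\<^esub>" p] w by simp
  finally have "z [^]\<^bsub>T.T\<^esub> p = \<zero>\<^bsub>T.T\<^esub>"
    unfolding z_def a_minus_def using tc
    by (simp add: Tp.frobenius_add Tp.frobenius_neg T.T.r_neg)
  then have "z = \<zero>\<^bsub>T.T\<^esub>"
  proof (rule T.T.reduced_localizations[OF zc])
    fix Q assume Q: "primeideal Q T.T"
    interpret Q: primeideal Q T.T by (rule Q)
    have "T.t a \<one>\<^bsub>L\<^esub> \<in> Q \<longleftrightarrow> a = \<zero>" if a: "a \<in> carrier R" for a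
    proof
      assume aQ: "T.t a \<one>\<^bsub>L\<^esub> \<in> Q"
      show "a = \<zero>"
      proof (rule ccontr)
        assume "a \<noteq> \<zero>"
        note ai = nonzero_inv[OF a this]
        have "T.t a \<one>\<^bsub>L\<^esub> \<otimes>\<^bsub>T.T\<^esub> T.t (inv a) \<one>\<^bsub>L\<^esub> \<in> Q"
          using aQ T.t_closed[OF ai(1) L1] by (rule Q.I_r_closed)
        then have "\<one>\<^bsub>T.T\<^esub> \<in> Q" using T.t_mult[OF a L1 ai(1) L1] ai(3) T.t_one by simp
        then show False using Q.one_imp_carrier Q.I_notcarr by simp
      qed
    next
      assume "a = \<zero>"
      then show "T.t a \<one>\<^bsub>L\<^esub> \<in> Q"
        using T.t_zero_left[of "\<one>\<^bsub>L\<^esub>"] additive_subgroup.zero_closed[OF Q.is_additive_subgroup] by simp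
    qed
    then have "{a \<in> carrier R. geom_class R F (carrier R) (single (a, \<one>\<^bsub>residue_closure R F\<^esub>)) \<in> Q}
        = max_ideal (R\<lparr>carrier := carrier R\<rparr>)"
      unfolding RR mR L_def \<psi>_def by auto
    moreover have "dominates R F (carrier R)"
      unfolding dominates_def RR m0 mR using Fc by auto
    ultimately have "(carrier R, Q) \<in> geom_fiber R XX F"
      unfolding geom_fiber_def using XX Q T_eq by simp
    then have "reduced_ring (geom_local_ring R F (carrier R) Q)"
      using red unfolding geometrically_reduced_fiber_def by blast
    then show "reduced_ring (ring_of_fractions T.T (carrier T.T - Q))"
      unfolding geom_local_ring_def T_eq .
  qed
  then have eq: "T.t w \<one>\<^bsub>L\<^esub> = T.t \<one> \<tau>" using tc unfolding z_def by simp
  obtain l where l: "l \<in> carrier R \<rightarrow> F" "\<forall>a\<in>carrier R. \<forall>b\<in>carrier R. l (a \<oplus> b) = l a \<oplus> l b"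
    "\<forall>r\<in>F. \<forall>a\<in>carrier R. l (r \<otimes> a) = r \<otimes> l a" "l \<one> = \<zero>" "l w = \<one>"
    using linear_functional_exists[OF F w(1) wF] by (elim bexE conjE)
  have "\<psi> (l w) \<otimes>\<^bsub>L\<^esub> \<one>\<^bsub>L\<^esub> = \<psi> (l \<one>) \<otimes>\<^bsub>L\<^esub> \<tau>"
    by (rule T.functional_of_tensors_eq[OF F.is_cring \<psi> _ _ _ w(1) L1 one_closed \<tau>(1) eq])
      (use l in auto)
  moreover have "\<psi> \<one> = \<one>\<^bsub>L\<^esub>" "\<psi> \<zero> = \<zero>\<^bsub>L\<^esub>"
    using ring_hom_one[OF \<psi>] ring_hom_zero[OF \<psi> F.ring_axioms L.ring_axioms] by auto
  ultimately show False using l(4,5) \<tau>(1) by simp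
qed

end

section \<open>Prime divisors as discrete valuation rings\<close>

lemma (in field) roots_in_algebraically_closed:
  assumes k: "subfield k R" "algebraically_closed (R\<lparr>carrier := k\<rparr>)" and n: "0 < n" and c: "c \<in> k"
  shows "\<exists>b\<in>k. b [^] (n::nat) = c"
proof -
  interpret k: algebraically_closed "R\<lparr>carrier := k\<rparr>" by (rule k(2))
  show ?thesis using k.root_exists[of c n] c n by (simp add: nat_pow_consistent[symmetric])
qed

lemma (in field) subring_of_subfield:
  assumes F: "subfield F R" and C: "subring C (R\<lparr>carrier := F\<rparr>)"
  shows "subring C R"
proof -
  interpret F: field "R\<lparr>carrier := F\<rparr>" by (rule subfield_iff(2)[OF F])
  note C_ops = subringE(1,3,5,6,7)[OF C, simplified]
  have Cc: "x \<in> carrier R" if "x \<in> C" for x using that C_ops(1) subfieldE(3)[OF F] by blast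
  show ?thesis
  proof (rule subringI)
    fix x assume x: "x \<in> C"
    then have xF: "x \<in> carrier (R\<lparr>carrier := F\<rparr>)" using C_ops(1) by auto
    have "\<ominus>\<^bsub>R\<lparr>carrier := F\<rparr>\<^esub> x \<oplus> x = \<zero>" using F.l_neg[OF xF] by simp
    then have "\<ominus> x = \<ominus>\<^bsub>R\<lparr>carrier := F\<rparr>\<^esub> x"
      using x Cc C_ops(3) by (intro minus_equality) auto
    then show "\<ominus> x \<in> C" using C_ops(3)[OF x] by simp
  qed (use Cc C_ops in auto)
qed

context char_p_field
begin

lemma codim_one_point_is_dvr:
  assumes k: "k \<subseteq> carrier R" and Y: "scheme_model R k Y" and E: "E \<in> codim_one_points R Y"
    and s: "s \<in> E" "s \<noteq> \<zero>" "max_ideal (R\<lparr>carrier := E\<rparr>) = PIdl\<^bsub>R\<lparr>carrier := E\<rparr>\<^esub> s"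
  shows "char_p_dvr R p E s"
proof -
  have EY: "E \<in> Y" and dim: "krull_dim (R\<lparr>carrier := E\<rparr>) = 1" using E by auto
  obtain A P where A: "subring A R" "primeideal P (R\<lparr>carrier := A\<rparr>)" "E = localize_at R A P"
    using model_point[OF k Y EY] by metis
  have Er: "subring E R" using localize_at_subring(1)[OF A(1,2)] A(3) by simp
  note unit = principal_max_ideal_units[OF Er s(1,3)]
  interpret char_p_principal_local R p E s
  proof (intro char_p_principal_local.intro char_p_field_axioms char_p_principal_local_axioms.intro)
    show "\<exists>w\<in>E. x \<otimes> w = \<one>" if "x \<in> E" "\<And>v. v \<in> E \<Longrightarrow> x \<noteq> s \<otimes> v" for x
      using unit[OF that(1)] that(2) by blast
    show "s \<otimes> v \<noteq> \<one>" if v: "v \<in> E" for v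
    proof
      assume "s \<otimes> v = \<one>"
      then have "\<exists>y\<in>E. s \<otimes> y = \<one>" using v by blast
      moreover have "s = s \<otimes> \<one>" using s(1) subringE(1)[OF Er] by auto
      ultimately show False using unit[OF s(1)] subringE(3)[OF Er] by blast
    qed
  qed (rule Er s)+
  show ?thesis
    by unfold_locales (rule separated_if_krull_dim_one[OF dim])
qed

end

context char_p_dvr
begin

lemma max_ideal_is_m: "max_ideal (R\<lparr>carrier := V\<rparr>) = m"
proof (rule Set.set_eqI)
  fix x
  show "x \<in> max_ideal (R\<lparr>carrier := V\<rparr>) \<longleftrightarrow> x \<in> m"
  proof
    assume "x \<in> max_ideal (R\<lparr>carrier := V\<rparr>)"
    then have x: "x \<in> V" "\<not> (\<exists>y\<in>V. x \<otimes> y = \<one>)" using max_ideal_subring[OF V] by auto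
    obtain v where "v \<in> V" "x = s \<otimes> v" using unit[OF x(1)] x(2) by blast
    then show "x \<in> m" using mI by simp
  next
    assume "x \<in> m"
    then obtain v where v: "v \<in> V" "x = s \<otimes> v" by (rule mE)
    have "x \<otimes> y \<noteq> \<one>" if "y \<in> V" for y
      using nonunit[OF V_ops(4)[OF v(1) that]] v that sc Vc by (simp add: m_assoc)
    then show "x \<in> max_ideal (R\<lparr>carrier := V\<rparr>)" using max_ideal_subring[OF V] \<open>x \<in> m\<close> mV by blast
  qed
qed

text \<open>By the product rule, a derivation that maps \<open>s\<close> into the maximal ideal maps all multiples of \<open>s\<close> into it.\<close>

lemma derivation_moves_uniformizer:
  assumes \<theta>: "\<theta> \<in> derivations (R\<lparr>carrier := V\<rparr>) k" and x: "x \<in> m" "\<theta> x \<notin> m"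
  shows "\<theta> s \<notin> m"
proof
  assume "\<theta> s \<in> m"
  obtain v where v: "v \<in> V" "x = s \<otimes> v" using x(1) by (rule mE)
  have "\<theta> x = s \<otimes> \<theta> v \<oplus> v \<otimes> \<theta> s" unfolding v(2) by (rule derivationsD(3)[OF \<theta> s(1) v(1)])
  then show False
    using x(2) m_add[OF mI[OF derivationsD(1)[OF \<theta> v(1)]] m_mult[OF v(1) \<open>\<theta> s \<in> m\<close>]] by simp
qed

text \<open>If \<open>u = v\<^sup>p\<close> and \<open>n = p j\<close>, then \<open>t = (v s\<^sup>j)\<^sup>p\<close>.\<close>

lemma unit_part_not_pth_power:
  assumes t: "t = u \<otimes> s [^] (n::nat)" "p dvd n" and no_root: "\<And>w. w \<in> carrier R \<Longrightarrow> w [^] p \<noteq> t"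
  shows "u \<notin> pth_powers V"
proof
  assume "u \<in> pth_powers V"
  then obtain v where v: "v \<in> V" "u = v [^] p" by (auto simp: pth_powers_def)
  obtain j where j: "n = p * j" using t(2) by (elim dvdE)
  have "(v \<otimes> s [^] j) [^] p = t"
    unfolding t(1) v(2) j using Vc[OF v(1)] sc by (simp add: nat_pow_distrib nat_pow_pow mult.commute)
  then show False using no_root[of "v \<otimes> s [^] j"] Vc[OF v(1)] sc by simp
qed

end

section \<open>Wild divisors that are not invariant\<close>

theorem corollary7p14:
  fixes K :: "'a ring" and k F :: "'a set" and XX C :: "'a set set"
    and \<Delta> :: "'a set \<Rightarrow> rat" and c\<^sub>0 E :: "'a set" and t s u :: 'a and p n :: nat
  assumes "field K"
    and "subfield k K" and "algebraically_closed (K\<lparr>carrier := k\<rparr>)"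
    and "Factorial_Ring.prime p" and "add_pow K p \<one>\<^bsub>K\<^esub> = \<zero>\<^bsub>K\<^esub>"
    and "subfield F K" and "k \<subseteq> F" and "smooth_curve (K\<lparr>carrier := F\<rparr>) k C"
    and "closed_point (K\<lparr>carrier := F\<rparr>) C c\<^sub>0"
    and "family_of_pairs K k XX F C \<Delta>"
    and "normal_model K XX"
    and "\<And>c. closed_point (K\<lparr>carrier := F\<rparr>) C c \<Longrightarrow>
           demi_normal_fiber K XX c \<and> only_separable_nodes K XX c"
    and "geometrically_normal_fiber K XX F"
    and "log_canonical_divisor_Q_Cartier K k XX \<Delta>"
    and "prime_divisor_over K k XX E"
    and "dominates K c\<^sub>0 E"
    and "uniformizer K c\<^sub>0 t" and "uniformizer K E s"
    and "u \<in> Units (K\<lparr>carrier := E\<rparr>)" and "t = u \<otimes>\<^bsub>K\<^esub> s [^]\<^bsub>K\<^esub> n"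
    and "p dvd n"
    and "\<not> T_invariant K k E t"
  shows "p dvd gamma_w K k E s u"
proof -
  interpret K: field K by (rule assms(1))
  interpret K: char_p_field K p
    using assms(1,4,5) K.is_cring by (intro char_p_field.intro char_p_ring.intro char_p_ring_axioms.intro)
  let ?F = "K\<lparr>carrier := F\<rparr>"
  interpret F: field ?F by (rule K.subfield_iff(2)[OF assms(6)])
  have k: "k \<subseteq> carrier K" "k \<subseteq> carrier ?F" using subfieldE(3)[OF assms(2)] assms(7) by auto
  have perfect: "\<exists>b\<in>k. b [^]\<^bsub>K\<^esub> p = c" if "c \<in> k" for c
    using K.roots_in_algebraically_closed[OF assms(2,3) K.p_pos that] .

  \<comment> \<open>The local ring of \<open>E\<close> is a discrete valuation ring, finitely generated over its \<open>p\<close>-th powers.\<close>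
  obtain Y where Y: "scheme_model K k Y" "E \<in> codim_one_points K Y"
    using assms(15) unfolding prime_divisor_over_def by (elim exE conjE)
  have s: "s \<in> E" "s \<noteq> \<zero>\<^bsub>K\<^esub>" "max_ideal (K\<lparr>carrier := E\<rparr>) = PIdl\<^bsub>K\<lparr>carrier := E\<rparr>\<^esub> s"
    using assms(18) unfolding uniformizer_def by blast+
  interpret E: char_p_dvr K p E s by (rule K.codim_one_point_is_dvr[OF k(1) Y s])
  have EY: "E \<in> Y" using Y(2) by simp
  obtain A P where A: "ess_finite_type K k A" "primeideal P (K\<lparr>carrier := A\<rparr>)" "E = localize_at K A P"
    by (rule K.model_point[OF k(1) Y(1) EY])
  have fin: "k \<subseteq> K.pth_powers E"
    "\<exists>G. finite G \<and> G \<subseteq> E \<and> (\<forall>B. subring B K \<longrightarrow> K.pth_powers E \<subseteq> B \<longrightarrow> G \<subseteq> B \<longrightarrow> E \<subseteq> B)"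
    by (rule K.finitely_generated_over_pth_powers[OF k(1) _ A], erule perfect)+
  obtain G where G: "finite G" "G \<subseteq> E"
    and gen: "\<forall>B. subring B K \<longrightarrow> K.pth_powers E \<subseteq> B \<longrightarrow> G \<subseteq> B \<longrightarrow> E \<subseteq> B"
    using fin(2) by (elim exE conjE)

  \<comment> \<open>The local ring of the closed point: its fraction field is \<open>F\<close>, and \<open>t\<close> vanishes along \<open>E\<close>.\<close>
  have C: "scheme_model ?F k C" using assms(8) unfolding smooth_curve_def by (elim conjE)
  have c0C: "c\<^sub>0 \<in> C" using assms(9) by simp
  obtain B Q where B: "subring B ?F" "primeideal Q (?F\<lparr>carrier := B\<rparr>)" "c\<^sub>0 = localize_at ?F B Q"
    "carrier ?F = {a \<otimes>\<^bsub>?F\<^esub> inv\<^bsub>?F\<^esub> b | a b. a \<in> B \<and> b \<in> B - {\<zero>\<^bsub>?F\<^esub>}}"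
    by (rule F.model_point[OF k(2) C c0C])
  have Bc0: "B \<subseteq> c\<^sub>0" using F.localize_at_subring(2)[OF B(1,2)] B(3) by simp
  have c0: "subring c\<^sub>0 K"
    using K.subring_of_subfield[OF assms(6)] F.localize_at_subring(1)[OF B(1,2)] B(3) by simp
  have t: "t \<in> c\<^sub>0" "t \<noteq> \<zero>\<^bsub>K\<^esub>" "max_ideal (K\<lparr>carrier := c\<^sub>0\<rparr>) = PIdl\<^bsub>K\<lparr>carrier := c\<^sub>0\<rparr>\<^esub> t"
    using assms(17) unfolding uniformizer_def by blast+
  have c0E: "c\<^sub>0 \<subseteq> E" "max_ideal (K\<lparr>carrier := c\<^sub>0\<rparr>) \<subseteq> E.m"
    using assms(16) E.max_ideal_is_m unfolding dominates_def by auto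
  have tm: "t \<in> E.m"
  proof -
    interpret c0: cring "K\<lparr>carrier := c\<^sub>0\<rparr>" using K.subring_is_domain[OF c0] domain_def by blast
    have "t \<in> PIdl\<^bsub>K\<lparr>carrier := c\<^sub>0\<rparr>\<^esub> t" using c0.cgenideal_self[of t] t(1) by simp
    then show ?thesis using t(3) c0E(2) by blast
  qed

  \<comment> \<open>The uniformizer of the curve is not a \<open>p\<close>-th power in \<open>K\<close>: a root would lie in \<open>F\<close>, as the generic fiber is geometrically reduced.\<close>
  have FC: "F \<in> C" using F.generic_point[OF k(2) C] by simp
  have XX: "scheme_model K k XX" "geometrically_reduced_fiber K XX F"
    using assms(10) FC unfolding family_of_pairs_def by blast+
  have no_root: "w [^]\<^bsub>K\<^esub> p \<noteq> t" if w: "w \<in> carrier K" for w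
  proof
    assume root: "w [^]\<^bsub>K\<^esub> p = t"
    have tF: "t \<in> F" using t(1) F.localize_at_subring(1)[OF B(1,2), THEN subringE(1)] B(3) by auto
    have "w \<in> F"
      using K.pth_root_in_generic_base[OF assms(6) K.generic_point[OF k(1) XX(1)] XX(2) w] root tF by simp
    then have "w \<in> carrier ?F" by simp
    then have "w \<in> {a \<otimes>\<^bsub>?F\<^esub> inv\<^bsub>?F\<^esub> b | a b. a \<in> B \<and> b \<in> B - {\<zero>\<^bsub>?F\<^esub>}}"
      by (rule subst[OF B(4)])
    then obtain a b where ab: "w = a \<otimes>\<^bsub>?F\<^esub> inv\<^bsub>?F\<^esub> b" "a \<in> B" "b \<in> B - {\<zero>\<^bsub>?F\<^esub>}"
      by blast
    have BF: "x \<in> F" "x \<in> carrier K" if "x \<in> B" for x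
      using that subringE(1)[OF B(1)] subfieldE(3)[OF assms(6)] by auto
    have b: "b \<in> F" "b \<in> B" "b \<noteq> \<zero>\<^bsub>K\<^esub>" using ab(3) BF by auto
    have "w \<otimes>\<^bsub>?F\<^esub> b = a"
      unfolding ab(1) using F.nonzero_inv[of b] b BF(1)[OF ab(2)] F.m_assoc[of a "inv\<^bsub>?F\<^esub> b" b] F.r_one[of a]
      by simp
    then have "a = w \<otimes>\<^bsub>K\<^esub> b" by simp
    then have "a [^]\<^bsub>K\<^esub> p = t \<otimes>\<^bsub>K\<^esub> b [^]\<^bsub>K\<^esub> p"
      using K.nat_pow_distrib[OF w BF(2)[OF b(2)], of p] root by simp
    moreover have "a \<in> c\<^sub>0" "b \<in> c\<^sub>0" using Bc0 ab(2) b(2) by auto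
    ultimately show False
      using E.uniformizer_not_pth_power[OF c0 c0E(1) t(1,2) tm] K.principal_max_ideal_units[OF c0 t(1,3)] b(3)
      by blast
  qed

  \<comment> \<open>As \<open>E\<close> is not invariant, some derivation that kills \<open>t\<close> moves the uniformizer \<open>s\<close> out of the maximal ideal.\<close>
  obtain \<theta> x where \<theta>: "\<theta> \<in> derivations (K\<lparr>carrier := E\<rparr>) k" "\<theta> t = \<zero>\<^bsub>K\<^esub>" and x: "x \<in> E.m" "\<theta> x \<notin> E.m"
    using assms(22) unfolding T_invariant_def E.max_ideal_is_m by blast
  have uE: "u \<in> E" using assms(19) by (simp add: Units_def)
  have "\<theta> u = \<zero>\<^bsub>K\<^esub>"
    using E.kills_unit_part[OF \<theta>(1) uE assms(21)] \<theta>(2) assms(20) by simp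
  moreover have "u \<notin> K.pth_powers E"
    using E.unit_part_not_pth_power[OF assms(20,21)] no_root by blast
  ultimately show ?thesis
    unfolding gamma_w_def
    using E.p_divides_order_of_differential[OF G _ fin(1) uE _ \<theta>(1) _ E.derivation_moves_uniformizer[OF \<theta>(1) x]] gen
    by blast
qed

end
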